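(* Let $N\ge 1$ be an integer and $s\in(0,1)$. Let $\Omega\subset\mathbb{R}^N$ be a bounded domain such that for some $R>0$, $$B_R\subset\Omega\subset B_{2R},$$ and such that there exists $c_0>0$ with $$|\Omega_t|\le c_0R^{N-1}\quad\text{for all } t>0,$$ where $\Omega_t=\{x\in\Omega:\ \rho(x)=\mathrm{dist}(x,\partial\Omega)=t\}$ and $|\Omega_t|$ denotes its $(N-1)$-dimensional Hausdorff measure. Let $\{\lambda_{s,i}(\Omega)\}_{i\in\mathbb{N}}$ be the increasing sequence of eigenvalues (counted with multiplicity) of the Dirichlet problem $$(-\Delta)^s u=\lambda u\ \text{ in }\Omega,\qquad u=0\ \text{ in }\mathbb{R}^N\setminus\Omega.$$ Then $$\lim_{k\to+\infty}k^{-1-\frac{2s}{N}}\sum_{i=1}^k\lambda_{s,i}(\Omega)=\frac{(2\pi)^{2s}N}{N+2s}\,(|B_1||\Omega|)^{-\frac{2s}{N}}.$$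
   Context: $B_r$ is the open ball of radius $r$ centered at the origin of $\mathbb{R}^N$; $|B_1|$ and $|\Omega|$ denote Lebesgue measure. A domain is a nonempty connected open set. For $s\in(0,1)$, $(-\Delta)^s u(x)=c_{N,s}\lim_{\epsilon\to0^+}\int_{\mathbb{R}^N\setminus B_\epsilon(x)}\frac{u(x)-u(y)}{|x-y|^{N+2s}}\,dy$ with $c_{N,s}=2^{2s}\pi^{-\frac N2}s\frac{\Gamma(\frac{N+2s}{2})}{\Gamma(1-s)}$. Eigenvalues are understood in the weak sense. Let $\mathbb{H}^s_0(\Omega)$ be the space of measurable $u:\mathbb{R}^N\to\mathbb{R}$ with $u\equiv0$ in $\mathbb{R}^N\setminus\Omega$ and $\int_{\mathbb{R}^N}\int_{\mathbb{R}^N}\frac{|u(x)-u(y)|^2}{|x-y|^{N+2s}}\,dx\,dy<+\infty$; it is a Hilbert space with inner product $$\mathcal{E}_s(u,w)=\frac{c_{N,s}}{2}\int_{\mathbb{R}^N}\int_{\mathbb{R}^N}\frac{(u(x)-u(y))(w(x)-w(y))}{|x-y|^{N+2s}}\,dx\,dy.$$ A nonzero $u\in\mathbb{H}^s_0(\Omega)$ is an eigenfunction with eigenvalue $\lambda$ if $\mathcal{E}_s(u,w)=\lambda\int_\Omega uw\,dx$ for all $w\in\mathbb{H}^s_0(\Omega)$. It is known that the eigenvalues, repeated according to multiplicity, form a sequence $0<\lambda_{s,1}(\Omega)<\lambda_{s,2}(\Omega)\le\lambda_{s,3}(\Omega)\le\cdots\to+\infty$ with corresponding eigenfunctions $\phi_i$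 forming an orthonormal basis of $L^2(\Omega)$, and that $\lambda_{s,i}(\Omega)=\min\{\mathcal{E}_s(u,u): u\in\mathbb{H}^s_0(\Omega),\ \|u\|_{L^2(\Omega)}=1,\ \int_\Omega u\phi_j\,dx=0\text{ for } j=1,\dots,i-1\}$. *)

theory Defs
  imports "HOL-Analysis.Analysis"
begin

definition frac_lap_const :: "nat \<Rightarrow> real \<Rightarrow> real" where
  "frac_lap_const N s =
     2 powr (2 * s) * pi powr (- (real N / 2)) * s *
       Gamma ((real N + 2 * s) / 2) / Gamma (1 - s)"

text \<open>
  The fractional Dirichlet space. On the diagonal the integrand below has the value \<open>0\<close>
  (division by zero), which is harmless because the diagonal is a null set. Elements are genuine
  functions, not classes modulo equality almost everywhere.
\<close>

definition frac_H0 :: "real \<Rightarrow> 'a::euclidean_space set \<Rightarrow> ('a \<Rightarrow> real) set" where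
  "frac_H0 s \<Omega> = {u. u \<in> borel_measurable lebesgue \<and> (\<forall>x. x \<notin> \<Omega> \<longrightarrow> u x = 0) \<and>
     integrable (lebesgue \<Otimes>\<^sub>M lebesgue)
       (\<lambda>(x, y). \<bar>u x - u y\<bar>\<^sup>2 / norm (x - y) powr (real DIM('a) + 2 * s))}"

definition frac_energy ::
    "real \<Rightarrow> ('a::euclidean_space \<Rightarrow> real) \<Rightarrow> ('a \<Rightarrow> real) \<Rightarrow> real" where
  "frac_energy s u w = frac_lap_const DIM('a) s / 2 *
     (LINT (x, y) | (lebesgue \<Otimes>\<^sub>M lebesgue).
        (u x - u y) * (w x - w y) / norm (x - y) powr (real DIM('a) + 2 * s))"

text \<open>
  The weak solutions \<open>u\<close> of \<open>(-\<Delta>)\<^sup>s u = \<mu> u\<close> in \<open>\<Omega>\<close> with \<open>u = 0\<close> outside \<open>\<Omega>\<close>, i.e. the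
  eigenfunctions for \<open>\<mu>\<close> together with the functions vanishing almost everywhere.
\<close>

definition frac_eigenspace ::
    "real \<Rightarrow> 'a::euclidean_space set \<Rightarrow> real \<Rightarrow> ('a \<Rightarrow> real) set" where
  "frac_eigenspace s \<Omega> \<mu> = {u \<in> frac_H0 s \<Omega>.
     \<forall>w \<in> frac_H0 s \<Omega>. frac_energy s u w = \<mu> * (LINT x:\<Omega>|lebesgue. u x * w x)}"

text \<open>
  The eigenspace of \<open>\<mu>\<close>, modulo equality almost everywhere, has dimension \<open>m\<close>: it has a basis
  \<open>\<phi> 0, \<dots>, \<phi> (m - 1)\<close>. Multiplicity \<open>0\<close> means that \<open>\<mu>\<close> is not an eigenvalue.
\<close>

definition frac_multiplicity ::
    "real \<Rightarrow> 'a::euclidean_space set \<Rightarrow> real \<Rightarrow> nat \<Rightarrow> bool" where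
  "frac_multiplicity s \<Omega> \<mu> m \<longleftrightarrow> (\<exists>\<phi>.
     (\<forall>i<m. \<phi> i \<in> frac_eigenspace s \<Omega> \<mu>) \<and>
     (\<forall>c. (AE x in lebesgue. (\<Sum>i<m. c i * \<phi> i x) = 0) \<longrightarrow> (\<forall>i<m. c i = 0)) \<and>
     (\<forall>u \<in> frac_eigenspace s \<Omega> \<mu>. \<exists>c. AE x in lebesgue. u x = (\<Sum>i<m. c i * \<phi> i x)))"

text \<open>
  The eigenvalues in increasing order, each as often as its multiplicity, indexed from \<open>1\<close>;
  the value at \<open>0\<close> is irrelevant.
\<close>

definition frac_eigenvalue_seq ::
    "real \<Rightarrow> 'a::euclidean_space set \<Rightarrow> (nat \<Rightarrow> real) \<Rightarrow> bool" where
  "frac_eigenvalue_seq s \<Omega> ev \<longleftrightarrow> mono_on {1..} ev \<and>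
     (\<forall>\<mu>. finite {i. 1 \<le> i \<and> ev i = \<mu>} \<and>
          frac_multiplicity s \<Omega> \<mu> (card {i. 1 \<le> i \<and> ev i = \<mu>}))"

text \<open>
  The \<open>d\<close>-dimensional Hausdorff (outer) measure, normalised so that for \<open>d\<close> equal to the
  dimension of the space it is Lebesgue measure. Empty covering sets contribute \<open>0\<close>; for
  \<open>d = 0\<close> a nonempty one contributes \<open>1\<close> (as \<open>0 ^ 0 = 1\<close>), giving counting measure.
  Boundedness is required explicitly because \<open>diameter\<close> is unspecified on unbounded sets.
\<close>

definition hausdorff_content :: "nat \<Rightarrow> real \<Rightarrow> 'a::metric_space set \<Rightarrow> ennreal" where
  "hausdorff_content d \<delta> A =
     (INF U \<in> {U :: nat \<Rightarrow> 'a set.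
                 A \<subseteq> (\<Union>i. U i) \<and> (\<forall>i. bounded (U i) \<and> diameter (U i) \<le> \<delta>)}.
        \<Sum>i. if U i = {} then 0
             else ennreal (unit_ball_vol (real d) * (diameter (U i) / 2) ^ d))"

definition hausdorff_measure :: "nat \<Rightarrow> 'a::metric_space set \<Rightarrow> ennreal" where
  "hausdorff_measure d A = (SUP \<delta> \<in> {0<..}. hausdorff_content d \<delta> A)"

end

theory Submission
  imports Defs "HOL-Probability.Characteristic_Functions" "HOL-Complex_Analysis.Great_Picard"
begin

text \<open>
  Both bounds are semiclassical. They use Plancherel's theorem for functions of finite energy,
  obtained by Gaussian regularisation, the identity
  \<open>c \<integral> (1 - cos (\<xi> \<bullet> z)) / |z|\<^bsup>N + 2 s\<^esup> dz = |\<xi>|\<^bsup>2 s\<^esup>\<close>, and the variational characterisation of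
  the eigenvalues.

  For orthonormal \<open>\<phi> i\<close> with power spectra \<open>P i\<close>, the form satisfies
  \<open>(2 \<pi>)\<^sup>N (\<mu> - E (\<phi> i)) \<le> \<integral> max 0 (\<mu> - |\<xi>|\<^bsup>2 s\<^esup>) P i \<xi> d\<xi>\<close>, while \<open>\<Sum> P i \<le> |\<Omega>|\<close> pointwise; this is
  the Berezin--Li--Yau bound, an upper bound for the trace of the positive part of \<open>\<mu> - E\<close>.
  Conversely, testing \<open>\<mu> - E\<close> with \<open>v x cos (\<xi> \<bullet> x)\<close> and \<open>v x sin (\<xi> \<bullet> x)\<close> for a cut-off \<open>v\<close>
  and integrating over \<open>\<xi>\<close> bounds the trace from below by
  \<open>(2 \<pi>)\<^bsup>-N\<^esup> \<integral> max 0 ((\<mu> - |\<xi>|\<^bsup>2 s\<^esup>) \<parallel>v\<parallel>\<^sup>2 - E v) d\<xi>\<close>, because the two test functions together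
  have energy at most \<open>E v + |\<xi>|\<^bsup>2 s\<^esup> \<parallel>v\<parallel>\<^sup>2\<close>. Letting \<open>v\<close> increase to the indicator function of
  \<open>\<Omega>\<close>, and passing from traces to eigenvalue sums by the Legendre transform
  \<open>\<Sum>\<^bsub>i \<le> k\<^esub> \<lambda> i = max\<^bsub>\<mu>\<^esub> (k \<mu> - \<Sum> max 0 (\<mu> - \<lambda> i))\<close>, gives the limit. Completeness of the
  eigenfunctions enters through the existence of Rayleigh minimizers on the orthogonal complement
  of finitely many eigenfunctions.
\<close>

section \<open>The symbol of the fractional Laplacian\<close>

text \<open>Plancherel's identity is used as two inequalities, each in the direction in which
  \<open>\<mu> * ip u u - en u u\<close> has to be bounded above: the total power spectrum from
  below, its moment of order \<open>2 * s\<close> from above. Only squared moduli of transforms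
  occur, so real cosine and sine transforms carry the whole Fourier side. Of the spectrum one is
  given a monotone enumeration in which every real number occurs as often as the dimension of its
  eigenspace. That the eigenvalues diverge is extracted from the Berezin--Li--Yau bound itself. The
  given forms live on functions measurable for \<open>lebesgue\<close> and on
  \<open>lebesgue \<Otimes>\<^sub>M lebesgue\<close>. The analysis is done for Borel functions on
  \<open>lborel\<close>, and a change of representatives connects the two. With
  \<open>a = N / (2 * s)\<close> and \<open>D\<close> the product of the two volumes divided by
  \<open>(2 * pi) ^ N\<close>, the trace of the positive part behaves like
  \<open>D * \<mu> powr (1 + a) / (1 + a)\<close>; its Legendre transform in \<open>k\<close> is
  \<open>k powr (1 + 1 / a)\<close> times the constant of the theorem.\<close>

lemma gaussian_cis_integral_real:
  fixes t \<zeta> :: real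
  assumes t: "0 < t"
  shows "integrable lborel (\<lambda>x. complex_of_real (exp (- t * x\<^sup>2)) * iexp (\<zeta> * x))"
    and "(LBINT x. complex_of_real (exp (- t * x\<^sup>2)) * iexp (\<zeta> * x)) =
      complex_of_real (sqrt (pi / t) * exp (- \<zeta>\<^sup>2 / (4 * t)))"
proof -
  \<comment> \<open>With \<open>c = sqrt (2 * t)\<close> the factor \<open>exp (- t * x^2)\<close>
    is \<open>exp (- (c * x)^2 / 2)\<close>, so the integral is a rescaled characteristic function
    of the standard normal distribution.\<close>
  define c where "c = sqrt (2 * t)"
  have c: "c > 0" and c2: "c\<^sup>2 = 2 * t" using t by (auto simp: c_def)
  have st: "complex_of_real (exp (- t * x\<^sup>2)) * iexp (\<zeta> * x) =
      sqrt (2 * pi) *\<^sub>R (std_normal_density (0 + c * x) *\<^sub>R iexp (\<zeta> / c * (0 + c * x)))" for x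
    using c c2 t by (simp add: std_normal_density_def power_mult_distrib scaleR_conv_of_real mult.assoc)
  have int: "integrable lborel (\<lambda>x. std_normal_density x *\<^sub>R iexp (\<zeta> / c * x))"
    by (rule Bochner_Integration.integrable_bound[of lborel std_normal_density])
       (auto simp: integrable_normal_density)
  show "integrable lborel (\<lambda>x. complex_of_real (exp (- t * x\<^sup>2)) * iexp (\<zeta> * x))"
    unfolding st using c
    by (intro integrable_scaleR_right lborel_integrable_real_affine[OF int]) auto
  have "complex_of_real (exp (- (\<zeta> / c)\<^sup>2 / 2)) = char std_normal_distribution (\<zeta> / c)"
    by (simp add: char_std_normal_distribution)
  also have "\<dots> = (LBINT x. std_normal_density x *\<^sub>R iexp (\<zeta> / c * x))"
    unfolding char_def by (subst integral_density) (auto simp: mult.commute)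
  also have "\<dots> = \<bar>c\<bar> *\<^sub>R (LBINT x. std_normal_density (0 + c * x) *\<^sub>R iexp (\<zeta> / c * (0 + c * x)))"
    using c by (subst lborel_integral_real_affine[of c _ 0]) auto
  finally have eq: "complex_of_real (exp (- (\<zeta> / c)\<^sup>2 / 2)) = \<dots>" .
  have "(LBINT x. complex_of_real (exp (- t * x\<^sup>2)) * iexp (\<zeta> * x)) =
    sqrt (2 * pi) *\<^sub>R (LBINT x. std_normal_density (0 + c * x) *\<^sub>R iexp (\<zeta> / c * (0 + c * x)))"
    unfolding st by (subst integral_scaleR_right) auto
  also have "\<dots> = complex_of_real (sqrt (2 * pi) / c * exp (- (\<zeta> / c)\<^sup>2 / 2))"
    using eq c by (simp add: scaleR_conv_of_real)
  also have "sqrt (2 * pi) / c = sqrt (pi / t)"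
    using t unfolding c_def by (simp add: real_sqrt_divide[symmetric])
  also have "- (\<zeta> / c)\<^sup>2 / 2 = - \<zeta>\<^sup>2 / (4 * t)"
    using t by (simp add: power_divide c2)
  finally show "(LBINT x. complex_of_real (exp (- t * x\<^sup>2)) * iexp (\<zeta> * x)) =
      complex_of_real (sqrt (pi / t) * exp (- \<zeta>\<^sup>2 / (4 * t)))" .
qed

text \<open>The complex exponential factors over the coordinates while the cosine does not. Hence
  the integral is computed as a product of one-dimensional complex integrals, and the real part is
  taken at the end.\<close>

lemma gaussian_cos_integral:
  fixes \<xi> :: "'a::euclidean_space"
  assumes t: "0 < t"
  shows "integrable lborel (\<lambda>z::'a. exp (- t * (norm z)\<^sup>2) * cos (\<xi> \<bullet> z))"
    and "(LBINT z. exp (- t * (norm z)\<^sup>2) * cos (\<xi> \<bullet> z)) =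
      (pi / t) powr (real DIM('a) / 2) * exp (- (norm \<xi>)\<^sup>2 / (4 * t))"
proof -
  interpret P: product_sigma_finite "\<lambda>_::'a. lborel :: real measure" ..
  let ?h = "\<lambda>b x. complex_of_real (exp (- t * x\<^sup>2)) * iexp ((\<xi> \<bullet> b) * x)"
  let ?g = "\<lambda>z::'a. complex_of_real (exp (- t * (norm z)\<^sup>2)) * iexp (\<xi> \<bullet> z)"
  have g: "?g z = (\<Prod>b\<in>Basis. ?h b (z \<bullet> b))" for z
  proof -
    have "(norm z)\<^sup>2 = (\<Sum>b\<in>Basis. (z \<bullet> b)\<^sup>2)"
      by (simp add: power2_norm_eq_inner power2_eq_square[of "z \<bullet> _"] euclidean_inner[symmetric])
    moreover have "\<xi> \<bullet> z = (\<Sum>b\<in>Basis. (\<xi> \<bullet> b) * (z \<bullet> b))"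
      by (rule euclidean_inner)
    ultimately show ?thesis
      by (simp add: prod.distrib exp_sum sum_distrib_left flip: of_real_prod sum_negf)
  qed
  have int1: "integrable lborel (?h b)" for b by (rule gaussian_cis_integral_real[OF t])
  have intP: "integrable (\<Pi>\<^sub>M b\<in>Basis. lborel) (\<lambda>f. \<Prod>b\<in>(Basis::'a set). ?h b (f b))"
    by (rule P.product_integrable_prod) (rule finite_Basis, rule int1)
  have meas: "(\<lambda>f. \<Sum>b\<in>(Basis::'a set). f b *\<^sub>R b) \<in> (\<Pi>\<^sub>M b\<in>Basis. lborel) \<rightarrow>\<^sub>M borel"
    by measurable
  have inner: "(\<Sum>b\<in>(Basis::'a set). f b *\<^sub>R b) \<bullet> b' = f b'" if "b' \<in> Basis" for f :: "'a \<Rightarrow> real" and b'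
    using that by (simp add: inner_sum_left inner_Basis if_distrib cong: if_cong)
  have comp: "?g (\<Sum>b\<in>Basis. f b *\<^sub>R b) = (\<Prod>b\<in>Basis. ?h b (f b))" for f
    unfolding g by (intro prod.cong refl) (simp only: inner)
  have gm: "?g \<in> borel_measurable borel" by measurable
  have int: "integrable lborel ?g"
    unfolding lborel_eq[where 'a='a]
    by (subst integrable_distr_eq[OF meas gm]) (simp only: comp intP)
  have "integral\<^sup>L lborel ?g = (LINT f|(\<Pi>\<^sub>M b\<in>Basis. lborel). (\<Prod>b\<in>(Basis::'a set). ?h b (f b)))"
    unfolding lborel_eq[where 'a='a] by (subst integral_distr[OF meas gm]) (simp only: comp)
  also have "\<dots> = (\<Prod>b\<in>(Basis::'a set). integral\<^sup>L lborel (?h b))"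
    by (rule P.product_integral_prod) (rule finite_Basis, rule int1)
  also have "\<dots> = (\<Prod>b\<in>(Basis::'a set). complex_of_real (sqrt (pi / t) * exp (- (\<xi> \<bullet> b)\<^sup>2 / (4 * t))))"
    by (intro prod.cong refl gaussian_cis_integral_real(2)[OF t])
  also have "\<dots> = complex_of_real (\<Prod>b\<in>(Basis::'a set). sqrt (pi / t) * exp (- (\<xi> \<bullet> b)\<^sup>2 / (4 * t)))"
    by simp
  also have "(\<Prod>b\<in>(Basis::'a set). sqrt (pi / t) * exp (- (\<xi> \<bullet> b)\<^sup>2 / (4 * t))) =
      sqrt (pi / t) ^ DIM('a) * exp (- (norm \<xi>)\<^sup>2 / (4 * t))"
  proof -
    have "- (norm \<xi>)\<^sup>2 / (4 * t) = (\<Sum>b\<in>(Basis::'a set). - (\<xi> \<bullet> b)\<^sup>2 / (4 * t))"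
      unfolding sum_divide_distrib[symmetric] sum_negf
      by (simp add: power2_norm_eq_inner power2_eq_square[of "\<xi> \<bullet> _"] euclidean_inner[symmetric])
    then show ?thesis by (simp add: prod.distrib exp_sum)
  qed
  also have "sqrt (pi / t) ^ DIM('a) = (pi / t) powr (real DIM('a) / 2)"
    using t by (simp add: powr_half_sqrt[symmetric] powr_realpow[symmetric] powr_powr)
  finally have val: "integral\<^sup>L lborel ?g = complex_of_real ((pi / t) powr (real DIM('a) / 2) *
      exp (- (norm \<xi>)\<^sup>2 / (4 * t)))" .
  have re: "exp (- t * (norm z)\<^sup>2) * cos (\<xi> \<bullet> z) = Re (?g z)" for z
    by (simp add: Re_exp)
  show "integrable lborel (\<lambda>z::'a. exp (- t * (norm z)\<^sup>2) * cos (\<xi> \<bullet> z))"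
    unfolding re by (rule integrable_Re[OF int])
  show "(LBINT z. exp (- t * (norm z)\<^sup>2) * cos (\<xi> \<bullet> z)) =
      (pi / t) powr (real DIM('a) / 2) * exp (- (norm \<xi>)\<^sup>2 / (4 * t))"
    unfolding re integral_Re[OF int] val by (rule Re_complex_of_real)
qed

section \<open>Subordination: powers as mixtures of exponentials\<close>

text \<open>Writes a negative power of \<open>b\<close> as a superposition of the exponentials
  \<open>exp (- b * t)\<close>; with \<open>b = |z|^2\<close> it resolves the energy kernel into
  Gaussians.\<close>

lemma nn_integral_Gamma_scaled:
  fixes p b :: real
  assumes "0 < p" "0 < b"
  shows "(\<integral>\<^sup>+t. ennreal (indicator {0<..} t * (t powr (p - 1) * exp (- b * t))) \<partial>lborel) =
    ennreal (Gamma p / b powr p)"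
proof -
  let ?f = "\<lambda>t. ennreal (indicator {0..} t * t powr (p - 1) / exp t)"
  have "ennreal (Gamma p) = \<bar>b\<bar> * (\<integral>\<^sup>+t. ?f (0 + b * t) \<partial>lborel)"
    using assms by (subst Gamma_conv_nn_integral_real[OF assms(1)])
      (rule nn_integral_real_affine, auto)
  also have "(\<integral>\<^sup>+t. ?f (0 + b * t) \<partial>lborel) =
      (\<integral>\<^sup>+t. ennreal (b powr (p - 1)) * ennreal (indicator {0<..} t * (t powr (p - 1) * exp (- b * t))) \<partial>lborel)"
    using assms
    by (intro nn_integral_cong)
       (auto simp: indicator_def powr_mult exp_minus field_simps zero_le_mult_iff ennreal_mult'[symmetric])
  also have "\<dots> = ennreal (b powr (p - 1)) *
      (\<integral>\<^sup>+t. ennreal (indicator {0<..} t * (t powr (p - 1) * exp (- b * t))) \<partial>lborel)"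
    by (rule nn_integral_cmult) auto
  finally have "ennreal (Gamma p) = ennreal (b powr p) *
      (\<integral>\<^sup>+t. ennreal (indicator {0<..} t * (t powr (p - 1) * exp (- b * t))) \<partial>lborel)"
    using assms by (simp add: mult.assoc[symmetric] ennreal_mult'[symmetric] powr_diff)
  then have "ennreal (1 / b powr p) * ennreal (Gamma p) = ennreal (1 / b powr p) * ennreal (b powr p) *
      (\<integral>\<^sup>+t. ennreal (indicator {0<..} t * (t powr (p - 1) * exp (- b * t))) \<partial>lborel)"
    by (simp add: mult.assoc)
  then show ?thesis
    using assms by (simp add: ennreal_mult'[symmetric] Gamma_real_pos)
qed

text \<open>Comes from the Gamma integral of order \<open>1 - s\<close> by
  \<open>t \<mapsto> 1 / t\<close>, whose Jacobian \<open>1 / t^2\<close> turns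
  \<open>t powr s\<close> into \<open>t powr (s - 2)\<close>.\<close>

lemma nn_integral_inverse_Gamma:
  fixes s r :: real
  assumes s: "s < 1" and r: "0 < r"
  shows "(\<integral>\<^sup>+t. ennreal (indicator {0<..} t * (t powr (s - 2) * exp (- r / t))) \<partial>lborel) =
    ennreal (Gamma (1 - s) * r powr (s - 1))"
proof -
  let ?f = "\<lambda>u. u powr (- s) * exp (- r * u)"
  have G: "Gamma (1 - s) / r powr (1 - s) = Gamma (1 - s) * r powr (s - 1)"
    using powr_minus_divide[of r "1 - s"] by simp
  have nn: "(\<integral>\<^sup>+t. ennreal (indicator {0<..} t * ?f t) \<partial>lborel) = ennreal (Gamma (1 - s) * r powr (s - 1))"
    using nn_integral_Gamma_scaled[of "1 - s" r] s r G by simp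
  have nneg: "0 \<le> Gamma (1 - s) * r powr (s - 1)"
    using s by (simp add: Gamma_real_pos less_imp_le)
  have "((\<lambda>t. indicator {0<..} t * ?f t) has_integral (Gamma (1 - s) * r powr (s - 1))) UNIV"
    by (rule nn_integral_has_integral) (use nn nneg in \<open>auto\<close>)
  moreover have "(\<lambda>t. indicator {0<..} t * ?f t) = (\<lambda>t. if t \<in> {0<..} then ?f t else 0)"
    by (auto simp: indicator_def)
  ultimately have hi: "(?f has_integral (Gamma (1 - s) * r powr (s - 1))) {0<..}"
    by (simp only: has_integral_restrict_UNIV)
  then have ai: "?f absolutely_integrable_on {0<..}"
    by (intro nonnegative_absolutely_integrable_1) (auto simp: integrable_on_def)
  have im: "(\<lambda>t. 1 / t) ` {0<..} = {0::real<..}"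
  proof (intro equalityI subsetI)
    fix x :: real assume "x \<in> {0<..}"
    then show "x \<in> (\<lambda>t. 1 / t) ` {0<..}" by (intro image_eqI[of _ _ "1 / x"]) auto
  qed auto
  have "(\<lambda>t. \<bar>- (1 / t\<^sup>2)\<bar> * ?f (1 / t)) absolutely_integrable_on {0<..} \<and>
      integral {0<..} (\<lambda>t. \<bar>- (1 / t\<^sup>2)\<bar> * ?f (1 / t)) = Gamma (1 - s) * r powr (s - 1)"
  proof (subst has_absolute_integral_change_of_variables_1'[where g = "\<lambda>t. 1 / t"])
    show "((\<lambda>t. 1 / t) has_field_derivative - (1 / t\<^sup>2)) (at t within {0<..})" if "t \<in> {0<..}" for t :: real
      using that by (auto intro!: derivative_eq_intros simp: power2_eq_square)
    show "?f absolutely_integrable_on (\<lambda>t. 1 / t) ` {0<..} \<and>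
        integral ((\<lambda>t. 1 / t) ` {0<..}) ?f = Gamma (1 - s) * r powr (s - 1)"
      unfolding im using ai hi by (auto dest: integral_unique)
  qed (auto simp: inj_on_def)
  then have "((\<lambda>t. \<bar>- (1 / t\<^sup>2)\<bar> * ?f (1 / t)) has_integral (Gamma (1 - s) * r powr (s - 1))) {0<..}"
    by (simp add: has_integral_iff set_lebesgue_integral_eq_integral(1))
  then have "((\<lambda>t. t powr (s - 2) * exp (- r / t)) has_integral (Gamma (1 - s) * r powr (s - 1))) {0<..}"
  proof (rule has_integral_eq[rotated])
    fix t :: real assume "t \<in> {0<..}"
    then have t: "t > 0" by simp
    have "(1 / t) powr (- s) = t powr s"
      using t by (simp add: powr_minus powr_divide)
    then show "\<bar>- (1 / t\<^sup>2)\<bar> * ?f (1 / t) = t powr (s - 2) * exp (- r / t)"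
      using t powr_diff[of t s 2] by simp
  qed
  from nn_integral_has_integral_lebesgue[OF _ this] show ?thesis by simp
qed

text \<open>Since \<open>1 - exp (- b / t)\<close> is the integral of
  \<open>exp (- r / t) / t\<close> over \<open>0 \<le> r \<le> b\<close>, Tonelli reduces the claim
  to the preceding integral and leaves a multiple of \<open>r powr (s - 1)\<close> to be integrated
  over that interval.\<close>

lemma nn_integral_powr_one_minus_exp:
  fixes s b :: real
  assumes s: "0 < s" "s < 1" and b: "0 \<le> b"
  shows "(\<integral>\<^sup>+t. ennreal (indicator {0<..} t * (t powr (s - 1) * (1 - exp (- b / t)))) \<partial>lborel) =
    ennreal (Gamma (1 - s) / s * b powr s)"
proof -
  let ?h = "\<lambda>r t. ennreal (indicator {0<..} t * (t powr (s - 2) * exp (- r / t))) * indicator {0..b} r"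
  have "(\<integral>\<^sup>+t. ennreal (indicator {0<..} t * (t powr (s - 1) * (1 - exp (- b / t)))) \<partial>lborel) =
      (\<integral>\<^sup>+t. (\<integral>\<^sup>+r. ?h r t \<partial>lborel) \<partial>lborel)"
  proof (rule nn_integral_cong)
    fix t :: real
    show "ennreal (indicator {0<..} t * (t powr (s - 1) * (1 - exp (- b / t)))) = (\<integral>\<^sup>+r. ?h r t \<partial>lborel)"
    proof (cases "t > 0")
      case True
      have "(\<integral>\<^sup>+r. ?h r t \<partial>lborel) = (\<integral>\<^sup>+r. ennreal (t powr (s - 2) * exp (- r / t)) * indicator {0..b} r \<partial>lborel)"
        using True by simp
      also have "\<dots> = ennreal (- (t powr (s - 1) * exp (- b / t)) - - (t powr (s - 1) * exp (- 0 / t)))"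
      proof (rule nn_integral_FTC_Icc)
        fix r
        have "t powr (s - 1) = t powr (s - 2) * t" using True powr_add[of t "s - 2" 1] by simp
        then show "((\<lambda>r. - (t powr (s - 1) * exp (- r / t))) has_real_derivative t powr (s - 2) * exp (- r / t)) (at r)"
          using True by (auto intro!: derivative_eq_intros)
      qed (use b in auto)
      also have "\<dots> = ennreal (indicator {0<..} t * (t powr (s - 1) * (1 - exp (- b / t))))"
        using True by (simp add: algebra_simps)
      finally show ?thesis ..
    qed simp
  qed
  also have "\<dots> = (\<integral>\<^sup>+r. (\<integral>\<^sup>+t. ?h r t \<partial>lborel) \<partial>lborel)"
    by (rule lborel_pair.Fubini') (simp add: case_prod_beta', measurable)
  also have "\<dots> = (\<integral>\<^sup>+r. ennreal (Gamma (1 - s) * r powr (s - 1)) * indicator {0..b} r \<partial>lborel)"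
  \<comment> \<open>At \<open>r = 0\<close> the integral over \<open>t\<close> diverges, so its
    closed form is available only for almost every \<open>r\<close>.\<close>
  proof (rule nn_integral_cong_AE, use AE_lborel_singleton[of "0::real"] in eventually_elim)
    fix r :: real assume "r \<noteq> 0"
    show "(\<integral>\<^sup>+t. ?h r t \<partial>lborel) = ennreal (Gamma (1 - s) * r powr (s - 1)) * indicator {0..b} r"
    proof (cases "r \<in> {0..b}")
      case True
      then have "r > 0" using \<open>r \<noteq> 0\<close> by auto
      then show ?thesis using nn_integral_inverse_Gamma[OF s(2), of r] True by simp
    qed simp
  qed
  also have "\<dots> = (\<integral>\<^sup>+r. ennreal (indicator {0..b} r * (Gamma (1 - s) * r powr (s - 1))) \<partial>lborel)"
    by (intro nn_integral_cong) (auto simp: indicator_def)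
  also have "\<dots> = ennreal (Gamma (1 - s) * (b powr s / s))"
  proof (rule nn_integral_has_integral_lebesgue)
    show "((\<lambda>r. Gamma (1 - s) * r powr (s - 1)) has_integral Gamma (1 - s) * (b powr s / s)) {0..b}"
      using has_integral_powr_from_0[of "s - 1" b] s b by (intro has_integral_mult_right) auto
  qed (use s in \<open>simp add: Gamma_real_pos less_imp_le\<close>)
  finally show ?thesis by simp
qed

lemma nn_integral_gaussian_one_minus_cos:
  fixes \<xi> :: "'a::euclidean_space"
  assumes t: "0 < t"
  shows "(\<integral>\<^sup>+z. ennreal (exp (- t * (norm z)\<^sup>2) * (1 - cos (\<xi> \<bullet> z))) \<partial>lborel) =
    ennreal ((pi / t) powr (real DIM('a) / 2) * (1 - exp (- (norm \<xi>)\<^sup>2 / (4 * t))))"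
proof -
  let ?G = "\<lambda>z::'a. exp (- t * (norm z)\<^sup>2)" and ?A = "(pi / t) powr (real DIM('a) / 2)"
  have I0: "integrable lborel ?G" "integral\<^sup>L lborel ?G = ?A"
    using gaussian_cos_integral[OF t, of "0::'a"] by simp_all
  note I1 = gaussian_cos_integral[OF t, of \<xi>]
  have "(\<integral>\<^sup>+z. ennreal (?G z * (1 - cos (\<xi> \<bullet> z))) \<partial>lborel) = (\<integral>\<^sup>+z. ennreal (?G z - ?G z * cos (\<xi> \<bullet> z)) \<partial>lborel)"
    by (simp only: right_diff_distrib mult_1_right)
  also have "\<dots> = ennreal (LBINT z. ?G z - ?G z * cos (\<xi> \<bullet> z))"
  proof (rule nn_integral_eq_integral[OF Bochner_Integration.integrable_diff[OF I0(1) I1(1)]], rule AE_I2)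
    show "0 \<le> ?G z - ?G z * cos (\<xi> \<bullet> z)" for z
      using mult_left_mono[OF cos_le_one[of "\<xi> \<bullet> z"], of "?G z"] by simp
  qed
  also have "(LBINT z. ?G z - ?G z * cos (\<xi> \<bullet> z)) = ?A * (1 - exp (- (norm \<xi>)\<^sup>2 / (4 * t)))"
    by (subst Bochner_Integration.integral_diff[OF I0(1) I1(1)])
       (simp only: I0(2) I1(2) right_diff_distrib mult_1_right)
  finally show ?thesis .
qed

lemma frac_lap_const_pos: "0 < s \<Longrightarrow> s < 1 \<Longrightarrow> 0 < frac_lap_const N s"
  by (auto simp: frac_lap_const_def intro!: divide_pos_pos mult_pos_pos Gamma_real_pos add_nonneg_pos)

text \<open>Resolving the kernel into Gaussians makes the integral over \<open>z\<close> explicit.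
  The remaining integral over \<open>t\<close> is homogeneous in \<open>norm \<xi>\<close> and
  produces the quotient of Gamma values that \<open>frac_lap_const\<close> is designed to
  cancel.\<close>

lemma nn_integral_one_minus_cos:
  fixes \<xi> :: "'a::euclidean_space"
  assumes s: "0 < s" "s < 1"
  shows "(\<integral>\<^sup>+z. ennreal ((1 - cos (\<xi> \<bullet> z)) / norm z powr (real DIM('a) + 2 * s)) \<partial>lborel) =
    ennreal (norm \<xi> powr (2 * s) / frac_lap_const DIM('a) s)"
proof -
  define p where "p = (real DIM('a) + 2 * s) / 2"
  have p: "p > 0" and p2: "real DIM('a) + 2 * s = 2 * p" using s by (auto simp: p_def intro: add_nonneg_pos)
  have Gp: "Gamma p > 0" and Gs: "Gamma (1 - s) > 0" using p s by (auto intro: Gamma_real_pos)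
  let ?h = "\<lambda>z t. ennreal (indicator {0<..} t * (t powr (p - 1) * exp (- (norm z)\<^sup>2 * t)) * (1 - cos (\<xi> \<bullet> z)))"
  have "ennreal (Gamma p) * (\<integral>\<^sup>+z. ennreal ((1 - cos (\<xi> \<bullet> z)) / norm z powr (real DIM('a) + 2 * s)) \<partial>lborel) =
      (\<integral>\<^sup>+z. ennreal (Gamma p) * ennreal ((1 - cos (\<xi> \<bullet> z)) / norm z powr (real DIM('a) + 2 * s)) \<partial>lborel)"
    by (subst nn_integral_cmult) auto
  also have "\<dots> = (\<integral>\<^sup>+z. (\<integral>\<^sup>+t. ?h z t \<partial>lborel) \<partial>lborel)"
  proof (rule nn_integral_cong)
    fix z :: 'a
    show "ennreal (Gamma p) * ennreal ((1 - cos (\<xi> \<bullet> z)) / norm z powr (real DIM('a) + 2 * s)) =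
      (\<integral>\<^sup>+t. ?h z t \<partial>lborel)"
    \<comment> \<open>At the origin both sides vanish because of the factor
      \<open>1 - cos 0\<close>.\<close>
    proof (cases "z = 0")
      case False
      then have "(\<integral>\<^sup>+t. ?h z t \<partial>lborel) = ennreal (Gamma p / (norm z)\<^sup>2 powr p) * ennreal (1 - cos (\<xi> \<bullet> z))"
        using nn_integral_Gamma_scaled[OF p, of "(norm z)\<^sup>2"]
        by (simp add: ennreal_mult'' nn_integral_multc)
      also have "(norm z)\<^sup>2 powr p = norm z powr (real DIM('a) + 2 * s)"
      proof -
        have "(norm z)\<^sup>2 = norm z powr 2" using False by simp
        then show ?thesis by (simp only: powr_powr p2)
      qed
      finally show ?thesis using Gp by (simp add: ennreal_mult'[symmetric])
    qed simp
  qed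
  also have "\<dots> = (\<integral>\<^sup>+t. (\<integral>\<^sup>+z. ?h z t \<partial>lborel) \<partial>lborel)"
    by (rule lborel_pair.Fubini') (simp add: case_prod_beta', measurable)
  also have "\<dots> = (\<integral>\<^sup>+t. ennreal (pi powr (real DIM('a) / 2)) *
      ennreal (indicator {0<..} t * (t powr (s - 1) * (1 - exp (- ((norm \<xi>)\<^sup>2 / 4) / t)))) \<partial>lborel)"
  proof (rule nn_integral_cong)
    fix t :: real
    show "(\<integral>\<^sup>+z. ?h z t \<partial>lborel) = ennreal (pi powr (real DIM('a) / 2)) *
      ennreal (indicator {0<..} t * (t powr (s - 1) * (1 - exp (- ((norm \<xi>)\<^sup>2 / 4) / t))))"
    proof (cases "t > 0")
      case True
      let ?G = "\<lambda>z::'a. exp (- t * (norm z)\<^sup>2)" and ?A = "(pi / t) powr (real DIM('a) / 2)"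
        and ?B = "exp (- (norm \<xi>)\<^sup>2 / (4 * t))"
      have "(\<integral>\<^sup>+z. ?h z t \<partial>lborel) =
          (\<integral>\<^sup>+z. ennreal (t powr (p - 1)) * ennreal (?G z * (1 - cos (\<xi> \<bullet> z))) \<partial>lborel)"
        using True
        by (intro nn_integral_cong) (simp add: ennreal_mult'[symmetric] algebra_simps)
      also have "\<dots> = ennreal (t powr (p - 1)) * (\<integral>\<^sup>+z. ennreal (?G z * (1 - cos (\<xi> \<bullet> z))) \<partial>lborel)"
        by (rule nn_integral_cmult) measurable
      also have "\<dots> = ennreal (t powr (p - 1)) * ennreal (?A * (1 - ?B))"
        by (simp only: nn_integral_gaussian_one_minus_cos[OF True])
      also have "\<dots> = ennreal (t powr (p - 1) * (?A * (1 - ?B)))"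
        by (simp add: ennreal_mult'[symmetric])
      also have "t powr (p - 1) * ((pi / t) powr (real DIM('a) / 2) * (1 - exp (- (norm \<xi>)\<^sup>2 / (4 * t)))) =
          pi powr (real DIM('a) / 2) * (t powr (s - 1) * (1 - exp (- ((norm \<xi>)\<^sup>2 / 4) / t)))"
      proof -
        \<comment> \<open>Here \<open>p - 1 = (s - 1) + N / 2\<close>, and the half dimension
          cancels against the Gaussian normalisation \<open>(pi / t) powr (N / 2)\<close>.\<close>
        have "t powr (p - 1) = t powr (s - 1) * t powr (real DIM('a) / 2)"
          unfolding powr_add[symmetric] p_def by (rule arg_cong[of _ _ "(powr) t"]) (simp add: field_simps)
        then show ?thesis using True by (simp add: powr_divide)
      qed
      finally show ?thesis using True by (simp add: ennreal_mult')
    qed simp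
  qed
  also have "\<dots> = ennreal (pi powr (real DIM('a) / 2)) * ennreal (Gamma (1 - s) / s * ((norm \<xi>)\<^sup>2 / 4) powr s)"
    by (subst nn_integral_cmult, simp, subst nn_integral_powr_one_minus_exp) (use s in auto)
  also have "\<dots> = ennreal (Gamma p) * ennreal (norm \<xi> powr (2 * s) / frac_lap_const DIM('a) s)"
  proof -
    have "((norm \<xi>)\<^sup>2 / 4) powr s = norm \<xi> powr (2 * s) * 2 powr (- (2 * s))"
    proof (cases "\<xi> = 0")
      case False
      have "((norm \<xi>)\<^sup>2 / 4) powr s = (norm \<xi> powr 2 / 2 powr 2) powr s" using False by simp
      also have "\<dots> = norm \<xi> powr (2 * s) * 2 powr (- (2 * s))"
        unfolding powr_divide powr_powr powr_minus_divide by simp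
      finally show ?thesis .
    qed simp
    moreover have "frac_lap_const DIM('a) s = 2 powr (2 * s) * (1 / pi powr (real DIM('a) / 2)) * s * Gamma p / Gamma (1 - s)"
      by (simp add: frac_lap_const_def p_def powr_minus_divide)
    moreover have "P * (H / s * (X * (1 / W))) = G * (X / (W * (1 / P) * s * G / H))"
      if "P > 0" "H > 0" "W > 0" "G > 0" for P H W G X :: real
      using that s by (simp add: field_simps)
    ultimately have "pi powr (real DIM('a) / 2) * (Gamma (1 - s) / s * ((norm \<xi>)\<^sup>2 / 4) powr s) =
        Gamma p * (norm \<xi> powr (2 * s) / frac_lap_const DIM('a) s)"
      using Gp Gs by (simp only: powr_minus_divide) simp
    then show ?thesis
      using Gp by (subst (1 2) ennreal_mult'[symmetric]) auto
  qed
  finally have *: "ennreal (Gamma p) * (\<integral>\<^sup>+z. ennreal ((1 - cos (\<xi> \<bullet> z)) / norm z powr (real DIM('a) + 2 * s)) \<partial>lborel) =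
    ennreal (Gamma p) * ennreal (norm \<xi> powr (2 * s) / frac_lap_const DIM('a) s)" .
  have inv: "ennreal (1 / Gamma p) * (ennreal (Gamma p) * x) = x" for x
    using Gp by (simp add: mult.assoc[symmetric] ennreal_mult'[symmetric])
  show ?thesis
    using arg_cong[OF *, of "\<lambda>x. ennreal (1 / Gamma p) * x"] unfolding inv .
qed

section \<open>Power spectra\<close>

lemma integrable_tensor:
  fixes f :: "'a \<Rightarrow> real" and g :: "'b \<Rightarrow> real"
  assumes "sigma_finite_measure N" "integrable M f" "integrable N g"
  shows "integrable (M \<Otimes>\<^sub>M N) (\<lambda>(x, y). f x * g y)"
proof -
  interpret N: sigma_finite_measure N by fact
  have [measurable]: "f \<in> borel_measurable M" "g \<in> borel_measurable N" using assms by auto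
  have "(\<integral>\<^sup>+z. norm (case z of (x, y) \<Rightarrow> f x * g y) \<partial>(M \<Otimes>\<^sub>M N)) =
      (\<integral>\<^sup>+x. (\<integral>\<^sup>+y. ennreal (norm (f x)) * ennreal (norm (g y)) \<partial>N) \<partial>M)"
    by (subst N.nn_integral_fst[symmetric]) (auto simp: abs_mult ennreal_mult')
  also have "\<dots> = (\<integral>\<^sup>+x. ennreal (norm (f x)) \<partial>M) * (\<integral>\<^sup>+y. ennreal (norm (g y)) \<partial>N)"
    by (simp add: nn_integral_cmult nn_integral_multc)
  also have "\<dots> < \<infinity>"
    using assms by (auto simp: integrable_iff_bounded ennreal_mult_less_top)
  finally show ?thesis by (intro integrableI_bounded) auto
qed

lemma nn_integral_lborel_translate:
  fixes a :: "'a::euclidean_space"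
  assumes [measurable]: "f \<in> borel_measurable borel"
  shows "(\<integral>\<^sup>+x. f (a + x) \<partial>lborel) = (\<integral>\<^sup>+x. f x \<partial>lborel)"
  by (subst (2) lborel_distr_plus[of a, symmetric]) (simp add: nn_integral_distr)

lemma nn_integral_lborel_reflect:
  fixes a :: "'a::euclidean_space"
  assumes [measurable]: "f \<in> borel_measurable borel"
  shows "(\<integral>\<^sup>+x. f (a - x) \<partial>lborel) = (\<integral>\<^sup>+x. f x \<partial>lborel)"
  by (subst (2) lborel_affine[of "-1" a]) (simp_all add: nn_integral_density nn_integral_distr)

lemma integral_lborel_translate:
  fixes a :: "'a::euclidean_space" and f :: "'a \<Rightarrow> real"
  assumes [measurable]: "f \<in> borel_measurable borel"
  shows "(LBINT x. f (a + x)) = (LBINT x. f x)"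
  by (subst (2) lborel_distr_plus[of a, symmetric]) (simp add: integral_distr)

lemma integrable_lborel_translate:
  fixes a :: "'a::euclidean_space" and f :: "'a \<Rightarrow> real"
  assumes "integrable lborel f"
  shows "integrable lborel (\<lambda>x. f (a + x))"
proof -
  have [measurable]: "f \<in> borel_measurable borel" using assms by simp
  show ?thesis
    using assms by (subst (asm) lborel_distr_plus[of a, symmetric]) (simp add: integrable_distr_eq)
qed

section \<open>Real transforms, power spectra and Gaussian regularisation\<close>

definition cos_tr :: "('a::euclidean_space \<Rightarrow> real) \<Rightarrow> 'a \<Rightarrow> real" where
  "cos_tr f \<xi> = (LBINT x. f x * cos (\<xi> \<bullet> x))"

definition sin_tr :: "('a::euclidean_space \<Rightarrow> real) \<Rightarrow> 'a \<Rightarrow> real" where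
  "sin_tr f \<xi> = (LBINT x. f x * sin (\<xi> \<bullet> x))"

definition power_spectrum :: "('a::euclidean_space \<Rightarrow> real) \<Rightarrow> 'a \<Rightarrow> real" where
  "power_spectrum f \<xi> = (cos_tr f \<xi>)\<^sup>2 + (sin_tr f \<xi>)\<^sup>2"

lemma power_spectrum_nonneg [simp]: "0 \<le> power_spectrum f \<xi>"
  by (simp add: power_spectrum_def)

lemma measurable_transforms [measurable]:
  assumes [measurable]: "f \<in> borel_measurable borel"
  shows "cos_tr f \<in> borel_measurable borel" "sin_tr f \<in> borel_measurable borel"
    "power_spectrum f \<in> borel_measurable borel"
  unfolding cos_tr_def[abs_def] sin_tr_def[abs_def] power_spectrum_def[abs_def] by measurable

lemma integrable_mult_cos_sin:
  fixes f :: "'a::euclidean_space \<Rightarrow> real"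
  assumes f: "integrable lborel f"
  shows "integrable lborel (\<lambda>x. f x * cos (\<xi> \<bullet> x))" "integrable lborel (\<lambda>x. f x * sin (\<xi> \<bullet> x))"
proof -
  have [measurable]: "f \<in> borel_measurable borel" using f by auto
  show "integrable lborel (\<lambda>x. f x * cos (\<xi> \<bullet> x))" "integrable lborel (\<lambda>x. f x * sin (\<xi> \<bullet> x))"
    by (rule Bochner_Integration.integrable_bound[OF f], simp, simp add: abs_mult mult_left_le)+
qed

text \<open>
  The Fourier transform of \<open>\<lambda>\<xi>. exp (- t * (norm \<xi>)\<^sup>2)\<close>; its total mass is \<open>(2 * pi) ^ DIM('a)\<close>, not \<open>1\<close>.
\<close>

definition heat :: "real \<Rightarrow> 'a::euclidean_space \<Rightarrow> real" where
  "heat t z = (pi / t) powr (real DIM('a) / 2) * exp (- (norm z)\<^sup>2 / (4 * t))"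

lemma measurable_heat [measurable]: "heat t \<in> borel_measurable borel"
  unfolding heat_def[abs_def] by measurable

lemma heat_nonneg [simp]: "0 \<le> heat t z"
  by (simp add: heat_def)

text \<open>The scales cancel, \<open>(pi / t) * (4 * pi * t) = (2 * pi)^2\<close>. The factors
  \<open>(2 * pi) ^ DIM('a)\<close> in the estimates below originate here.\<close>

lemma nn_integral_heat:
  assumes t: "0 < t"
  shows "(\<integral>\<^sup>+z. ennreal (heat t z) \<partial>(lborel :: 'a::euclidean_space measure)) = ennreal ((2 * pi) ^ DIM('a))"
proof -
  have t': "0 < 1 / (4 * t)" using t by simp
  have i: "integrable lborel (\<lambda>z::'a. exp (- (1 / (4 * t)) * (norm z)\<^sup>2))"
    and v: "(LBINT z. exp (- (1 / (4 * t)) * (norm (z::'a))\<^sup>2)) = (pi / (1 / (4 * t))) powr (real DIM('a) / 2)"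
    using gaussian_cos_integral[OF t', of "0::'a"] by simp_all
  have "(\<integral>\<^sup>+z. ennreal (heat t z) \<partial>(lborel :: 'a measure)) =
     (\<integral>\<^sup>+z. ennreal ((pi / t) powr (real DIM('a) / 2)) * ennreal (exp (- (1 / (4 * t)) * (norm z)\<^sup>2)) \<partial>(lborel :: 'a measure))"
    by (simp add: heat_def ennreal_mult'[symmetric])
  also have "\<dots> = ennreal ((pi / t) powr (real DIM('a) / 2)) * ennreal ((pi / (1 / (4 * t))) powr (real DIM('a) / 2))"
    by (subst nn_integral_cmult, simp, subst nn_integral_eq_integral[OF i]) (simp_all only: v exp_ge_zero, simp)
  also have "\<dots> = ennreal (((2 * pi)\<^sup>2) powr (real DIM('a) / 2))"
  proof -
    have "(pi / t) powr (real DIM('a) / 2) * (pi / (1 / (4 * t))) powr (real DIM('a) / 2) = ((2 * pi)\<^sup>2) powr (real DIM('a) / 2)"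
      unfolding powr_mult[symmetric] using t by (simp add: power2_eq_square mult_ac)
    then show ?thesis by (simp add: ennreal_mult'[symmetric])
  qed
  also have "((2 * pi)\<^sup>2) powr (real DIM('a) / 2) = (2 * pi) ^ DIM('a)"
  proof -
    have "(2 * pi)\<^sup>2 = (2 * pi) powr 2" by simp
    then show ?thesis by (simp only: powr_powr) (simp add: powr_realpow)
  qed
  finally show ?thesis .
qed

lemma power_spectrum_eq:
  fixes f :: "'a::euclidean_space \<Rightarrow> real"
  assumes f: "integrable lborel f"
  shows "power_spectrum f \<xi> = (LINT (x, y)|(lborel \<Otimes>\<^sub>M lborel). f x * f y * cos (\<xi> \<bullet> (x - y)))"
proof -
  note I = integrable_mult_cos_sin[OF f, of \<xi>]
  have tens: "(LINT z|(lborel \<Otimes>\<^sub>M lborel). (case z of (x, y) \<Rightarrow> g x * g y)) = (integral\<^sup>L lborel g)\<^sup>2"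
    if "integrable lborel g" for g :: "'a \<Rightarrow> real"
    using lborel_pair.integral_fst'[OF integrable_tensor[OF sigma_finite_lborel that that]]
    by (simp add: power2_eq_square)
  have "(LINT (x, y)|(lborel \<Otimes>\<^sub>M lborel). f x * f y * cos (\<xi> \<bullet> (x - y))) =
      (LINT z|(lborel \<Otimes>\<^sub>M lborel). (case z of (x, y) \<Rightarrow> (f x * cos (\<xi> \<bullet> x)) * (f y * cos (\<xi> \<bullet> y))) +
        (case z of (x, y) \<Rightarrow> (f x * sin (\<xi> \<bullet> x)) * (f y * sin (\<xi> \<bullet> y))))"
    by (intro Bochner_Integration.integral_cong refl) (auto simp: inner_diff_right cos_diff algebra_simps)
  also have "\<dots> = power_spectrum f \<xi>"
    unfolding power_spectrum_def cos_tr_def sin_tr_def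
    by (subst Bochner_Integration.integral_add) (intro integrable_tensor sigma_finite_lborel I, intro integrable_tensor sigma_finite_lborel I, simp only: tens[OF I(1)] tens[OF I(2)])
  finally show ?thesis ..
qed

text \<open>The Gaussian weight makes the integrand absolutely integrable in all three variables, so
  Fubini applies before the power spectrum itself is known to be integrable.\<close>

lemma gaussian_power_spectrum:
  fixes f :: "'a::euclidean_space \<Rightarrow> real"
  assumes t: "0 < t" and f: "integrable lborel f"
  shows "integrable lborel (\<lambda>\<xi>. exp (- t * (norm \<xi>)\<^sup>2) * power_spectrum f \<xi>)"
    and "integrable (lborel \<Otimes>\<^sub>M lborel) (\<lambda>(x, y). f x * f y * heat t (x - y))"
    and "(LBINT \<xi>. exp (- t * (norm \<xi>)\<^sup>2) * power_spectrum f \<xi>) =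
      (LINT (x, y)|(lborel \<Otimes>\<^sub>M lborel). f x * f y * heat t (x - y))"
proof -
  have [measurable]: "f \<in> borel_measurable borel" using f by auto
  let ?P = "lborel \<Otimes>\<^sub>M lborel :: ('a \<times> 'a) measure"
  have sf: "sigma_finite_measure ?P"
    unfolding lborel_prod by (rule sigma_finite_lborel)
  interpret P: pair_sigma_finite "lborel :: 'a measure" ?P
    unfolding pair_sigma_finite_def by (intro conjI sigma_finite_lborel sf)
  let ?F = "\<lambda>(\<xi>::'a, (x, y)). exp (- t * (norm \<xi>)\<^sup>2) * (f x * f y * cos (\<xi> \<bullet> (x - y)))"
  have G: "integrable lborel (\<lambda>z::'a. exp (- t * (norm z)\<^sup>2))"
    using gaussian_cos_integral(1)[OF t, of "0::'a"] by simp
  have ff: "integrable ?P (\<lambda>(x, y). f x * f y)"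
    by (rule integrable_tensor[OF sigma_finite_lborel f f])
  have "integrable (lborel \<Otimes>\<^sub>M ?P) (\<lambda>(\<xi>::'a, z). exp (- t * (norm \<xi>)\<^sup>2) * (case z of (x, y) \<Rightarrow> f x * f y))"
    by (rule integrable_tensor[OF sf G ff])
  then have int: "integrable (lborel \<Otimes>\<^sub>M ?P) ?F"
    by (rule Bochner_Integration.integrable_bound) (measurable, auto simp: abs_mult mult.assoc[symmetric] intro!: mult_left_le AE_I2)
  have 1: "(LINT z|?P. ?F (\<xi>, z)) = exp (- t * (norm \<xi>)\<^sup>2) * power_spectrum f \<xi>" for \<xi>
    unfolding power_spectrum_eq[OF f] by (simp add: case_prod_unfold)
  have 2: "(LBINT \<xi>. ?F (\<xi>, z)) = (case z of (x, y) \<Rightarrow> f x * f y * heat t (x - y))" for z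
  proof -
    obtain x y where z: "z = (x, y)" by (cases z)
    have "(LBINT \<xi>. ?F (\<xi>, z)) = (LBINT \<xi>. f x * f y * (exp (- t * (norm \<xi>)\<^sup>2) * cos ((x - y) \<bullet> \<xi>)))"
      unfolding z by (intro Bochner_Integration.integral_cong refl) (simp add: inner_commute)
    also have "\<dots> = f x * f y * heat t (x - y)"
      by (simp only: integral_mult_right_zero gaussian_cos_integral(2)[OF t] heat_def)
    finally show ?thesis by (simp add: z)
  qed
  show "integrable lborel (\<lambda>\<xi>. exp (- t * (norm \<xi>)\<^sup>2) * power_spectrum f \<xi>)"
    using P.integrable_fst'[OF int] unfolding 1 .
  show "integrable ?P (\<lambda>(x, y). f x * f y * heat t (x - y))"
    using P.integrable_snd[of "\<lambda>\<xi> z. ?F (\<xi>, z)"] int unfolding 2 by (simp add: case_prod_unfold)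
  have "(LBINT \<xi>. exp (- t * (norm \<xi>)\<^sup>2) * power_spectrum f \<xi>) = integral\<^sup>L (lborel \<Otimes>\<^sub>M ?P) ?F"
    using P.integral_fst'[OF int] unfolding 1 .
  also have "\<dots> = (LINT (x, y)|(lborel \<Otimes>\<^sub>M lborel). f x * f y * heat t (x - y))"
    using P.integral_snd[of "\<lambda>\<xi> z. ?F (\<xi>, z)"] int unfolding 2 by (simp add: case_prod_unfold)
  finally show "(LBINT \<xi>. exp (- t * (norm \<xi>)\<^sup>2) * power_spectrum f \<xi>) =
      (LINT (x, y)|(lborel \<Otimes>\<^sub>M lborel). f x * f y * heat t (x - y))" .
qed

text \<open>Tonelli with the kernel integrated first, by invariance under translation and
  reflection. It serves three kernels: \<open>heat t\<close>, the truncated energy kernel, and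
  \<open>1 - cos\<close> divided by the energy kernel.\<close>

lemma integrable_pair_convolve:
  fixes h k :: "'a::euclidean_space \<Rightarrow> real"
  assumes h: "integrable lborel h" and k: "k \<in> borel_measurable borel" "\<And>z. 0 \<le> k z"
    and kint: "(\<integral>\<^sup>+z. ennreal (k z) \<partial>lborel) = ennreal c" and h0: "\<And>x. 0 \<le> h x" and c: "0 \<le> c"
  shows "has_bochner_integral (lborel \<Otimes>\<^sub>M lborel) (\<lambda>(x, y). h x * k (x - y)) (c * integral\<^sup>L lborel h)"
    and "has_bochner_integral (lborel \<Otimes>\<^sub>M lborel) (\<lambda>(x, y). h y * k (x - y)) (c * integral\<^sup>L lborel h)"
proof -
  have [measurable]: "h \<in> borel_measurable borel" "k \<in> borel_measurable borel" using h k by auto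
  have hh: "(\<integral>\<^sup>+x. ennreal (h x) * ennreal c \<partial>lborel) = ennreal (c * integral\<^sup>L lborel h)"
    using h h0 c by (simp add: nn_integral_multc nn_integral_eq_integral ennreal_mult' ennreal_mult'' mult.commute[of c])
  have "(\<integral>\<^sup>+z. ennreal (case z of (x, y) \<Rightarrow> h x * k (x - y)) \<partial>(lborel \<Otimes>\<^sub>M lborel)) =
      (\<integral>\<^sup>+x. (\<integral>\<^sup>+y. ennreal (h x) * ennreal (k (x - y)) \<partial>lborel) \<partial>lborel)"
    by (subst lborel.nn_integral_fst[symmetric]) (auto simp: ennreal_mult' h0)
  also have "\<dots> = (\<integral>\<^sup>+x. ennreal (h x) * ennreal c \<partial>lborel)"
    by (simp add: nn_integral_cmult nn_integral_lborel_reflect[of "\<lambda>z. ennreal (k z)"] kint)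
  finally have n1: "(\<integral>\<^sup>+z. ennreal (case z of (x, y) \<Rightarrow> h x * k (x - y)) \<partial>(lborel \<Otimes>\<^sub>M lborel)) = ennreal (c * integral\<^sup>L lborel h)"
    unfolding hh .
  show "has_bochner_integral (lborel \<Otimes>\<^sub>M lborel) (\<lambda>(x, y). h x * k (x - y)) (c * integral\<^sup>L lborel h)"
    by (rule has_bochner_integral_nn_integral) (use n1 h0 k c in \<open>auto intro!: AE_I2 Bochner_Integration.integral_nonneg mult_nonneg_nonneg\<close>)
  have tr: "(\<integral>\<^sup>+x. ennreal (k (x - y)) \<partial>lborel) = ennreal c" for y
    using nn_integral_lborel_translate[of "\<lambda>z. ennreal (k z)" "- y"] kint by simp
  have "(\<integral>\<^sup>+z. ennreal (case z of (x, y) \<Rightarrow> h y * k (x - y)) \<partial>(lborel \<Otimes>\<^sub>M lborel)) =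
      (\<integral>\<^sup>+y. (\<integral>\<^sup>+x. ennreal (h y) * ennreal (k (x - y)) \<partial>lborel) \<partial>lborel)"
    by (subst lborel_pair.nn_integral_snd[symmetric]) (auto simp: ennreal_mult' h0)
  also have "\<dots> = (\<integral>\<^sup>+x. ennreal (h x) * ennreal c \<partial>lborel)"
    by (simp add: nn_integral_cmult tr)
  finally have n2: "(\<integral>\<^sup>+z. ennreal (case z of (x, y) \<Rightarrow> h y * k (x - y)) \<partial>(lborel \<Otimes>\<^sub>M lborel)) = ennreal (c * integral\<^sup>L lborel h)"
    unfolding hh .
  show "has_bochner_integral (lborel \<Otimes>\<^sub>M lborel) (\<lambda>(x, y). h y * k (x - y)) (c * integral\<^sup>L lborel h)"
    by (rule has_bochner_integral_nn_integral) (use n2 h0 k c in \<open>auto intro!: AE_I2 Bochner_Integration.integral_nonneg mult_nonneg_nonneg\<close>)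
qed

text \<open>Substitutes \<open>2 * f x * f y = (f x)^2 + (f y)^2 - (f x - f y)^2\<close> and
  integrates the squares against the total mass of \<open>heat t\<close>. The defect in Plancherel's
  identity becomes an explicit nonnegative double integral: its sign gives Bessel's inequality, its
  size for finite energy the converse.\<close>

lemma gaussian_plancherel:
  fixes f :: "'a::euclidean_space \<Rightarrow> real"
  assumes t: "0 < t" and f: "integrable lborel f" and f2: "integrable lborel (\<lambda>x. (f x)\<^sup>2)"
  shows "integrable (lborel \<Otimes>\<^sub>M lborel) (\<lambda>(x, y). (f x - f y)\<^sup>2 * heat t (x - y))"
    and "(LBINT \<xi>. exp (- t * (norm \<xi>)\<^sup>2) * power_spectrum f \<xi>) =
      (2 * pi) ^ DIM('a) * (LBINT x. (f x)\<^sup>2) -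
        (LINT (x, y)|(lborel \<Otimes>\<^sub>M lborel). (f x - f y)\<^sup>2 * heat t (x - y)) / 2"
proof -
  let ?P = "lborel \<Otimes>\<^sub>M lborel :: ('a \<times> 'a) measure" and ?A = "(2 * pi) ^ DIM('a) * (LBINT x. (f x)\<^sup>2)"
    and ?B = "LINT (x, y)|(lborel \<Otimes>\<^sub>M lborel). f x * f y * heat t (x - y)"
  note c = integrable_pair_convolve[OF f2 measurable_heat heat_nonneg nn_integral_heat[OF t]]
  note g = gaussian_power_spectrum[OF t f]
  have b: "has_bochner_integral ?P (\<lambda>z. 2 * (case z of (x, y) \<Rightarrow> f x * f y * heat t (x - y))) (2 * ?B)"
    using g(2) by (intro has_bochner_integral_mult_right has_bochner_integral_integrable)
  have "has_bochner_integral ?P (\<lambda>z. (case z of (x, y) \<Rightarrow> (f x)\<^sup>2 * heat t (x - y)) + (case z of (x, y) \<Rightarrow> (f y)\<^sup>2 * heat t (x - y)) -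
      2 * (case z of (x, y) \<Rightarrow> f x * f y * heat t (x - y))) (?A + ?A - 2 * ?B)"
    by (intro has_bochner_integral_diff[OF has_bochner_integral_add[OF c] b]) auto
  also have "(\<lambda>z. (case z of (x, y) \<Rightarrow> (f x)\<^sup>2 * heat t (x - y)) + (case z of (x, y) \<Rightarrow> (f y)\<^sup>2 * heat t (x - y)) -
      2 * (case z of (x, y) \<Rightarrow> f x * f y * heat t (x - y))) = (\<lambda>(x, y). (f x - f y)\<^sup>2 * heat t (x - y))"
    by (auto simp: power2_diff algebra_simps)
  finally have *: "has_bochner_integral ?P (\<lambda>(x, y). (f x - f y)\<^sup>2 * heat t (x - y)) (?A + ?A - 2 * ?B)" .
  then show "integrable ?P (\<lambda>(x, y). (f x - f y)\<^sup>2 * heat t (x - y))" by (rule integrable.intros)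
  show "(LBINT \<xi>. exp (- t * (norm \<xi>)\<^sup>2) * power_spectrum f \<xi>) =
      ?A - (LINT (x, y)|?P. (f x - f y)\<^sup>2 * heat t (x - y)) / 2"
    unfolding g(3) has_bochner_integral_integral_eq[OF *] by (simp add: field_simps)
qed

text \<open>The nonnegative defect is dropped; as \<open>t\<close> tends to 0 the Gaussian factor
  tends to 1, and Fatou's lemma preserves the bound.\<close>

lemma power_spectrum_bessel:
  fixes f :: "'a::euclidean_space \<Rightarrow> real"
  assumes f: "integrable lborel f" and f2: "integrable lborel (\<lambda>x. (f x)\<^sup>2)"
  shows "integrable lborel (power_spectrum f)"
    and "(LBINT \<xi>. power_spectrum f \<xi>) \<le> (2 * pi) ^ DIM('a) * (LBINT x. (f x)\<^sup>2)"
    and "(\<integral>\<^sup>+\<xi>. ennreal (power_spectrum f \<xi>) \<partial>lborel) \<le> ennreal ((2 * pi) ^ DIM('a) * (LBINT x. (f x)\<^sup>2))"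
proof -
  have [measurable]: "f \<in> borel_measurable borel" using f by auto
  let ?A = "(2 * pi) ^ DIM('a) * (LBINT x. (f x)\<^sup>2)"
  let ?u = "\<lambda>n \<xi>. ennreal (exp (- (1 / real (Suc n)) * (norm \<xi>)\<^sup>2) * power_spectrum f \<xi>)"
  have A: "0 \<le> ?A" by simp
  have le: "(\<integral>\<^sup>+\<xi>. ?u n \<xi> \<partial>lborel) \<le> ennreal ?A" for n
  proof -
    have t: "0 < 1 / real (Suc n)" by simp
    have "(\<integral>\<^sup>+\<xi>. ?u n \<xi> \<partial>lborel) = ennreal (LBINT \<xi>. exp (- (1 / real (Suc n)) * (norm \<xi>)\<^sup>2) * power_spectrum f \<xi>)"
      by (rule nn_integral_eq_integral[OF gaussian_power_spectrum(1)[OF t f]]) simp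
    also have "\<dots> \<le> ennreal ?A"
      unfolding gaussian_plancherel(2)[OF t f f2] by (intro ennreal_leI) (auto intro!: Bochner_Integration.integral_nonneg)
    finally show ?thesis .
  qed
  have lim: "(\<lambda>n. ?u n \<xi>) \<longlonglongrightarrow> ennreal (power_spectrum f \<xi>)" for \<xi>
  proof (rule tendsto_ennrealI)
    have "(\<lambda>n. exp (- (1 / real (Suc n)) * (norm \<xi>)\<^sup>2) * power_spectrum f \<xi>) \<longlonglongrightarrow> exp (- 0 * (norm \<xi>)\<^sup>2) * power_spectrum f \<xi>"
      by (intro tendsto_intros LIMSEQ_Suc[OF lim_1_over_n])
    then show "(\<lambda>n. exp (- (1 / real (Suc n)) * (norm \<xi>)\<^sup>2) * power_spectrum f \<xi>) \<longlonglongrightarrow> power_spectrum f \<xi>" by simp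
  qed
  have "(\<integral>\<^sup>+\<xi>. ennreal (power_spectrum f \<xi>) \<partial>lborel) = (\<integral>\<^sup>+\<xi>. liminf (\<lambda>n. ?u n \<xi>) \<partial>lborel)"
    by (intro nn_integral_cong lim_imp_Liminf[symmetric] lim) auto
  also have "\<dots> \<le> liminf (\<lambda>n. \<integral>\<^sup>+\<xi>. ?u n \<xi> \<partial>lborel)"
    by (rule nn_integral_liminf) measurable
  also have "\<dots> \<le> liminf (\<lambda>n::nat. ennreal ?A)"
    by (rule Liminf_mono, rule always_eventually, intro allI le)
  also have "\<dots> = ennreal ?A" by (simp add: Liminf_const)
  finally show 1: "(\<integral>\<^sup>+\<xi>. ennreal (power_spectrum f \<xi>) \<partial>lborel) \<le> ennreal ?A" .
  show 2: "integrable lborel (power_spectrum f)"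
    by (rule integrableI_nonneg) (measurable, simp, rule le_less_trans[OF 1], simp)
  show "(LBINT \<xi>. power_spectrum f \<xi>) \<le> ?A"
    using 1 A by (subst (asm) nn_integral_eq_integral[OF 2]) auto
qed

text \<open>Follows from \<open>r / q \<le> exp (r / q)\<close> with
  \<open>r = |z|^2 / (4 * t)\<close>. The exponent \<open>q\<close> is chosen so that the bound is
  exactly the energy kernel in \<open>z\<close>; the power of \<open>t\<close> left over is
  \<open>q - N / 2 = s\<close>.\<close>

lemma heat_le:
  fixes z :: "'a::euclidean_space"
  assumes t: "0 < t" and s: "0 < s" and z: "z \<noteq> 0"
  defines "q \<equiv> (real DIM('a) + 2 * s) / 2"
  shows "heat t z \<le> pi powr (real DIM('a) / 2) * (4 * q) powr q * t powr s / norm z powr (real DIM('a) + 2 * s)"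
proof -
  have q: "q > 0" using s by (auto simp: q_def intro: add_nonneg_pos)
  define r where "r = (norm z)\<^sup>2 / (4 * t)"
  have r: "r > 0" using t z by (simp add: r_def)
  have "r / q \<le> exp (r / q)" using exp_ge_add_one_self[of "r / q"] by linarith
  then have "(r / q) powr q \<le> exp (r / q) powr q" using q r by (intro powr_mono2) auto
  also have "\<dots> = exp r" using q by (simp add: exp_powr_real)
  finally have "exp (- r) \<le> q powr q / r powr q"
    using q r by (simp add: powr_divide exp_minus field_simps)
  then have "heat t z \<le> (pi / t) powr (real DIM('a) / 2) * (q powr q / r powr q)"
    unfolding heat_def by (intro mult_left_mono) (auto simp: r_def)
  also have "r powr q = norm z powr (real DIM('a) + 2 * s) / ((4 powr q) * (t powr (real DIM('a) / 2) * t powr s))"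
  proof -
    have n: "(norm z)\<^sup>2 = norm z powr 2" using z by simp
    have "2 * q = real DIM('a) + 2 * s" by (simp add: q_def)
    moreover have "t powr q = t powr (real DIM('a) / 2) * t powr s"
      unfolding powr_add[symmetric] q_def by (rule arg_cong[of _ _ "(powr) t"]) (simp add: field_simps)
    ultimately show ?thesis
      unfolding r_def n powr_divide powr_powr powr_mult by simp
  qed
  also have "(pi / t) powr (real DIM('a) / 2) * (q powr q / (norm z powr (real DIM('a) + 2 * s) / ((4 powr q) * (t powr (real DIM('a) / 2) * t powr s)))) =
    pi powr (real DIM('a) / 2) * (4 * q) powr q * t powr s / norm z powr (real DIM('a) + 2 * s)"
    unfolding powr_divide powr_mult using t by simp
  finally show ?thesis .
qed

text \<open>By \<open>heat_le\<close> the defect at time \<open>t\<close> is at most a constant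
  times \<open>t powr s\<close> times the energy integral, which vanishes in the limit because
  \<open>s\<close> is positive.\<close>

lemma power_spectrum_plancherel_le:
  fixes f :: "'a::euclidean_space \<Rightarrow> real"
  assumes s: "0 < s" and f: "integrable lborel f" and f2: "integrable lborel (\<lambda>x. (f x)\<^sup>2)"
    and e: "integrable (lborel \<Otimes>\<^sub>M lborel) (\<lambda>(x, y). (f x - f y)\<^sup>2 / norm (x - y) powr (real DIM('a) + 2 * s))"
  shows "(2 * pi) ^ DIM('a) * (LBINT x. (f x)\<^sup>2) \<le> (LBINT \<xi>. power_spectrum f \<xi>)"
proof -
  have [measurable]: "f \<in> borel_measurable borel" using f by auto
  define q where "q = (real DIM('a) + 2 * s) / 2"
  define C where "C = pi powr (real DIM('a) / 2) * (4 * q) powr q"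
  let ?P = "lborel \<Otimes>\<^sub>M lborel :: ('a \<times> 'a) measure" and ?A = "(2 * pi) ^ DIM('a) * (LBINT x. (f x)\<^sup>2)"
  define D where "D = (LINT (x, y)|?P. (f x - f y)\<^sup>2 / norm (x - y) powr (real DIM('a) + 2 * s))"
  have ineq: "?A \<le> (LBINT \<xi>. power_spectrum f \<xi>) + C * t powr s * D / 2" if t: "0 < t" for t
  proof -
    have "(LINT (x, y)|?P. (f x - f y)\<^sup>2 * heat t (x - y)) \<le>
      (LINT z|?P. C * t powr s * (case z of (x, y) \<Rightarrow> (f x - f y)\<^sup>2 / norm (x - y) powr (real DIM('a) + 2 * s)))"
    proof (rule integral_mono[OF gaussian_plancherel(1)[OF t f f2] integrable_mult_right[OF e]], clarify)
      fix x y :: 'a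
      show "(f x - f y)\<^sup>2 * heat t (x - y) \<le> C * t powr s * ((f x - f y)\<^sup>2 / norm (x - y) powr (real DIM('a) + 2 * s))"
      proof (cases "x = y")
        case False
        then have "heat t (x - y) \<le> C * t powr s / norm (x - y) powr (real DIM('a) + 2 * s)"
          using heat_le[OF t s, of "x - y"] by (simp add: C_def q_def)
        from mult_left_mono[OF this, of "(f x - f y)\<^sup>2"] show ?thesis by (simp add: mult_ac)
      qed simp
    qed
    also have "\<dots> = C * t powr s * D" by (simp add: D_def)
    finally have 1: "(LINT (x, y)|?P. (f x - f y)\<^sup>2 * heat t (x - y)) \<le> C * t powr s * D" .
    have "(LBINT \<xi>. exp (- t * (norm \<xi>)\<^sup>2) * power_spectrum f \<xi>) \<le> (LBINT \<xi>. power_spectrum f \<xi>)"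
    proof (rule integral_mono[OF gaussian_power_spectrum(1)[OF t f] power_spectrum_bessel(1)[OF f f2]])
      show "exp (- t * (norm \<xi>)\<^sup>2) * power_spectrum f \<xi> \<le> power_spectrum f \<xi>" for \<xi>
        using t by (intro mult_left_le_one_le) auto
    qed
    then show ?thesis
      using 1 gaussian_plancherel(2)[OF t f f2] by linarith
  qed
  have "(\<lambda>n. (1 / real (Suc n)) powr s) \<longlonglongrightarrow> 0 powr s"
    by (intro tendsto_powr' LIMSEQ_Suc[OF lim_1_over_n] tendsto_const) (use s in auto)
  then have "(\<lambda>n. (LBINT \<xi>. power_spectrum f \<xi>) + C * (1 / real (Suc n)) powr s * D / 2) \<longlonglongrightarrow> (LBINT \<xi>. power_spectrum f \<xi>) + C * 0 powr s * D / 2"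
    using s by (intro tendsto_add tendsto_mult tendsto_divide tendsto_const) auto
  then show ?thesis
    by (rule LIMSEQ_le_const[THEN order_trans]) (use ineq in \<open>auto simp: zero_less_divide_iff\<close>)
qed

section \<open>The energy on the Fourier side\<close>

text \<open>Translation multiplies the Fourier transform by a phase, and
  \<open>|1 - exp (i * \<theta>)|^2 = 2 * (1 - cos \<theta>)\<close>. In real terms the pair of
  cosine and sine transforms is rotated by the angle \<open>\<xi> \<bullet> z\<close>.\<close>

lemma power_spectrum_translate_diff:
  fixes f :: "'a::euclidean_space \<Rightarrow> real"
  assumes f: "integrable lborel f"
  shows "power_spectrum (\<lambda>x. f x - f (z + x)) \<xi> = 2 * (1 - cos (\<xi> \<bullet> z)) * power_spectrum f \<xi>"
proof -
  have [measurable]: "f \<in> borel_measurable borel" using f by auto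
  let ?C = "cos_tr f \<xi>" and ?S = "sin_tr f \<xi>" and ?c = "cos (\<xi> \<bullet> z)" and ?s = "sin (\<xi> \<bullet> z)"
  note I = integrable_mult_cos_sin[OF f, of \<xi>]
  have f': "integrable lborel (\<lambda>x. f (z + x))" by (rule integrable_lborel_translate[OF f])
  note I' = integrable_mult_cos_sin[OF f', of \<xi>]
  have "(LBINT x. f (z + x) * cos (\<xi> \<bullet> x)) = (LBINT x. f x * cos (\<xi> \<bullet> (x - z)))"
    using integral_lborel_translate[of "\<lambda>x. f x * cos (\<xi> \<bullet> (x - z))" z] by simp
  also have "\<dots> = (LBINT x. ?c * (f x * cos (\<xi> \<bullet> x)) + ?s * (f x * sin (\<xi> \<bullet> x)))"
    by (simp add: inner_diff_right cos_diff algebra_simps)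
  also have "\<dots> = ?c * ?C + ?s * ?S"
    using I by (simp add: cos_tr_def sin_tr_def)
  finally have C': "(LBINT x. f (z + x) * cos (\<xi> \<bullet> x)) = ?c * ?C + ?s * ?S" .
  have "(LBINT x. f (z + x) * sin (\<xi> \<bullet> x)) = (LBINT x. f x * sin (\<xi> \<bullet> (x - z)))"
    using integral_lborel_translate[of "\<lambda>x. f x * sin (\<xi> \<bullet> (x - z))" z] by simp
  also have "\<dots> = (LBINT x. ?c * (f x * sin (\<xi> \<bullet> x)) - ?s * (f x * cos (\<xi> \<bullet> x)))"
    by (simp add: inner_diff_right sin_diff algebra_simps)
  also have "\<dots> = ?c * ?S - ?s * ?C"
    using I by (simp add: cos_tr_def sin_tr_def)
  finally have S': "(LBINT x. f (z + x) * sin (\<xi> \<bullet> x)) = ?c * ?S - ?s * ?C" .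
  have "cos_tr (\<lambda>x. f x - f (z + x)) \<xi> = ?C - (?c * ?C + ?s * ?S)"
    unfolding C'[symmetric] using I I' by (simp add: cos_tr_def left_diff_distrib)
  moreover have "sin_tr (\<lambda>x. f x - f (z + x)) \<xi> = ?S - (?c * ?S - ?s * ?C)"
    unfolding S'[symmetric] using I I' by (simp add: sin_tr_def left_diff_distrib)
  moreover have "(C - (c * C + d * S))\<^sup>2 + (S - (c * S - d * C))\<^sup>2 = 2 * (1 - c) * (C\<^sup>2 + S\<^sup>2)"
    if "d\<^sup>2 = 1 - c\<^sup>2" for C S c d :: real
  proof -
    have "(C - (c * C + d * S))\<^sup>2 + (S - (c * S - d * C))\<^sup>2 = (C\<^sup>2 + S\<^sup>2) * ((1 - c)\<^sup>2 + d\<^sup>2)"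
      by algebra
    then show ?thesis using that by algebra
  qed
  ultimately show ?thesis
    unfolding power_spectrum_def by (simp add: sin_squared_eq)
qed

text \<open>For each shift \<open>z\<close>, Bessel's inequality for \<open>f x - f (z + x)\<close>
  compares \<open>2 * (1 - cos (\<xi> \<bullet> z))\<close> times the spectrum with the squared
  differences. Dividing by the kernel and integrating over \<open>z\<close> produces the symbol on
  one side and the energy on the other.\<close>

lemma power_spectrum_energy_le:
  fixes f :: "'a::euclidean_space \<Rightarrow> real"
  assumes s: "0 < s" "s < 1" and f: "integrable lborel f" and f2: "integrable lborel (\<lambda>x. (f x)\<^sup>2)"
    and e: "integrable (lborel \<Otimes>\<^sub>M lborel) (\<lambda>(x, y). (f x - f y)\<^sup>2 / norm (x - y) powr (real DIM('a) + 2 * s))"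
  shows "integrable lborel (\<lambda>\<xi>. norm \<xi> powr (2 * s) * power_spectrum f \<xi>)"
    and "(LBINT \<xi>. norm \<xi> powr (2 * s) * power_spectrum f \<xi>) \<le> (2 * pi) ^ DIM('a) *
      (frac_lap_const DIM('a) s / 2 *
        (LINT (x, y)|(lborel \<Otimes>\<^sub>M lborel). (f x - f y)\<^sup>2 / norm (x - y) powr (real DIM('a) + 2 * s)))"
proof -
  have [measurable]: "f \<in> borel_measurable borel" using f by auto
  let ?P = "lborel \<Otimes>\<^sub>M lborel :: ('a \<times> 'a) measure"
  define p where "p = real DIM('a) + 2 * s"
  define c where "c = frac_lap_const DIM('a) s"
  have c: "c > 0" unfolding c_def by (rule frac_lap_const_pos[OF s])
  define D where "D = (LINT (x, y)|?P. (f x - f y)\<^sup>2 / norm (x - y) powr p)"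
  have D0: "0 \<le> D" unfolding D_def by (rule Bochner_Integration.integral_nonneg) auto
  let ?p = "(2 * pi) ^ DIM('a) :: real"
  have bes: "ennreal (2 * (1 - cos (\<xi> \<bullet> z)) * power_spectrum f \<xi>) = ennreal (power_spectrum (\<lambda>x. f x - f (z + x)) \<xi>)" for z \<xi>
    by (simp add: power_spectrum_translate_diff[OF f])
  note f' = integrable_lborel_translate[OF f] and f2' = integrable_lborel_translate[OF f2]
  have d2: "integrable lborel (\<lambda>x. (f x - f (z + x))\<^sup>2)" for z
  proof (rule Bochner_Integration.integrable_bound)
    show "integrable lborel (\<lambda>x. 2 * (f x)\<^sup>2 + 2 * (f (z + x))\<^sup>2)" using f2 f2' by simp
    have "(a - b)\<^sup>2 \<le> 2 * a\<^sup>2 + 2 * b\<^sup>2" for a b :: real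
      using zero_le_power2[of "a + b"] by (simp add: power2_sum power2_diff)
    then show "AE x in lborel. norm ((f x - f (z + x))\<^sup>2) \<le> norm (2 * (f x)\<^sup>2 + 2 * (f (z + x))\<^sup>2)" by auto
  qed simp
  have inner: "(\<integral>\<^sup>+\<xi>. ennreal (2 * (1 - cos (\<xi> \<bullet> z)) * power_spectrum f \<xi>) \<partial>lborel) \<le>
      ennreal ?p * (\<integral>\<^sup>+x. ennreal ((f x - f (z + x))\<^sup>2) \<partial>lborel)" for z
    unfolding bes using power_spectrum_bessel(3)[OF Bochner_Integration.integrable_diff[OF f f'] d2, of z]
    by (simp add: nn_integral_eq_integral[OF d2] ennreal_mult')
  have "(\<integral>\<^sup>+\<xi>. ennreal (2 / c) * ennreal (norm \<xi> powr (2 * s) * power_spectrum f \<xi>) \<partial>lborel) =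
      (\<integral>\<^sup>+\<xi>. ennreal (2 * power_spectrum f \<xi>) * ennreal (norm \<xi> powr (2 * s) / c) \<partial>lborel)"
    using c by (intro nn_integral_cong) (simp add: ennreal_mult'[symmetric])
  also have "\<dots> = (\<integral>\<^sup>+\<xi>. ennreal (2 * power_spectrum f \<xi>) * (\<integral>\<^sup>+z. ennreal ((1 - cos (\<xi> \<bullet> z)) / norm z powr p) \<partial>lborel) \<partial>lborel)"
    unfolding p_def nn_integral_one_minus_cos[OF s] c_def ..
  also have "\<dots> = (\<integral>\<^sup>+\<xi>. (\<integral>\<^sup>+z. ennreal (2 * power_spectrum f \<xi>) * ennreal ((1 - cos (\<xi> \<bullet> z)) / norm z powr p) \<partial>lborel) \<partial>lborel)"
    by (intro nn_integral_cong nn_integral_cmult[symmetric]) measurable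
  also have "\<dots> = (\<integral>\<^sup>+z. (\<integral>\<^sup>+\<xi>. ennreal (2 * power_spectrum f \<xi>) * ennreal ((1 - cos (\<xi> \<bullet> z)) / norm z powr p) \<partial>lborel) \<partial>lborel)"
    by (rule lborel_pair.Fubini') (simp add: case_prod_beta', measurable)
  also have "\<dots> = (\<integral>\<^sup>+z. ennreal (1 / norm z powr p) * (\<integral>\<^sup>+\<xi>. ennreal (2 * (1 - cos (\<xi> \<bullet> z)) * power_spectrum f \<xi>) \<partial>lborel) \<partial>lborel)"
    by (subst nn_integral_cmult[symmetric], measurable)
       (intro nn_integral_cong, simp add: ennreal_mult'[symmetric] mult_ac)
  also have "\<dots> \<le> (\<integral>\<^sup>+z. ennreal (1 / norm z powr p) * (ennreal ?p * (\<integral>\<^sup>+x. ennreal ((f x - f (z + x))\<^sup>2) \<partial>lborel)) \<partial>lborel)"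
    by (intro nn_integral_mono mult_left_mono inner) simp
  also have "\<dots> = ennreal ?p * (\<integral>\<^sup>+z. (\<integral>\<^sup>+x. ennreal ((f x - f (x + z))\<^sup>2 / norm (x - (x + z)) powr p) \<partial>lborel) \<partial>lborel)"
    by (subst nn_integral_cmult[symmetric], measurable)
       (intro nn_integral_cong, simp add: nn_integral_cmult[symmetric] ennreal_mult'[symmetric] mult_ac add_ac)
  also have "(\<integral>\<^sup>+z. (\<integral>\<^sup>+x. ennreal ((f x - f (x + z))\<^sup>2 / norm (x - (x + z)) powr p) \<partial>lborel) \<partial>lborel) =
      (\<integral>\<^sup>+x. (\<integral>\<^sup>+z. ennreal ((f x - f (x + z))\<^sup>2 / norm (x - (x + z)) powr p) \<partial>lborel) \<partial>lborel)"
    by (rule lborel_pair.Fubini') (simp add: case_prod_beta', measurable)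
  also have "\<dots> = (\<integral>\<^sup>+x. (\<integral>\<^sup>+y. ennreal ((f x - f y)\<^sup>2 / norm (x - y) powr p) \<partial>lborel) \<partial>lborel)"
    by (intro nn_integral_cong nn_integral_lborel_translate) measurable
  also have "\<dots> = (\<integral>\<^sup>+w. ennreal (case w of (x, y) \<Rightarrow> (f x - f y)\<^sup>2 / norm (x - y) powr p) \<partial>?P)"
    by (subst lborel.nn_integral_fst[symmetric]) auto
  also have "\<dots> = ennreal D"
    unfolding D_def using e by (intro nn_integral_eq_integral) (auto simp: p_def)
  also have "(\<integral>\<^sup>+\<xi>. ennreal (2 / c) * ennreal (norm \<xi> powr (2 * s) * power_spectrum f \<xi>) \<partial>lborel) =
      ennreal (2 / c) * (\<integral>\<^sup>+\<xi>. ennreal (norm \<xi> powr (2 * s) * power_spectrum f \<xi>) \<partial>lborel)"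
    by (rule nn_integral_cmult) measurable
  finally have "ennreal (c / 2) * (ennreal (2 / c) * (\<integral>\<^sup>+\<xi>. ennreal (norm \<xi> powr (2 * s) * power_spectrum f \<xi>) \<partial>lborel)) \<le>
    ennreal (c / 2) * (ennreal ?p * ennreal D)"
    by (intro mult_left_mono) auto
  then have 1: "(\<integral>\<^sup>+\<xi>. ennreal (norm \<xi> powr (2 * s) * power_spectrum f \<xi>) \<partial>lborel) \<le> ennreal (?p * (c / 2 * D))"
  proof -
    have "ennreal (c / 2) * (ennreal (2 / c) * x) = x" for x
      unfolding mult.assoc[symmetric] using c by (subst ennreal_mult'[symmetric]) auto
    moreover have "ennreal (c / 2) * (ennreal ?p * ennreal D) = ennreal (c / 2 * (?p * D))"
      using c by (simp only: ennreal_mult' zero_le_power pi_ge_zero mult_nonneg_nonneg zero_le_numeral divide_nonneg_pos less_imp_le zero_less_numeral)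
    moreover have "c / 2 * (?p * D) = ?p * (c / 2 * D)" by simp
    ultimately show ?thesis
      using \<open>ennreal (c / 2) * (ennreal (2 / c) * _) \<le> _\<close> by (simp only:)
  qed
  show 2: "integrable lborel (\<lambda>\<xi>. norm \<xi> powr (2 * s) * power_spectrum f \<xi>)"
    by (rule integrableI_nonneg) (measurable, simp, rule le_less_trans[OF 1], simp)
  show "(LBINT \<xi>. norm \<xi> powr (2 * s) * power_spectrum f \<xi>) \<le> ?p * (frac_lap_const DIM('a) s / 2 *
        (LINT (x, y)|?P. (f x - f y)\<^sup>2 / norm (x - y) powr (real DIM('a) + 2 * s)))"
    using 1 c D0 unfolding nn_integral_eq_integral[OF 2 AE_I2[OF mult_nonneg_nonneg[OF powr_ge_zero power_spectrum_nonneg]]]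
    by (simp add: D_def c_def p_def)
qed

section \<open>The fractional Dirichlet form\<close>

text \<open>Layer-cake formula: the weight at \<open>\<xi>\<close> is the length of the set of all
  \<open>t \<le> \<mu>\<close> above \<open>norm \<xi> powr (2 * s)\<close>, and for fixed
  \<open>t\<close> the admissible \<open>\<xi>\<close> fill a ball of volume proportional to
  \<open>t powr a\<close>. This is the phase-space integral of Weyl's law.\<close>

lemma weyl_weight:
  fixes s \<mu> :: real
  assumes s: "0 < s" and \<mu>: "0 \<le> \<mu>"
  defines "a \<equiv> real DIM('a::euclidean_space) / (2 * s)"
  shows "integrable lborel (\<lambda>\<xi>::'a. max 0 (\<mu> - norm \<xi> powr (2 * s)))"
    and "(LINT \<xi>|(lborel :: 'a measure). max 0 (\<mu> - norm \<xi> powr (2 * s))) =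
      unit_ball_vol (real DIM('a)) * \<mu> powr (1 + a) / (1 + a)"
proof -
  have a: "0 < a" using s by (simp add: a_def)
  let ?V = "unit_ball_vol (real DIM('a))"
  let ?h = "\<lambda>\<xi>::'a. \<lambda>t. indicator {0..\<mu>} t * (if norm \<xi> powr (2 * s) < t then 1 else 0) :: ennreal"
  have lev: "{\<xi>::'a. norm \<xi> powr (2 * s) < t} = ball 0 (t powr (1 / (2 * s)))" if "0 < t" for t
  proof -
    have "norm \<xi> powr (2 * s) < t \<longleftrightarrow> norm \<xi> < t powr (1 / (2 * s))" for \<xi> :: 'a
    proof -
      define T where "T = t powr (1 / (2 * s))"
      have T: "T powr (2 * s) = t"
        unfolding T_def powr_powr using s that by simp
      have "norm \<xi> powr (2 * s) < t" if "norm \<xi> < T"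
        using powr_less_mono2[of "2 * s" "norm \<xi>" T] s that T by simp
      moreover have "t \<le> norm \<xi> powr (2 * s)" if "T \<le> norm \<xi>"
        using powr_mono2[of "2 * s" T "norm \<xi>"] s that T by (simp add: T_def)
      ultimately show ?thesis
        unfolding T_def[symmetric] by (meson not_less)
    qed
    then show ?thesis
      unfolding ball_def dist_0_norm by (simp only:)
  qed
  have "(\<integral>\<^sup>+\<xi>. ennreal (max 0 (\<mu> - norm \<xi> powr (2 * s))) \<partial>(lborel :: 'a measure)) =
      (\<integral>\<^sup>+\<xi>. (\<integral>\<^sup>+t. ?h \<xi> t \<partial>lborel) \<partial>lborel)"
  proof (rule nn_integral_cong)
    fix \<xi> :: 'a
    have "(\<integral>\<^sup>+t. ?h \<xi> t \<partial>lborel) = (\<integral>\<^sup>+t. indicator {norm \<xi> powr (2 * s)<..\<mu>} t \<partial>lborel)"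
      by (rule nn_integral_cong) (auto simp: indicator_def intro: order.strict_implies_order le_less_trans[OF powr_ge_zero])
    also have "\<dots> = ennreal (max 0 (\<mu> - norm \<xi> powr (2 * s)))"
      by (cases "norm \<xi> powr (2 * s) \<le> \<mu>") auto
    finally show "ennreal (max 0 (\<mu> - norm \<xi> powr (2 * s))) = (\<integral>\<^sup>+t. ?h \<xi> t \<partial>lborel)" ..
  qed
  also have "\<dots> = (\<integral>\<^sup>+t. (\<integral>\<^sup>+\<xi>. ?h \<xi> t \<partial>lborel) \<partial>lborel)"
    by (rule lborel_pair.Fubini') (simp add: case_prod_beta', measurable)
  also have "\<dots> = (\<integral>\<^sup>+t. ennreal (indicator {0..\<mu>} t * (?V * t powr a)) \<partial>lborel)"
  proof (rule nn_integral_cong_AE, use AE_lborel_singleton[of "0::real"] in eventually_elim)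
    fix t :: real assume t0: "t \<noteq> 0"
    show "(\<integral>\<^sup>+\<xi>. ?h \<xi> t \<partial>lborel) = ennreal (indicator {0..\<mu>} t * (?V * t powr a))"
    proof (cases "t \<in> {0..\<mu>}")
      case True
      then have t: "0 < t" using t0 by auto
      have "(\<integral>\<^sup>+\<xi>. ?h \<xi> t \<partial>lborel) = (\<integral>\<^sup>+\<xi>. indicator {\<xi>::'a. norm \<xi> powr (2 * s) < t} \<xi> \<partial>lborel)"
        using True by (intro nn_integral_cong) (auto simp: indicator_def)
      also have "\<dots> = ennreal (?V * (t powr (1 / (2 * s))) ^ DIM('a))"
        unfolding lev[OF t] using t by (simp add: emeasure_ball)
      also have "(t powr (1 / (2 * s))) ^ DIM('a) = t powr a"
        using t by (simp add: powr_realpow[symmetric] powr_powr a_def)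
      finally show ?thesis using True by simp
    qed simp
  qed
  also have "\<dots> = ennreal (?V * (\<mu> powr (a + 1) / (a + 1)))"
  proof (rule nn_integral_has_integral_lebesgue)
    show "((\<lambda>t. ?V * t powr a) has_integral ?V * (\<mu> powr (a + 1) / (a + 1))) {0..\<mu>}"
      using a \<mu> by (intro has_integral_mult_right has_integral_powr_from_0) auto
  qed simp
  finally have nn: "(\<integral>\<^sup>+\<xi>. ennreal (max 0 (\<mu> - norm \<xi> powr (2 * s))) \<partial>(lborel :: 'a measure)) = ennreal (?V * (\<mu> powr (a + 1) / (a + 1)))" .
  have "has_bochner_integral (lborel :: 'a measure) (\<lambda>\<xi>. max 0 (\<mu> - norm \<xi> powr (2 * s))) (?V * (\<mu> powr (a + 1) / (a + 1)))"
    by (rule has_bochner_integral_nn_integral) (use nn a in \<open>auto intro!: mult_nonneg_nonneg divide_nonneg_nonneg\<close>)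
  then show "integrable lborel (\<lambda>\<xi>::'a. max 0 (\<mu> - norm \<xi> powr (2 * s)))"
    and "(LINT \<xi>|(lborel :: 'a measure). max 0 (\<mu> - norm \<xi> powr (2 * s))) = ?V * \<mu> powr (1 + a) / (1 + a)"
    by (auto simp: has_bochner_integral_iff add.commute)
qed

section \<open>Semidefinite symmetric forms on spaces of functions\<close>

text \<open>One set of rules for two forms, the L2 product and the energy. Elements are functions
  rather than classes, so \<open>B\<close> is only semidefinite: \<open>B u u = 0\<close> does not
  give \<open>u = 0\<close>.\<close>

locale sym_form =
  fixes S :: "('b \<Rightarrow> real) set" and B :: "('b \<Rightarrow> real) \<Rightarrow> ('b \<Rightarrow> real) \<Rightarrow> real"
  assumes zero_mem: "(\<lambda>x. 0) \<in> S"
    and add_mem: "\<And>u w. u \<in> S \<Longrightarrow> w \<in> S \<Longrightarrow> (\<lambda>x. u x + w x) \<in> S"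
    and scale_mem: "\<And>u a. u \<in> S \<Longrightarrow> (\<lambda>x. a * u x) \<in> S"
    and add_left: "\<And>u v w. u \<in> S \<Longrightarrow> v \<in> S \<Longrightarrow> w \<in> S \<Longrightarrow> B (\<lambda>x. u x + v x) w = B u w + B v w"
    and scale_left: "\<And>u w a. u \<in> S \<Longrightarrow> w \<in> S \<Longrightarrow> B (\<lambda>x. a * u x) w = a * B u w"
    and form_sym: "\<And>u w. B u w = B w u"
    and form_nonneg: "\<And>u. u \<in> S \<Longrightarrow> 0 \<le> B u u"
begin

lemma add_right: "u \<in> S \<Longrightarrow> v \<in> S \<Longrightarrow> w \<in> S \<Longrightarrow> B w (\<lambda>x. u x + v x) = B w u + B w v"
  using add_left[of u v w] by (simp add: form_sym[of w])

lemma scale_right: "u \<in> S \<Longrightarrow> w \<in> S \<Longrightarrow> B w (\<lambda>x. a * u x) = a * B w u"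
  using scale_left[of u w a] by (simp add: form_sym[of w])

lemma diff_mem: "u \<in> S \<Longrightarrow> w \<in> S \<Longrightarrow> (\<lambda>x. u x - w x) \<in> S"
  using add_mem[of u "\<lambda>x. - 1 * w x"] scale_mem[of w "- 1"] by simp

lemma diff_left: "u \<in> S \<Longrightarrow> v \<in> S \<Longrightarrow> w \<in> S \<Longrightarrow> B (\<lambda>x. u x - v x) w = B u w - B v w"
  using add_left[of u "\<lambda>x. - 1 * v x" w] scale_left[of v w "- 1"] scale_mem[of v "- 1"] by simp

lemma diff_right: "u \<in> S \<Longrightarrow> v \<in> S \<Longrightarrow> w \<in> S \<Longrightarrow> B w (\<lambda>x. u x - v x) = B w u - B w v"
  using diff_left[of u v w] by (simp add: form_sym[of w])

lemma zero_left: "w \<in> S \<Longrightarrow> B (\<lambda>x. 0) w = 0"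
  using scale_left[of "\<lambda>x. 0" w 0] zero_mem by simp

lemma lincomb_mem: "finite I \<Longrightarrow> (\<And>i. i \<in> I \<Longrightarrow> \<phi> i \<in> S) \<Longrightarrow> (\<lambda>x. \<Sum>i\<in>I. c i * \<phi> i x) \<in> S"
  by (induction rule: finite_induct) (simp_all add: zero_mem add_mem scale_mem)

lemma lincomb_left:
  "finite I \<Longrightarrow> (\<And>i. i \<in> I \<Longrightarrow> \<phi> i \<in> S) \<Longrightarrow> w \<in> S \<Longrightarrow>
    B (\<lambda>x. \<Sum>i\<in>I. c i * \<phi> i x) w = (\<Sum>i\<in>I. c i * B (\<phi> i) w)"
  by (induction rule: finite_induct)
     (simp_all add: zero_left add_left scale_left scale_mem lincomb_mem)

lemma lincomb_right:
  "finite I \<Longrightarrow> (\<And>i. i \<in> I \<Longrightarrow> \<phi> i \<in> S) \<Longrightarrow> w \<in> S \<Longrightarrow>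
    B w (\<lambda>x. \<Sum>i\<in>I. c i * \<phi> i x) = (\<Sum>i\<in>I. c i * B w (\<phi> i))"
  using lincomb_left[of I \<phi> w c] by (simp add: form_sym[of w])

lemma orthonormal_remainder:
  assumes "finite I" "\<And>i. i \<in> I \<Longrightarrow> \<phi> i \<in> S" "g \<in> S"
    and on: "\<And>i j. i \<in> I \<Longrightarrow> j \<in> I \<Longrightarrow> B (\<phi> i) (\<phi> j) = (if i = j then 1 else 0)"
  defines "r \<equiv> \<lambda>x. g x - (\<Sum>i\<in>I. B g (\<phi> i) * \<phi> i x)"
  shows "r \<in> S" and "\<And>j. j \<in> I \<Longrightarrow> B r (\<phi> j) = 0" and "B g g = B r r + (\<Sum>i\<in>I. (B g (\<phi> i))\<^sup>2)"
proof -
  let ?p = "\<lambda>x. \<Sum>i\<in>I. B g (\<phi> i) * \<phi> i x"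
  have p: "?p \<in> S" using assms by (intro lincomb_mem) auto
  show r: "r \<in> S" unfolding r_def using assms p by (intro diff_mem)
  show orth: "B r (\<phi> j) = 0" if "j \<in> I" for j
    unfolding r_def using assms that p
    by (simp add: diff_left lincomb_left if_distrib[of "(*) _"] cong: if_cong)
  have "B r ?p = 0"
    using assms r orth by (simp add: lincomb_right)
  moreover have "B g ?p = (\<Sum>i\<in>I. (B g (\<phi> i))\<^sup>2)"
    using assms by (simp add: lincomb_right power2_eq_square)
  moreover have "B r g = B g g - B ?p g" "B r ?p = B g ?p - B ?p ?p"
    unfolding r_def using assms(3) p by (simp_all add: diff_left)
  moreover have "B r r = B r g - B r ?p"
    using diff_right[of g ?p r] assms(3) p r by (simp add: r_def)
  ultimately show "B g g = B r r + (\<Sum>i\<in>I. (B g (\<phi> i))\<^sup>2)"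
    using form_sym[of ?p g] by linarith
qed

lemma bessel_inequality:
  assumes "finite I" "\<And>i. i \<in> I \<Longrightarrow> \<phi> i \<in> S" "g \<in> S"
    and "\<And>i j. i \<in> I \<Longrightarrow> j \<in> I \<Longrightarrow> B (\<phi> i) (\<phi> j) = (if i = j then 1 else 0)"
  shows "(\<Sum>i\<in>I. (B g (\<phi> i))\<^sup>2) \<le> B g g"
  using form_nonneg[OF orthonormal_remainder(1)[OF assms]] orthonormal_remainder(3)[OF assms] by linarith

end

section \<open>The Dirichlet space in Borel form\<close>

locale frac_domain =
  fixes s :: real and \<Omega> :: "'a::euclidean_space set"
  assumes s: "0 < s" "s < 1" and open_dom: "open \<Omega>" and bounded_dom: "bounded \<Omega>"
begin

abbreviation kern :: "'a \<Rightarrow> real" where "kern z \<equiv> norm z powr (real DIM('a) + 2 * s)"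

definition L2 :: "('a \<Rightarrow> real) set" where
  "L2 = {u \<in> borel_measurable borel. (\<forall>x. x \<notin> \<Omega> \<longrightarrow> u x = 0) \<and> integrable lborel (\<lambda>x. (u x)\<^sup>2)}"

definition ip :: "('a \<Rightarrow> real) \<Rightarrow> ('a \<Rightarrow> real) \<Rightarrow> real" where
  "ip u w = (LBINT x. u x * w x)"

text \<open>Borel counterpart of \<open>frac_H0\<close> over \<open>lborel\<close>, where Tonelli,
  translations and reflections apply directly. Square integrability is a consequence, by the
  Poincare inequality \<open>H_subset_L2\<close>.\<close>

definition H :: "('a \<Rightarrow> real) set" where
  "H = {u \<in> borel_measurable borel. (\<forall>x. x \<notin> \<Omega> \<longrightarrow> u x = 0) \<and>
    integrable (lborel \<Otimes>\<^sub>M lborel) (\<lambda>(x, y). (u x - u y)\<^sup>2 / kern (x - y))}"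

definition en :: "('a \<Rightarrow> real) \<Rightarrow> ('a \<Rightarrow> real) \<Rightarrow> real" where
  "en u w = frac_lap_const DIM('a) s / 2 *
    (LINT (x, y)|(lborel \<Otimes>\<^sub>M lborel). (u x - u y) * (w x - w y) / kern (x - y))"

lemma dom_sets [measurable]: "\<Omega> \<in> sets borel"
  using open_dom by auto

lemma emeasure_dom: "emeasure lborel \<Omega> < \<infinity>"
  by (rule emeasure_bounded_finite[OF bounded_dom])

lemma integrable_indicator_dom: "integrable lborel (indicator \<Omega> :: 'a \<Rightarrow> real)"
  using emeasure_dom by (simp add: integrable_indicator_iff)

lemma const_pos: "0 < frac_lap_const DIM('a) s"
  by (rule frac_lap_const_pos[OF s])

lemma L2D:
  assumes "u \<in> L2"
  shows "u \<in> borel_measurable borel" "\<And>x. x \<notin> \<Omega> \<Longrightarrow> u x = 0" "integrable lborel (\<lambda>x. (u x)\<^sup>2)"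
  using assms by (auto simp: L2_def)

lemma HD:
  assumes "u \<in> H"
  shows "u \<in> borel_measurable borel" "\<And>x. x \<notin> \<Omega> \<Longrightarrow> u x = 0"
    "integrable (lborel \<Otimes>\<^sub>M lborel) (\<lambda>(x, y). (u x - u y)\<^sup>2 / kern (x - y))"
  using assms by (auto simp: H_def)

lemma L2_integrable_mult:
  assumes u: "u \<in> L2" and w: "w \<in> L2"
  shows "integrable lborel (\<lambda>x. u x * w x)"
proof (rule Bochner_Integration.integrable_bound)
  note [measurable] = L2D(1)[OF u] L2D(1)[OF w]
  show "integrable lborel (\<lambda>x. (u x)\<^sup>2 + (w x)\<^sup>2)" using L2D(3) u w by simp
  have "\<bar>a * b\<bar> \<le> \<bar>a\<^sup>2 + b\<^sup>2\<bar>" for a b :: real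
  proof -
    have "2 * \<bar>a * b\<bar> \<le> a\<^sup>2 + b\<^sup>2"
      using zero_le_power2[of "\<bar>a\<bar> - \<bar>b\<bar>"] by (simp add: power2_diff abs_mult)
    then show ?thesis by (smt (verit) abs_ge_zero abs_ge_self)
  qed
  then show "AE x in lborel. norm (u x * w x) \<le> norm ((u x)\<^sup>2 + (w x)\<^sup>2)" by simp
qed (use L2D(1)[OF u] L2D(1)[OF w] in measurable)

lemma indicator_L2: "(\<lambda>x. indicator \<Omega> x :: real) \<in> L2"
proof -
  have "(\<lambda>x. (indicator \<Omega> x :: real)\<^sup>2) = indicator \<Omega>" by (auto simp: indicator_def fun_eq_iff)
  then show ?thesis using integrable_indicator_dom by (simp add: L2_def)
qed

lemma L2_integrable:
  assumes u: "u \<in> L2" shows "integrable lborel u"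
proof -
  have "(\<lambda>x. u x * indicator \<Omega> x) = u" using L2D(2)[OF u] by (auto simp: indicator_def fun_eq_iff)
  then show ?thesis using L2_integrable_mult[OF u indicator_L2] by simp
qed

lemma L2_bounded_mult:
  assumes u: "u \<in> L2" and [measurable]: "g \<in> borel_measurable borel" and g: "\<And>x. \<bar>g x\<bar> \<le> 1"
  shows "(\<lambda>x. u x * g x) \<in> L2"
proof -
  note [measurable] = L2D(1)[OF u]
  have "integrable lborel (\<lambda>x. (u x * g x)\<^sup>2)"
  proof (rule Bochner_Integration.integrable_bound[OF L2D(3)[OF u]])
    have "(u x * g x)\<^sup>2 \<le> (u x)\<^sup>2" for x
      using mult_left_mono[OF power_mono[OF g[of x], of 2], of "(u x)\<^sup>2"] by (simp add: power_mult_distrib)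
    then show "AE x in lborel. norm ((u x * g x)\<^sup>2) \<le> norm ((u x)\<^sup>2)" by simp
  qed measurable
  then show ?thesis using L2D(2)[OF u] by (auto simp: L2_def)
qed

text \<open>
  A Poincare inequality: for \<open>x \<in> \<Omega>\<close>, integrating the quotient over \<open>y\<close> in a unit ball far away
  from \<open>\<Omega>\<close>, where \<open>u y = 0\<close>, bounds \<open>(u x)\<^sup>2\<close>.
\<close>

lemma H_subset_L2: "H \<subseteq> L2"
proof
  fix u assume u: "u \<in> H"
  note [measurable] = HD(1)[OF u]
  obtain r where r: "0 < r" "\<Omega> \<subseteq> ball 0 r" using bounded_dom by (metis bounded_subset_ballD)
  obtain b :: 'a where b: "b \<in> Basis" by (rule nonempty_Basis[THEN ex_in_conv[THEN iffD2], THEN exE])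
  \<comment> \<open>Norms in this ball lie strictly between \<open>r + 1\<close> and
    \<open>r + 3\<close>, so it misses \<open>\<Omega>\<close>, and its points are at distance less
    than \<open>2 * r + 3\<close> from those of \<open>\<Omega>\<close>. \<open>D\<close> is the
    value of the kernel at that distance.\<close>
  define A where "A = ball ((r + 2) *\<^sub>R b) 1"
  define D where "D = kern ((2 * r + 3) *\<^sub>R b)"
  have D: "D = (2 * r + 3) powr (real DIM('a) + 2 * s)" using b r by (simp add: D_def)
  then have D0: "D > 0" using r by simp
  have A: "y \<notin> \<Omega>" "norm (x - y) \<le> 2 * r + 3" if "y \<in> A" "x \<in> \<Omega>" for x y
  proof -
    have "norm ((r + 2) *\<^sub>R b - y) < 1" using that by (simp add: A_def dist_norm)
    moreover have "norm ((r + 2) *\<^sub>R b) = r + 2" using b r by simp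
    moreover have "norm x < r" using that r by (auto simp: dist_norm)
    ultimately have y: "norm y > r + 1" "norm y < r + 3" and x: "norm x < r"
      using norm_triangle_ineq2[of "(r + 2) *\<^sub>R b" y] norm_triangle_ineq2[of y "(r + 2) *\<^sub>R b"]
      by (auto simp: norm_minus_commute)
    then show "y \<notin> \<Omega>" "norm (x - y) \<le> 2 * r + 3"
      using r norm_triangle_ineq4[of x y] by (force simp: dist_norm)+
  qed
  have A_pos: "emeasure lborel A = ennreal (unit_ball_vol (real DIM('a)))"
    unfolding A_def by (simp add: emeasure_ball)
  have Am [measurable]: "A \<in> sets borel" by (simp add: A_def)
  have "ennreal (unit_ball_vol (real DIM('a)) / D) * (\<integral>\<^sup>+x. ennreal ((u x)\<^sup>2) \<partial>lborel) =
      (\<integral>\<^sup>+x. (\<integral>\<^sup>+y. ennreal ((u x)\<^sup>2 / D) * indicator A y \<partial>lborel) \<partial>lborel)"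
  proof -
    have "(\<integral>\<^sup>+y. ennreal ((u x)\<^sup>2 / D) * indicator A y \<partial>lborel) =
        ennreal (unit_ball_vol (real DIM('a)) / D) * ennreal ((u x)\<^sup>2)" for x
    proof -
      have "(\<integral>\<^sup>+y. ennreal ((u x)\<^sup>2 / D) * indicator A y \<partial>lborel) =
          ennreal ((u x)\<^sup>2 / D) * ennreal (unit_ball_vol (real DIM('a)))"
        using Am by (subst nn_integral_cmult_indicator) (simp_all add: A_pos)
      also have "\<dots> = ennreal ((u x)\<^sup>2 / D * unit_ball_vol (real DIM('a)))"
        using D0 by (subst ennreal_mult') auto
      also have "(u x)\<^sup>2 / D * unit_ball_vol (real DIM('a)) = unit_ball_vol (real DIM('a)) / D * (u x)\<^sup>2" by simp
      also have "ennreal \<dots> = ennreal (unit_ball_vol (real DIM('a)) / D) * ennreal ((u x)\<^sup>2)"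
        using D0 by (subst ennreal_mult') auto
      finally show ?thesis .
    qed
    then show ?thesis by (simp add: nn_integral_cmult)
  qed
  also have "\<dots> \<le> (\<integral>\<^sup>+x. (\<integral>\<^sup>+y. ennreal ((u x - u y)\<^sup>2 / kern (x - y)) \<partial>lborel) \<partial>lborel)"
  proof (intro nn_integral_mono)
    fix x y
    show "ennreal ((u x)\<^sup>2 / D) * indicator A y \<le> ennreal ((u x - u y)\<^sup>2 / kern (x - y))"
    proof (cases "x \<in> \<Omega> \<and> y \<in> A")
      case True
      then have "y \<notin> \<Omega>" "norm (x - y) \<le> 2 * r + 3" using A by auto
      moreover from this True have "x \<noteq> y" by auto
      ultimately have "0 < norm (x - y)" "norm (x - y) \<le> 2 * r + 3" "u y = 0"
        using HD(2)[OF u, of y] by auto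
      then have "kern (x - y) \<le> D" "0 < kern (x - y)" "u y = 0"
        unfolding D using powr_mono2[of "real DIM('a) + 2 * s" "norm (x - y)" "2 * r + 3"] s by auto
      then show ?thesis using True D0 by (auto intro!: ennreal_leI divide_left_mono)
    next
      case False
      then show ?thesis using HD(2)[OF u] by (auto simp: indicator_def)
    qed
  qed
  also have "\<dots> = (\<integral>\<^sup>+z. ennreal (case z of (x, y) \<Rightarrow> (u x - u y)\<^sup>2 / kern (x - y)) \<partial>(lborel \<Otimes>\<^sub>M lborel))"
    by (subst lborel.nn_integral_fst[symmetric]) auto
  also have "\<dots> < \<infinity>"
    using HD(3)[OF u] by (subst nn_integral_eq_integral) auto
  finally have "(\<integral>\<^sup>+x. ennreal ((u x)\<^sup>2) \<partial>lborel) < \<infinity>"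
    using D0 unit_ball_vol_pos[of "real DIM('a)"] by (auto simp: ennreal_mult_less_top simp del: unit_ball_vol_pos)
  then have "integrable lborel (\<lambda>x. (u x)\<^sup>2)" by (intro integrableI_nonneg) auto
  then show "u \<in> L2" using HD[OF u] by (auto simp: L2_def)
qed

lemma H_L2: "u \<in> H \<Longrightarrow> u \<in> L2"
  using H_subset_L2 by blast

lemma H_integrable_mult:
  assumes u: "u \<in> H" and w: "w \<in> H"
  shows "integrable (lborel \<Otimes>\<^sub>M lborel) (\<lambda>(x, y). (u x - u y) * (w x - w y) / kern (x - y))"
proof (rule Bochner_Integration.integrable_bound)
  note [measurable] = HD(1)[OF u] HD(1)[OF w]
  show "integrable (lborel \<Otimes>\<^sub>M lborel) (\<lambda>z. (case z of (x, y) \<Rightarrow> (u x - u y)\<^sup>2 / kern (x - y)) +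
      (case z of (x, y) \<Rightarrow> (w x - w y)\<^sup>2 / kern (x - y)))"
    using HD(3)[OF u] HD(3)[OF w] by (rule Bochner_Integration.integrable_add)
  have "\<bar>a * b / k\<bar> \<le> \<bar>a\<^sup>2 / k + b\<^sup>2 / k\<bar>" if "0 \<le> k" for a b k :: real
  proof -
    have "2 * \<bar>a * b\<bar> \<le> a\<^sup>2 + b\<^sup>2"
      using zero_le_power2[of "\<bar>a\<bar> - \<bar>b\<bar>"] by (simp add: power2_diff abs_mult)
    then have "\<bar>a * b\<bar> \<le> \<bar>a\<^sup>2 + b\<^sup>2\<bar>" by (smt (verit) abs_ge_zero abs_ge_self)
    then show ?thesis using that unfolding add_divide_distrib[symmetric] abs_divide
      by (intro divide_right_mono) auto
  qed
  then show "AE z in lborel \<Otimes>\<^sub>M lborel. norm (case z of (x, y) \<Rightarrow> (u x - u y) * (w x - w y) / kern (x - y)) \<le>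
      norm ((case z of (x, y) \<Rightarrow> (u x - u y)\<^sup>2 / kern (x - y)) + (case z of (x, y) \<Rightarrow> (w x - w y)\<^sup>2 / kern (x - y)))"
    by (auto simp del: norm_powr_real_powr)
qed (use HD(1)[OF u] HD(1)[OF w] in measurable)

sublocale L2: sym_form L2 ip
proof
  fix u w :: "'a \<Rightarrow> real" and a :: real
  show "ip u w = ip w u" by (simp add: ip_def mult.commute)
  show "(\<lambda>x. 0) \<in> L2" by (simp add: L2_def)
  assume u: "u \<in> L2"
  note [measurable] = L2D(1)[OF u]
  show "0 \<le> ip u u" by (simp add: ip_def)
  show "(\<lambda>x. a * u x) \<in> L2" using L2D[OF u] by (auto simp: L2_def power_mult_distrib)
  assume w: "w \<in> L2"
  note [measurable] = L2D(1)[OF w]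
  show "(\<lambda>x. u x + w x) \<in> L2"
    using L2D[OF u] L2D[OF w] L2_integrable_mult[OF u w] by (auto simp: L2_def power2_sum mult.assoc)
  show "ip (\<lambda>x. a * u x) w = a * ip u w" by (simp add: ip_def mult.assoc)
  fix v assume v: "v \<in> L2"
  show "ip (\<lambda>x. u x + v x) w = ip u w + ip v w"
    using L2_integrable_mult[OF u w] L2_integrable_mult[OF v w] by (simp add: ip_def distrib_right)
qed

sublocale H: sym_form H en
proof
  fix u w :: "'a \<Rightarrow> real" and a :: real
  show "en u w = en w u" by (simp add: en_def mult.commute)
  show "(\<lambda>x. 0) \<in> H" by (simp add: H_def case_prod_unfold)
  assume u: "u \<in> H"
  note [measurable] = HD(1)[OF u]
  show "0 \<le> en u u" unfolding en_def using const_pos by (intro mult_nonneg_nonneg Bochner_Integration.integral_nonneg) auto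
  have "integrable (lborel \<Otimes>\<^sub>M lborel) (\<lambda>z. a\<^sup>2 * (case z of (x, y) \<Rightarrow> (u x - u y)\<^sup>2 / kern (x - y)))"
    using HD(3)[OF u] by (rule integrable_mult_right)
  also have "(\<lambda>z. a\<^sup>2 * (case z of (x, y) \<Rightarrow> (u x - u y)\<^sup>2 / kern (x - y))) =
      (\<lambda>(x, y). (a * u x - a * u y)\<^sup>2 / kern (x - y))"
    by (auto simp: power_mult_distrib right_diff_distrib[symmetric])
  finally show "(\<lambda>x. a * u x) \<in> H" using HD[OF u] by (auto simp: H_def)
  assume w: "w \<in> H"
  note [measurable] = HD(1)[OF w]
  have "integrable (lborel \<Otimes>\<^sub>M lborel) (\<lambda>z. (case z of (x, y) \<Rightarrow> (u x - u y)\<^sup>2 / kern (x - y)) +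
      (case z of (x, y) \<Rightarrow> (w x - w y)\<^sup>2 / kern (x - y)) + 2 * (case z of (x, y) \<Rightarrow> (u x - u y) * (w x - w y) / kern (x - y)))"
    using HD(3)[OF u] HD(3)[OF w] H_integrable_mult[OF u w]
    by (intro Bochner_Integration.integrable_add integrable_mult_right)
  also have "(\<lambda>z. (case z of (x, y) \<Rightarrow> (u x - u y)\<^sup>2 / kern (x - y)) +
      (case z of (x, y) \<Rightarrow> (w x - w y)\<^sup>2 / kern (x - y)) + 2 * (case z of (x, y) \<Rightarrow> (u x - u y) * (w x - w y) / kern (x - y))) =
      (\<lambda>(x, y). ((u x + w x) - (u y + w y))\<^sup>2 / kern (x - y))"
  proof -
    have eq: "a\<^sup>2 / k + b\<^sup>2 / k + 2 * (a * b / k) = (a + b)\<^sup>2 / k" for a b k :: real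
      by (simp add: power2_sum add_divide_distrib)
    have d: "(u x + w x) - (u y + w y) = (u x - u y) + (w x - w y)" for x y by simp
    show ?thesis by (rule ext, clarify, unfold prod.case d, rule eq)
  qed
  finally show "(\<lambda>x. u x + w x) \<in> H" using HD[OF u] HD[OF w] by (auto simp: H_def)
  have "(\<lambda>(x, y). (a * u x - a * u y) * (w x - w y) / kern (x - y)) =
      (\<lambda>z. a * (case z of (x, y) \<Rightarrow> (u x - u y) * (w x - w y) / kern (x - y)))"
    by (auto simp: algebra_simps diff_divide_distrib add_divide_distrib)
  then show "en (\<lambda>x. a * u x) w = a * en u w" by (simp add: en_def)
  fix v assume v: "v \<in> H"
  have "(\<lambda>(x, y). (u x + v x - (u y + v y)) * (w x - w y) / kern (x - y)) =
      (\<lambda>z. (case z of (x, y) \<Rightarrow> (u x - u y) * (w x - w y) / kern (x - y)) +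
        (case z of (x, y) \<Rightarrow> (v x - v y) * (w x - w y) / kern (x - y)))"
    by (auto simp: algebra_simps diff_divide_distrib add_divide_distrib)
  then show "en (\<lambda>x. u x + v x) w = en u w + en v w"
    using H_integrable_mult[OF u w] H_integrable_mult[OF v w]
    by (simp add: en_def distrib_left)
qed

section \<open>Bounding the form by power spectra\<close>

lemma ip_self: "ip u u = (LBINT x. (u x)\<^sup>2)"
  by (simp add: ip_def power2_eq_square)

lemma en_self: "en u u = frac_lap_const DIM('a) s / 2 *
    (LINT (x, y)|(lborel \<Otimes>\<^sub>M lborel). (u x - u y)\<^sup>2 / kern (x - y))"
  by (simp add: en_def power2_eq_square)

abbreviation weight :: "real \<Rightarrow> 'a \<Rightarrow> real" where
  "weight \<mu> \<xi> \<equiv> max 0 (\<mu> - norm \<xi> powr (2 * s))"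

lemma integrable_weight_spectrum:
  assumes u: "u \<in> L2" and \<mu>: "0 \<le> \<mu>"
  shows "integrable lborel (\<lambda>\<xi>. weight \<mu> \<xi> * power_spectrum u \<xi>)"
proof (rule Bochner_Integration.integrable_bound)
  note [measurable] = L2D(1)[OF u]
  show "integrable lborel (\<lambda>\<xi>. \<mu> * power_spectrum u \<xi>)"
    using power_spectrum_bessel(1)[OF L2_integrable[OF u] L2D(3)[OF u]] by simp
  show "AE \<xi> in lborel. norm (weight \<mu> \<xi> * power_spectrum u \<xi>) \<le> norm (\<mu> * power_spectrum u \<xi>)"
    using \<mu> by (auto simp: abs_mult intro!: mult_right_mono)
qed (use L2D(1)[OF u] in measurable)

text \<open>The squared norm carries the coefficient \<open>\<mu> \<ge> 0\<close> and is estimated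
  from above by the spectrum; the energy carries a minus sign and is estimated from below by the
  moment. Thus both one-sided Plancherel estimates point the right way. Passing to the positive part
  of the weight only increases the integral, as power spectra are nonnegative.\<close>

lemma form_le_weight_spectrum:
  assumes u: "u \<in> H" and \<mu>: "0 \<le> \<mu>"
  shows "(2 * pi) ^ DIM('a) * (\<mu> * ip u u - en u u) \<le> (LBINT \<xi>. weight \<mu> \<xi> * power_spectrum u \<xi>)"
proof -
  note u2 = H_L2[OF u]
  note ii = L2_integrable[OF u2] L2D(3)[OF u2] 
  note I1 = power_spectrum_bessel(1)[OF ii] and I2 = power_spectrum_energy_le[OF s ii HD(3)[OF u]]
  have "(2 * pi) ^ DIM('a) * (\<mu> * ip u u) \<le> \<mu> * (LBINT \<xi>. power_spectrum u \<xi>)"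
    using mult_left_mono[OF power_spectrum_plancherel_le[OF s(1) ii HD(3)[OF u]] \<mu>]
    by (simp add: ip_self mult_ac)
  moreover have "(LBINT \<xi>. norm \<xi> powr (2 * s) * power_spectrum u \<xi>) \<le> (2 * pi) ^ DIM('a) * en u u"
    using I2(2) by (simp add: en_self)
  ultimately have "(2 * pi) ^ DIM('a) * (\<mu> * ip u u - en u u) \<le>
      \<mu> * (LBINT \<xi>. power_spectrum u \<xi>) - (LBINT \<xi>. norm \<xi> powr (2 * s) * power_spectrum u \<xi>)"
    by (simp add: right_diff_distrib)
  also have "\<dots> = (LBINT \<xi>. \<mu> * power_spectrum u \<xi> - norm \<xi> powr (2 * s) * power_spectrum u \<xi>)"
    using I1 I2(1) by simp
  also have "\<dots> \<le> (LBINT \<xi>. weight \<mu> \<xi> * power_spectrum u \<xi>)"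
  proof (rule integral_mono[OF _ integrable_weight_spectrum[OF u2 \<mu>]])
    show "\<mu> * power_spectrum u \<xi> - norm \<xi> powr (2 * s) * power_spectrum u \<xi> \<le> weight \<mu> \<xi> * power_spectrum u \<xi>" for \<xi>
      unfolding left_diff_distrib[symmetric] by (intro mult_right_mono) auto
  qed (use I1 I2(1) in simp)
  finally show ?thesis .
qed

text \<open>At a fixed frequency the transforms of the \<open>\<phi> i\<close> are their
  coefficients against the cosine and the sine cut off to \<open>\<Omega>\<close>. Bessel's
  inequality for these two functions and \<open>cos^2 + sin^2 = 1\<close> leave the volume.\<close>

lemma sum_power_spectrum_le:
  assumes "finite I" "\<And>i. i \<in> I \<Longrightarrow> \<phi> i \<in> L2"
    and "\<And>i j. i \<in> I \<Longrightarrow> j \<in> I \<Longrightarrow> ip (\<phi> i) (\<phi> j) = (if i = j then 1 else 0)"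
  shows "(\<Sum>i\<in>I. power_spectrum (\<phi> i) \<xi>) \<le> measure lborel \<Omega>"
proof -
  let ?c = "\<lambda>x. indicator \<Omega> x * cos (\<xi> \<bullet> x)" and ?s = "\<lambda>x. indicator \<Omega> x * sin (\<xi> \<bullet> x)"
  have c: "?c \<in> L2" "?s \<in> L2"
    by (rule L2_bounded_mult[OF indicator_L2]; simp)+
  have eq: "ip ?c (\<phi> i) = cos_tr (\<phi> i) \<xi>" "ip ?s (\<phi> i) = sin_tr (\<phi> i) \<xi>" if "i \<in> I" for i
    unfolding ip_def cos_tr_def sin_tr_def using L2D(2)[OF assms(2)[OF that]]
    by (auto intro!: Bochner_Integration.integral_cong simp: indicator_def)
  have "(\<Sum>i\<in>I. power_spectrum (\<phi> i) \<xi>) = (\<Sum>i\<in>I. (ip ?c (\<phi> i))\<^sup>2) + (\<Sum>i\<in>I. (ip ?s (\<phi> i))\<^sup>2)"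
    using eq by (simp add: power_spectrum_def sum.distrib)
  also have "\<dots> \<le> ip ?c ?c + ip ?s ?s"
    using assms c by (intro add_mono L2.bessel_inequality) auto
  also have "\<dots> = (LBINT x. ?c x * ?c x + ?s x * ?s x)"
    unfolding ip_def by (rule Bochner_Integration.integral_add[symmetric]) (intro L2_integrable_mult c)+
  also have "\<dots> = (LBINT x. indicator \<Omega> x)"
  proof (intro Bochner_Integration.integral_cong refl)
    fix x
    show "?c x * ?c x + ?s x * ?s x = indicator \<Omega> x"
      using sin_cos_squared_add[of "\<xi> \<bullet> x"] by (auto simp: indicator_def power2_eq_square)
  qed
  finally show ?thesis by simp
qed

lemma berezin_li_yau:
  assumes I: "finite I" "\<And>i. i \<in> I \<Longrightarrow> \<phi> i \<in> H"
    and on: "\<And>i j. i \<in> I \<Longrightarrow> j \<in> I \<Longrightarrow> ip (\<phi> i) (\<phi> j) = (if i = j then 1 else 0)"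
    and \<mu>: "0 \<le> \<mu>"
  shows "(2 * pi) ^ DIM('a) * (\<Sum>i\<in>I. \<mu> - en (\<phi> i) (\<phi> i)) \<le> measure lborel \<Omega> * (LBINT \<xi>. weight \<mu> \<xi>)"
proof -
  have "(2 * pi) ^ DIM('a) * (\<Sum>i\<in>I. \<mu> - en (\<phi> i) (\<phi> i)) =
      (\<Sum>i\<in>I. (2 * pi) ^ DIM('a) * (\<mu> * ip (\<phi> i) (\<phi> i) - en (\<phi> i) (\<phi> i)))"
    using on by (simp add: sum_distrib_left)
  also have "\<dots> \<le> (\<Sum>i\<in>I. LBINT \<xi>. weight \<mu> \<xi> * power_spectrum (\<phi> i) \<xi>)"
    by (intro sum_mono form_le_weight_spectrum I \<mu>)
  also have "\<dots> = (LBINT \<xi>. weight \<mu> \<xi> * (\<Sum>i\<in>I. power_spectrum (\<phi> i) \<xi>))"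
    unfolding sum_distrib_left using I H_L2 \<mu>
    by (intro Bochner_Integration.integral_sum[symmetric] integrable_weight_spectrum) auto
  also have "\<dots> \<le> (LBINT \<xi>. weight \<mu> \<xi> * measure lborel \<Omega>)"
  proof (rule integral_mono)
    show "integrable lborel (\<lambda>\<xi>. weight \<mu> \<xi> * (\<Sum>i\<in>I. power_spectrum (\<phi> i) \<xi>))"
      unfolding sum_distrib_left using I H_L2 \<mu>
      by (intro Bochner_Integration.integrable_sum integrable_weight_spectrum) auto
    show "integrable lborel (\<lambda>\<xi>. weight \<mu> \<xi> * measure lborel \<Omega>)"
      using weyl_weight(1)[OF s(1) \<mu>, where 'a='a] by simp
    show "weight \<mu> \<xi> * (\<Sum>i\<in>I. power_spectrum (\<phi> i) \<xi>) \<le> weight \<mu> \<xi> * measure lborel \<Omega>" for \<xi>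
      using I H_L2 on by (intro mult_left_mono sum_power_spectrum_le) auto
  qed
  finally show ?thesis by (simp add: mult.commute)
qed

end

section \<open>Existence of Rayleigh minimizers\<close>

context sym_form
begin

lemma form_add_scaled:
  assumes "u \<in> S" "w \<in> S"
  shows "B (\<lambda>x. u x + t * w x) (\<lambda>x. u x + t * w x) = B u u + 2 * t * B u w + t\<^sup>2 * B w w"
  using assms scale_mem[of w t] add_mem[of u "\<lambda>x. t * w x"]
  by (simp add: add_left add_right scale_left scale_right form_sym[of w u] power2_eq_square algebra_simps)

lemma cauchy_schwarz:
  assumes u: "u \<in> S" and w: "w \<in> S"
  shows "(B u w)\<^sup>2 \<le> B u u * B w w"
proof -
  have nn: "0 \<le> B u u + 2 * t * B u w + t\<^sup>2 * B w w" for t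
    unfolding form_add_scaled[OF u w, symmetric] using u w by (intro form_nonneg add_mem scale_mem)
  show ?thesis
  proof (cases "B w w = 0")
    case False
    then have pos: "B w w > 0" using form_nonneg[OF w] by simp
    have "0 \<le> B w w * (B u u + 2 * (- B u w / B w w) * B u w + (- B u w / B w w)\<^sup>2 * B w w)"
      using nn[of "- B u w / B w w"] pos by (intro mult_nonneg_nonneg) (simp_all only: less_imp_le)
    also have "\<dots> = B u u * B w w - (B u w)\<^sup>2" using pos by (simp add: field_simps power2_eq_square)
    finally show ?thesis by simp
  next
    case True
    have "B u w = 0"
    proof (rule ccontr)
      assume b: "B u w \<noteq> 0"
      \<comment> \<open>When \<open>B w w = 0\<close> the quadratic is affine in \<open>t\<close>;
        this value of \<open>t\<close> brings it down to \<open>- 1\<close>.\<close>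
      have "0 \<le> B u u + 2 * (- (B u u + 1) / (2 * B u w)) * B u w" using nn[of "- (B u u + 1) / (2 * B u w)"] True by simp
      also have "\<dots> = - 1" using b by (simp add: field_simps)
      finally show False by simp
    qed
    then show ?thesis using True by simp
  qed
qed

lemma form_tendsto_zero:
  assumes g: "\<And>n. g n \<in> S" and u: "u \<in> S" and lim: "(\<lambda>n. B (g n) (g n)) \<longlonglongrightarrow> 0"
  shows "(\<lambda>n. B u (g n)) \<longlonglongrightarrow> 0"
proof -
  have "(\<lambda>n. (B u (g n))\<^sup>2) \<longlonglongrightarrow> 0"
  proof (rule tendsto_sandwich[of "\<lambda>_. 0"])
    show "(\<lambda>n. B u u * B (g n) (g n)) \<longlonglongrightarrow> 0" using tendsto_mult_left[OF lim, of "B u u"] by simp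
  qed (use cauchy_schwarz[OF u g] in auto)
  then have "(\<lambda>n. sqrt ((B u (g n))\<^sup>2)) \<longlonglongrightarrow> sqrt 0" by (rule tendsto_real_sqrt)
  then show ?thesis by (simp add: tendsto_rabs_zero_iff)
qed

lemma form_tendsto:
  assumes g: "\<And>n. w n \<in> S" and u: "u \<in> S"
    and lim: "(\<lambda>n. B (\<lambda>x. w n x - u x) (\<lambda>x. w n x - u x)) \<longlonglongrightarrow> 0"
  shows "(\<lambda>n. B (w n) (w n)) \<longlonglongrightarrow> B u u" and "v \<in> S \<Longrightarrow> (\<lambda>n. B v (w n)) \<longlonglongrightarrow> B v u"
proof -
  let ?g = "\<lambda>n x. w n x - u x"
  have gm: "?g n \<in> S" for n using g u by (rule diff_mem)
  have "B (w n) (w n) = B u u + 2 * B u (?g n) + B (?g n) (?g n)" for n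
    using form_add_scaled[OF u gm, of 1 n] by simp
  moreover have "(\<lambda>n. B u u + 2 * B u (?g n) + B (?g n) (?g n)) \<longlonglongrightarrow> B u u + 2 * 0 + 0"
    by (intro tendsto_intros form_tendsto_zero gm u lim)
  ultimately show "(\<lambda>n. B (w n) (w n)) \<longlonglongrightarrow> B u u" by simp
  show "(\<lambda>n. B v (w n)) \<longlonglongrightarrow> B v u" if v: "v \<in> S"
  proof -
    have "(\<lambda>n. B v (?g n) + B v u) \<longlonglongrightarrow> 0 + B v u"
      by (intro tendsto_intros form_tendsto_zero gm v lim)
    then show ?thesis using diff_right[OF g u v] by simp
  qed
qed

lemma parallelogram:
  assumes "u \<in> S" "w \<in> S"
  shows "B (\<lambda>x. u x - w x) (\<lambda>x. u x - w x) = 2 * B u u + 2 * B w w - B (\<lambda>x. u x + w x) (\<lambda>x. u x + w x)"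
  using form_add_scaled[OF assms, of 1] form_add_scaled[OF assms, of "- 1"] by simp

end

section \<open>Completeness of the form domain and compactness at low frequencies\<close>

context frac_domain
begin

text \<open>On \<open>\<Omega>\<close> one has \<open>|u| \<le> \<delta> + u^2 / \<delta>\<close>.
  Finite volume thus turns smallness in L2 into smallness in L1, with \<open>\<delta>\<close> free
  to balance the two terms; \<open>\<delta> = 1\<close> gives plain L1 bounds.\<close>

lemma L2_integral_abs_le:
  assumes u: "u \<in> L2" and \<delta>: "0 < \<delta>"
  shows "(LBINT x. \<bar>u x\<bar>) \<le> \<delta> * measure lborel \<Omega> + ip u u / \<delta>"
proof -
  have "(LBINT x. \<bar>u x\<bar>) \<le> (LBINT x. \<delta> * indicator \<Omega> x + (u x)\<^sup>2 / \<delta>)"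
  proof (rule integral_mono)
    show "integrable lborel (\<lambda>x. \<bar>u x\<bar>)" using L2_integrable[OF u] by simp
    show "integrable lborel (\<lambda>x. \<delta> * indicator \<Omega> x + (u x)\<^sup>2 / \<delta>)"
      using integrable_indicator_dom L2D(3)[OF u] by simp
    fix x
    have "\<delta> * \<bar>u x\<bar> \<le> \<delta>\<^sup>2 + (u x)\<^sup>2"
    proof -
      have "2 * (\<delta> * \<bar>u x\<bar>) \<le> \<delta>\<^sup>2 + (u x)\<^sup>2"
        using zero_le_power2[of "\<delta> - \<bar>u x\<bar>"] by (simp add: power2_diff)
      moreover have "0 \<le> \<delta> * \<bar>u x\<bar>" using \<delta> by simp
      ultimately show ?thesis by linarith
    qed
    then have "\<bar>u x\<bar> \<le> \<delta> + (u x)\<^sup>2 / \<delta>" using \<delta> by (simp add: field_simps power2_eq_square)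
    then show "\<bar>u x\<bar> \<le> \<delta> * indicator \<Omega> x + (u x)\<^sup>2 / \<delta>"
      using L2D(2)[OF u, of x] by (auto simp: indicator_def)
  qed
  also have "\<dots> = \<delta> * measure lborel \<Omega> + ip u u / \<delta>"
    using integrable_indicator_dom L2D(3)[OF u] by (simp add: ip_self)
  finally show ?thesis .
qed

text \<open>An L1 Cauchy sequence has a subsequence that converges almost everywhere. Fatou's lemma,
  on the space for \<open>ip\<close> and on the product space for \<open>en\<close>, then bounds the
  distance to the pointwise limit by the Cauchy estimate.\<close>

lemma H_complete:
  assumes v: "\<And>n. v n \<in> H"
    and cauchy: "\<And>e. 0 < e \<Longrightarrow> \<exists>N. \<forall>n\<ge>N. \<forall>m\<ge>N.
      ip (\<lambda>x. v n x - v m x) (\<lambda>x. v n x - v m x) < e \<and> en (\<lambda>x. v n x - v m x) (\<lambda>x. v n x - v m x) < e"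
  obtains u r where "u \<in> H" "strict_mono (r :: nat \<Rightarrow> nat)"
    "(\<lambda>n. ip (\<lambda>x. v (r n) x - u x) (\<lambda>x. v (r n) x - u x)) \<longlonglongrightarrow> 0"
    "(\<lambda>n. en (\<lambda>x. v (r n) x - u x) (\<lambda>x. v (r n) x - u x)) \<longlonglongrightarrow> 0"
proof -
  let ?d = "\<lambda>n m x. v n x - v m x"
  let ?m = "measure lborel \<Omega>"
  have vm [measurable]: "v n \<in> borel_measurable borel" for n using HD(1)[OF v] .
  have dH: "?d n m \<in> H" for n m using v v by (rule H.diff_mem)
  have L1: "\<exists>N. \<forall>i\<ge>N. \<forall>j\<ge>N. (LBINT x. norm (v i x - v j x)) < e" if e: "0 < e" for e
  proof -
    \<comment> \<open>Makes each of the two terms of \<open>L2_integral_abs_le\<close> at most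
      \<open>e / 2\<close>; the summand 1 keeps the denominator positive whatever the
      volume.\<close>
    define \<delta> where "\<delta> = e / (2 * (?m + 1))"
    have m: "?m + 1 > 0" by (simp add: add_nonneg_pos)
    have \<delta>: "0 < \<delta>" using e m by (simp add: \<delta>_def)
    obtain N where N: "\<forall>n\<ge>N. \<forall>k\<ge>N. ip (?d n k) (?d n k) < \<delta> * (e / 2)"
      using cauchy[of "\<delta> * (e / 2)"] \<delta> e by auto
    have "(LBINT x. norm (v i x - v j x)) < e" if "i \<ge> N" "j \<ge> N" for i j
    proof -
      have "(LBINT x. norm (v i x - v j x)) \<le> \<delta> * ?m + ip (?d i j) (?d i j) / \<delta>"
        using L2_integral_abs_le[OF H_L2[OF dH] \<delta>] by simp
      also have "ip (?d i j) (?d i j) / \<delta> < e / 2"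
        using N that \<delta> by (simp add: divide_less_eq mult.commute)
      also have "\<delta> * ?m \<le> e / 2"
      proof -
        have "\<delta> * ?m \<le> \<delta> * (?m + 1)" using \<delta> by simp
        also have "\<dots> = e / 2"
        proof -
          have "e / (2 * M) * M = e / 2" if "M > 0" for M using that by simp
          then show ?thesis unfolding \<delta>_def using m by blast
        qed
        finally show ?thesis .
      qed
      finally show ?thesis by simp
    qed
    then show ?thesis by blast
  qed
  obtain r where r: "strict_mono r" and AEc: "AE x in lborel. Cauchy (\<lambda>i. v (r i) x)"
    using cauchy_L1_AE_cauchy_subseq[of lborel v, OF L2_integrable[OF H_L2[OF v]] L1] .
  let ?w = "\<lambda>n. v (r n)"
  \<comment> \<open>The value 0 off the set of convergence makes the limit Borel. Outside
    \<open>\<Omega>\<close> every term is 0, so \<open>u\<close> vanishes there at every point and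
    not just almost everywhere.\<close>
  define u where "u = (\<lambda>x. if Cauchy (\<lambda>i. ?w i x) then lim (\<lambda>i. ?w i x) else 0)"
  have um [measurable]: "u \<in> borel_measurable borel"
    unfolding u_def by measurable
  have cm [measurable]: "Measurable.pred borel (\<lambda>x. Cauchy (\<lambda>i. ?w i x))" by measurable
  have conv: "(\<lambda>i. ?w i x) \<longlonglongrightarrow> u x" if "Cauchy (\<lambda>i. ?w i x)" for x
    using that by (simp add: u_def Cauchy_convergent_iff convergent_LIMSEQ_iff)
  have u0: "u x = 0" if "x \<notin> \<Omega>" for x
    using HD(2)[OF v that] by (simp add: u_def)
  have AEp: "AE z in lborel \<Otimes>\<^sub>M lborel. Cauchy (\<lambda>i. ?w i (fst z)) \<and> Cauchy (\<lambda>i. ?w i (snd z))"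
  proof (rule lborel_pair.AE_pair_measure)
    show "{z \<in> space (lborel \<Otimes>\<^sub>M lborel). Cauchy (\<lambda>i. ?w i (fst z)) \<and> Cauchy (\<lambda>i. ?w i (snd z))} \<in> sets (lborel \<Otimes>\<^sub>M lborel)"
      by measurable
    show "AE x in lborel. AE y in lborel. Cauchy (\<lambda>i. ?w i (fst (x, y))) \<and> Cauchy (\<lambda>i. ?w i (snd (x, y)))"
      using AEc by eventually_elim (use AEc in \<open>auto elim: eventually_mono\<close>)
  qed
  let ?g = "\<lambda>n x. ?w n x - u x"
  let ?c = "frac_lap_const DIM('a) s / 2"
  have cpos: "?c > 0" using const_pos by simp
  have rn: "n \<le> r n" for n using r by (rule seq_suble)
  have key: "?g n \<in> H \<and> ip (?g n) (?g n) \<le> e \<and> en (?g n) (?g n) \<le> e"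
    if e: "0 < e" and N: "\<forall>n\<ge>N. \<forall>m\<ge>N. ip (?d n m) (?d n m) < e \<and> en (?d n m) (?d n m) < e" and n: "N \<le> n" for e N n
  proof -
    have ev: "eventually (\<lambda>m. ip (?d (r n) (r m)) (?d (r n) (r m)) \<le> e \<and> en (?d (r n) (r m)) (?d (r n) (r m)) \<le> e) sequentially"
      using N n rn by (intro eventually_sequentiallyI[of N]) (meson less_imp_le order_trans)
    have "(\<integral>\<^sup>+x. ennreal ((?g n x)\<^sup>2) \<partial>lborel) \<le> (\<integral>\<^sup>+x. liminf (\<lambda>m. ennreal ((?w n x - ?w m x)\<^sup>2)) \<partial>lborel)"
    proof (rule nn_integral_mono_AE, use AEc in eventually_elim)
      fix x assume "Cauchy (\<lambda>i. ?w i x)"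
      then have "(\<lambda>m. ennreal ((?w n x - ?w m x)\<^sup>2)) \<longlonglongrightarrow> ennreal ((?w n x - u x)\<^sup>2)"
        by (intro tendsto_ennrealI tendsto_intros conv)
      from lim_imp_Liminf[OF sequentially_bot this]
      show "ennreal ((?g n x)\<^sup>2) \<le> liminf (\<lambda>m. ennreal ((?w n x - ?w m x)\<^sup>2))" by (simp only:)
    qed
    also have "\<dots> \<le> liminf (\<lambda>m. \<integral>\<^sup>+x. ennreal ((?w n x - ?w m x)\<^sup>2) \<partial>lborel)"
      by (rule nn_integral_liminf) measurable
    also have "\<dots> \<le> liminf (\<lambda>m::nat. ennreal e)"
    proof (rule Liminf_mono, use ev in eventually_elim)
      fix m assume "ip (?d (r n) (r m)) (?d (r n) (r m)) \<le> e \<and> en (?d (r n) (r m)) (?d (r n) (r m)) \<le> e"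
      then show "(\<integral>\<^sup>+x. ennreal ((?w n x - ?w m x)\<^sup>2) \<partial>lborel) \<le> ennreal e"
        using L2D(3)[OF H_L2[OF dH[of "r n" "r m"]]]
        by (subst nn_integral_eq_integral) (auto simp: ip_self[symmetric] intro: ennreal_leI)
    qed
    finally have I1: "(\<integral>\<^sup>+x. ennreal ((?g n x)\<^sup>2) \<partial>lborel) \<le> ennreal e" by (simp add: Liminf_const)
    let ?k = "\<lambda>f z. (f (fst z) - f (snd z))\<^sup>2 / kern (fst z - snd z)"
    have "(\<integral>\<^sup>+z. ennreal (?k (?g n) z) \<partial>(lborel \<Otimes>\<^sub>M lborel)) \<le>
        (\<integral>\<^sup>+z. liminf (\<lambda>m. ennreal (?k (?d (r n) (r m)) z)) \<partial>(lborel \<Otimes>\<^sub>M lborel))"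
    proof (rule nn_integral_mono_AE, use AEp in eventually_elim)
      fix z :: "'a \<times> 'a" assume z: "Cauchy (\<lambda>i. ?w i (fst z)) \<and> Cauchy (\<lambda>i. ?w i (snd z))"
      have "(\<lambda>m. ennreal (?k (?d (r n) (r m)) z)) \<longlonglongrightarrow> ennreal (?k (?g n) z)"
      proof (cases "fst z = snd z")
        case False
        then show ?thesis using z by (intro tendsto_ennrealI tendsto_intros conv) auto
      qed simp
      from lim_imp_Liminf[OF sequentially_bot this]
      show "ennreal (?k (?g n) z) \<le> liminf (\<lambda>m. ennreal (?k (?d (r n) (r m)) z))" by (simp only:)
    qed
    also have "\<dots> \<le> liminf (\<lambda>m. \<integral>\<^sup>+z. ennreal (?k (?d (r n) (r m)) z) \<partial>(lborel \<Otimes>\<^sub>M lborel))"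
      by (rule nn_integral_liminf) measurable
    also have "\<dots> \<le> liminf (\<lambda>m::nat. ennreal (e / ?c))"
    proof (rule Liminf_mono, use ev in eventually_elim)
      fix m assume "ip (?d (r n) (r m)) (?d (r n) (r m)) \<le> e \<and> en (?d (r n) (r m)) (?d (r n) (r m)) \<le> e"
      then have "(LINT z|(lborel \<Otimes>\<^sub>M lborel). ?k (?d (r n) (r m)) z) \<le> e / ?c"
        using cpos by (simp add: en_self case_prod_unfold pos_le_divide_eq mult.commute)
      then show "(\<integral>\<^sup>+z. ennreal (?k (?d (r n) (r m)) z) \<partial>(lborel \<Otimes>\<^sub>M lborel)) \<le> ennreal (e / ?c)"
        using HD(3)[OF dH[of "r n" "r m"]]
        by (subst nn_integral_eq_integral) (auto simp: case_prod_unfold intro: ennreal_leI)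
    qed
    finally have I2: "(\<integral>\<^sup>+z. ennreal (?k (?g n) z) \<partial>(lborel \<Otimes>\<^sub>M lborel)) \<le> ennreal (e / ?c)" by (simp add: Liminf_const)
    have i1: "integrable lborel (\<lambda>x. (?g n x)\<^sup>2)"
      by (rule integrableI_nonneg) (measurable, simp, rule le_less_trans[OF I1], simp)
    have i2: "integrable (lborel \<Otimes>\<^sub>M lborel) (?k (?g n))"
      by (rule integrableI_nonneg) (measurable, simp, rule le_less_trans[OF I2], simp)
    have "?g n \<in> H"
      using i2 u0 HD(2)[OF v] by (simp add: H_def case_prod_unfold)
    moreover have "ip (?g n) (?g n) \<le> e"
      using I1 e unfolding ip_self by (subst (asm) nn_integral_eq_integral[OF i1]) auto
    moreover have "(LINT z|(lborel \<Otimes>\<^sub>M lborel). ?k (?g n) z) \<le> e / ?c"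
      using I2 e cpos by (subst (asm) nn_integral_eq_integral[OF i2]) auto
    then have "en (?g n) (?g n) \<le> e"
      using cpos by (simp add: en_self case_prod_unfold pos_le_divide_eq mult.commute)
    ultimately show ?thesis by simp
  qed
  obtain N1 where N1: "\<forall>n\<ge>N1. \<forall>m\<ge>N1. ip (?d n m) (?d n m) < 1 \<and> en (?d n m) (?d n m) < 1"
    using cauchy[of 1] by auto
  have g1: "?g N1 \<in> H" using key[OF _ N1] by simp
  have "(\<lambda>x. ?w N1 x - ?g N1 x) \<in> H" by (rule H.diff_mem[OF v g1])
  then have uH: "u \<in> H" by simp
  then have gH: "?g n \<in> H" for n using v by (intro H.diff_mem)
  have lim: "(\<lambda>n. ip (?g n) (?g n)) \<longlonglongrightarrow> 0 \<and> (\<lambda>n. en (?g n) (?g n)) \<longlonglongrightarrow> 0"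
  proof (intro conjI)
    have ex: "\<exists>N. \<forall>n\<ge>N. ip (?g n) (?g n) < e \<and> en (?g n) (?g n) < e" if "0 < e" for e
    proof -
      obtain N where N: "\<forall>n\<ge>N. \<forall>m\<ge>N. ip (?d n m) (?d n m) < e / 2 \<and> en (?d n m) (?d n m) < e / 2"
        using cauchy[OF half_gt_zero[OF \<open>0 < e\<close>]] by blast
      have "ip (?g n) (?g n) < e \<and> en (?g n) (?g n) < e" if "n \<ge> N" for n
        using key[OF _ N that] \<open>0 < e\<close> by force
      then show ?thesis by blast
    qed
    show "(\<lambda>n. ip (?g n) (?g n)) \<longlonglongrightarrow> 0"
      using ex L2.form_nonneg[OF H_L2[OF gH]] by (simp add: LIMSEQ_def dist_real_def) blast
    show "(\<lambda>n. en (?g n) (?g n)) \<longlonglongrightarrow> 0"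
      using ex H.form_nonneg[OF gH] by (simp add: LIMSEQ_def dist_real_def) blast
  qed
  show thesis by (rule that[OF uH r]) (use lim in auto)
qed

lemma cos_tr_diff: "u \<in> L2 \<Longrightarrow> w \<in> L2 \<Longrightarrow> cos_tr (\<lambda>x. u x - w x) \<xi> = cos_tr u \<xi> - cos_tr w \<xi>"
  and sin_tr_diff: "u \<in> L2 \<Longrightarrow> w \<in> L2 \<Longrightarrow> sin_tr (\<lambda>x. u x - w x) \<xi> = sin_tr u \<xi> - sin_tr w \<xi>"
  using integrable_mult_cos_sin[OF L2_integrable, of u \<xi>] integrable_mult_cos_sin[OF L2_integrable, of w \<xi>]
  by (simp_all add: cos_tr_def sin_tr_def left_diff_distrib)

lemma transforms_bound:
  assumes u: "u \<in> L2"
  shows "\<bar>cos_tr u \<xi>\<bar> \<le> (LBINT x. \<bar>u x\<bar>)" "\<bar>sin_tr u \<xi>\<bar> \<le> (LBINT x. \<bar>u x\<bar>)"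
proof -
  have b: "\<bar>LBINT x. u x * g x\<bar> \<le> (LBINT x. \<bar>u x\<bar>)"
    if i: "integrable lborel (\<lambda>x. u x * g x)" and g: "\<And>x. \<bar>g x\<bar> \<le> 1" for g :: "'a \<Rightarrow> real"
  proof -
    have "\<bar>LBINT x. u x * g x\<bar> \<le> (LBINT x. \<bar>u x * g x\<bar>)" by (rule integral_abs_bound)
    also have "\<dots> \<le> (LBINT x. \<bar>u x\<bar>)"
    proof (rule integral_mono[OF integrable_abs[OF i] integrable_abs[OF L2_integrable[OF u]]])
      show "\<bar>u x * g x\<bar> \<le> \<bar>u x\<bar>" for x using g[of x] by (simp add: abs_mult mult_left_le)
    qed
    finally show ?thesis .
  qed
  show "\<bar>cos_tr u \<xi>\<bar> \<le> (LBINT x. \<bar>u x\<bar>)" "\<bar>sin_tr u \<xi>\<bar> \<le> (LBINT x. \<bar>u x\<bar>)"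
    unfolding cos_tr_def sin_tr_def using integrable_mult_cos_sin[OF L2_integrable[OF u]] by (auto intro!: b)
qed

text \<open>On the bounded set \<open>\<Omega>\<close> the phases \<open>\<xi> \<bullet> x\<close>
  and \<open>\<eta> \<bullet> x\<close> differ by at most \<open>norm (\<xi> - \<eta>) * r\<close>,
  and cosine and sine are 1-Lipschitz. This supplies the equicontinuity for Arzela--Ascoli.\<close>

lemma transforms_lipschitz:
  assumes u: "u \<in> L2" and r: "\<And>x. x \<in> \<Omega> \<Longrightarrow> norm x \<le> r"
  shows "\<bar>cos_tr u \<xi> - cos_tr u \<eta>\<bar> \<le> norm (\<xi> - \<eta>) * r * (LBINT x. \<bar>u x\<bar>)"
    and "\<bar>sin_tr u \<xi> - sin_tr u \<eta>\<bar> \<le> norm (\<xi> - \<eta>) * r * (LBINT x. \<bar>u x\<bar>)"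
proof -
  have b: "\<bar>(LBINT x. u x * g (\<xi> \<bullet> x)) - (LBINT x. u x * g (\<eta> \<bullet> x))\<bar> \<le> norm (\<xi> - \<eta>) * r * (LBINT x. \<bar>u x\<bar>)"
    if i: "\<And>\<zeta>. integrable lborel (\<lambda>x. u x * g (\<zeta> \<bullet> x))" and g: "\<And>a b. \<bar>g a - g b\<bar> \<le> \<bar>a - b\<bar>" for g :: "real \<Rightarrow> real"
  proof -
    have "\<bar>(LBINT x. u x * g (\<xi> \<bullet> x)) - (LBINT x. u x * g (\<eta> \<bullet> x))\<bar> =
        \<bar>LBINT x. u x * g (\<xi> \<bullet> x) - u x * g (\<eta> \<bullet> x)\<bar>"
      using i by simp
    also have "\<dots> \<le> (LBINT x. \<bar>u x * g (\<xi> \<bullet> x) - u x * g (\<eta> \<bullet> x)\<bar>)" by (rule integral_abs_bound)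
    also have "\<dots> \<le> (LBINT x. norm (\<xi> - \<eta>) * r * \<bar>u x\<bar>)"
    proof (rule integral_mono)
      fix x
      show "\<bar>u x * g (\<xi> \<bullet> x) - u x * g (\<eta> \<bullet> x)\<bar> \<le> norm (\<xi> - \<eta>) * r * \<bar>u x\<bar>"
      proof (cases "x \<in> \<Omega>")
        case True
        have "\<bar>g (\<xi> \<bullet> x) - g (\<eta> \<bullet> x)\<bar> \<le> \<bar>(\<xi> - \<eta>) \<bullet> x\<bar>" using g by (simp add: inner_diff_left)
        also have "\<dots> \<le> norm (\<xi> - \<eta>) * norm x" by (rule Cauchy_Schwarz_ineq2)
        also have "\<dots> \<le> norm (\<xi> - \<eta>) * r" using r[OF True] by (intro mult_left_mono) auto
        finally have "\<bar>u x\<bar> * \<bar>g (\<xi> \<bullet> x) - g (\<eta> \<bullet> x)\<bar> \<le> \<bar>u x\<bar> * (norm (\<xi> - \<eta>) * r)" by (intro mult_left_mono) auto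
        then show ?thesis by (simp add: right_diff_distrib[symmetric] abs_mult mult_ac)
      qed (use L2D(2)[OF u] in simp)
    qed (use i L2_integrable[OF u] in auto)
    finally show ?thesis by simp
  qed
  have c: "\<bar>cos a - cos b\<bar> \<le> \<bar>a - b\<bar>" "\<bar>sin a - sin b\<bar> \<le> \<bar>a - b\<bar>" for a b :: real
  proof -
    have sn: "\<bar>sin ((a - b) / 2)\<bar> \<le> \<bar>a - b\<bar> / 2" "\<bar>sin ((b - a) / 2)\<bar> \<le> \<bar>a - b\<bar> / 2"
      using abs_sin_x_le_abs_x[of "(a - b) / 2"] abs_sin_x_le_abs_x[of "(b - a) / 2"] by (auto simp: abs_minus_commute)
    have "\<bar>cos a - cos b\<bar> = 2 * (\<bar>sin ((a + b) / 2)\<bar> * \<bar>sin ((b - a) / 2)\<bar>)"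
      by (simp add: cos_diff_cos abs_mult)
    also have "\<dots> \<le> 2 * (1 * (\<bar>a - b\<bar> / 2))"
      using sn by (intro mult_left_mono mult_mono) auto
    finally show "\<bar>cos a - cos b\<bar> \<le> \<bar>a - b\<bar>" by simp
    have "\<bar>sin a - sin b\<bar> = 2 * (\<bar>sin ((a - b) / 2)\<bar> * \<bar>cos ((a + b) / 2)\<bar>)"
      by (simp add: sin_diff_sin abs_mult)
    also have "\<dots> \<le> 2 * ((\<bar>a - b\<bar> / 2) * 1)"
      using sn by (intro mult_left_mono mult_mono) auto
    finally show "\<bar>sin a - sin b\<bar> \<le> \<bar>a - b\<bar>" by simp
  qed
  show "\<bar>cos_tr u \<xi> - cos_tr u \<eta>\<bar> \<le> norm (\<xi> - \<eta>) * r * (LBINT x. \<bar>u x\<bar>)"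
    and "\<bar>sin_tr u \<xi> - sin_tr u \<eta>\<bar> \<le> norm (\<xi> - \<eta>) * r * (LBINT x. \<bar>u x\<bar>)"
    unfolding cos_tr_def sin_tr_def using integrable_mult_cos_sin[OF L2_integrable[OF u]] c by (auto intro!: b)
qed

text \<open>The transforms are uniformly bounded and equi-Lipschitz, so Arzela--Ascoli yields
  uniform convergence on the ball. The conclusion speaks of differences because the limit
  \<open>g\<close> is not known to be the transform of an element of \<open>L2\<close>.\<close>

lemma low_frequency_compact:
  assumes u: "\<And>n. u n \<in> L2" and u1: "\<And>n. ip (u n) (u n) \<le> 1"
  shows "\<exists>k :: nat \<Rightarrow> nat. strict_mono k \<and> (\<forall>e>0. \<exists>N. \<forall>n\<ge>N. \<forall>m\<ge>N. \<forall>\<xi>\<in>cball 0 \<rho>.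
        power_spectrum (\<lambda>x. u (k n) x - u (k m) x) \<xi> < e)"
proof -
  define M where "M = measure lborel \<Omega> + 1"
  have M0: "M > 0" by (simp add: M_def add_nonneg_pos)
  have M: "(LBINT x. \<bar>u n x\<bar>) \<le> M" for n
    using L2_integral_abs_le[OF u, of 1 n] u1[of n] by (simp add: M_def)
  obtain r where r: "0 < r" "\<And>x. x \<in> \<Omega> \<Longrightarrow> norm x \<le> r"
    using bounded_dom by (auto simp: bounded_pos)
  let ?F = "\<lambda>n \<xi>. (cos_tr (u n) \<xi>, sin_tr (u n) \<xi>)"
  have lip: "norm (?F n \<xi> - ?F n \<eta>) \<le> norm (\<xi> - \<eta>) * (2 * r * M)" for n \<xi> \<eta>
  proof -
    have "norm (?F n \<xi> - ?F n \<eta>) \<le> \<bar>cos_tr (u n) \<xi> - cos_tr (u n) \<eta>\<bar> + \<bar>sin_tr (u n) \<xi> - sin_tr (u n) \<eta>\<bar>"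
      using norm_Pair_le[of "cos_tr (u n) \<xi> - cos_tr (u n) \<eta>" "sin_tr (u n) \<xi> - sin_tr (u n) \<eta>"] by simp
    also have "\<dots> \<le> norm (\<xi> - \<eta>) * r * (LBINT x. \<bar>u n x\<bar>) + norm (\<xi> - \<eta>) * r * (LBINT x. \<bar>u n x\<bar>)"
      by (intro add_mono transforms_lipschitz[OF u] r(2))
    also have "\<dots> \<le> norm (\<xi> - \<eta>) * r * M + norm (\<xi> - \<eta>) * r * M"
      using r(1) by (intro add_mono mult_left_mono M) auto
    finally show ?thesis by (simp add: algebra_simps)
  qed
  obtain g k where k: "strict_mono (k :: nat \<Rightarrow> nat)"
    and conv: "\<And>e. 0 < e \<Longrightarrow> \<exists>N. \<forall>n \<xi>. n \<ge> N \<and> \<xi> \<in> cball 0 \<rho> \<longrightarrow> norm (?F (k n) \<xi> - g \<xi>) < e"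
  proof (rule Arzela_Ascoli[of "cball (0::'a) \<rho>" ?F "M + M"])
    show "norm (?F n \<xi>) \<le> M + M" for n \<xi>
    proof -
      have "norm (?F n \<xi>) \<le> \<bar>cos_tr (u n) \<xi>\<bar> + \<bar>sin_tr (u n) \<xi>\<bar>"
        using norm_Pair_le[of "cos_tr (u n) \<xi>" "sin_tr (u n) \<xi>"] by simp
      also have "\<dots> \<le> M + M"
        by (intro add_mono transforms_bound[OF u, THEN order_trans] M)
      finally show ?thesis .
    qed
    show "\<exists>d. 0 < d \<and> (\<forall>n \<eta>. \<eta> \<in> cball 0 \<rho> \<and> norm (\<xi> - \<eta>) < d \<longrightarrow> norm (?F n \<xi> - ?F n \<eta>) < e)"
      if "0 < e" for \<xi> e
    proof (intro exI conjI allI impI)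
      let ?d = "e / (2 * r * M)"
      have p: "2 * r * M > 0" using r M0 by simp
      show "0 < ?d" using that p by simp
      fix n \<eta> assume "\<eta> \<in> cball 0 \<rho> \<and> norm (\<xi> - \<eta>) < ?d"
      then have "norm (\<xi> - \<eta>) * (2 * r * M) < e" using p by (simp add: pos_less_divide_eq)
      then show "norm (?F n \<xi> - ?F n \<eta>) < e" using lip[of n \<xi> \<eta>] by simp
    qed
  qed auto
  show ?thesis
  proof (rule exI[of _ k], intro conjI k allI impI)
    fix e :: real assume e: "0 < e"
    obtain N where N: "\<forall>n \<xi>. n \<ge> N \<and> \<xi> \<in> cball 0 \<rho> \<longrightarrow> norm (?F (k n) \<xi> - g \<xi>) < sqrt e / 2"
      using conv[of "sqrt e / 2"] e by auto
    have "power_spectrum (\<lambda>x. u (k n) x - u (k m) x) \<xi> < e" if "n \<ge> N" "m \<ge> N" "\<xi> \<in> cball 0 \<rho>" for n m \<xi>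
    proof -
      have tri: "norm (a - b) \<le> norm (a - c) + norm (b - c)" for a b c :: "real \<times> real"
        using norm_triangle_ineq4[of "a - c" "b - c"] by simp
      have close: "norm (?F (k j) \<xi> - g \<xi>) < sqrt e / 2" if "j \<ge> N" for j
        using N that \<open>\<xi> \<in> cball 0 \<rho>\<close> by blast
      have "norm (?F (k n) \<xi> - ?F (k m) \<xi>) \<le> norm (?F (k n) \<xi> - g \<xi>) + norm (?F (k m) \<xi> - g \<xi>)"
        by (rule tri)
      also have "\<dots> < sqrt e / 2 + sqrt e / 2"
        by (rule add_strict_mono[OF close[OF that(1)] close[OF that(2)]])
      also have "\<dots> = sqrt e" by simp
      finally have "(norm (?F (k n) \<xi> - ?F (k m) \<xi>))\<^sup>2 < (sqrt e)\<^sup>2"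
        by (rule power_strict_mono) simp_all
      moreover have "(norm (?F (k n) \<xi> - ?F (k m) \<xi>))\<^sup>2 = power_spectrum (\<lambda>x. u (k n) x - u (k m) x) \<xi>"
        by (simp add: power_spectrum_def cos_tr_diff[OF u u] sin_tr_diff[OF u u] norm_Pair)
      ultimately show ?thesis using e by simp
    qed
    then show "\<exists>N. \<forall>n\<ge>N. \<forall>m\<ge>N. \<forall>\<xi>\<in>cball 0 \<rho>. power_spectrum (\<lambda>x. u (k n) x - u (k m) x) \<xi> < e" by blast
  qed
qed

text \<open>
  For a minimizing sequence and \<open>l\<close> the infimum, the parallelogram law gives
  \<open>en d d \<le> l * ip d d + o(1)\<close> for the differences \<open>d\<close>. Applied with \<open>\<mu> = l + 1\<close>,
  \<open>form_le_weight_spectrum\<close> then bounds \<open>ip d d\<close> by frequencies in a fixed ball, where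
  \<open>low_frequency_compact\<close> applies: no compact embedding is needed.
\<close>

lemma rayleigh_minimizer:
  assumes \<phi>: "\<And>i. i \<in> I \<Longrightarrow> \<phi> i \<in> L2"
  defines "V \<equiv> {w \<in> H. \<forall>i\<in>I. ip w (\<phi> i) = 0}"
  assumes w0: "w0 \<in> V" "ip w0 w0 \<noteq> 0"
  shows "\<exists>u\<in>V. ip u u = 1 \<and> (\<forall>w\<in>V. en u u * ip w w \<le> en w w)"
proof -
  have VH: "w \<in> H" if "w \<in> V" for w using that by (simp add: V_def)
  have VL: "w \<in> L2" if "w \<in> V" for w using VH[OF that] by (rule H_L2)
  have Vadd: "(\<lambda>x. u x + w x) \<in> V" if "u \<in> V" "w \<in> V" for u w
    using that VL[OF that(1)] VL[OF that(2)] \<phi> by (auto simp: V_def H.add_mem L2.add_left)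
  have Vscale: "(\<lambda>x. a * u x) \<in> V" if "u \<in> V" for a u
    using that VL[OF that] \<phi> by (auto simp: V_def H.scale_mem L2.scale_left)
  define R where "R = {en w w | w. w \<in> V \<and> ip w w = 1}"
  have normalize: "\<exists>v\<in>V. ip v v = 1 \<and> en v v = en w w / ip w w" if w: "w \<in> V" "ip w w \<noteq> 0" for w
  proof (intro bexI conjI)
    have pos: "ip w w > 0" using L2.form_nonneg[OF VL[OF w(1)]] w by simp
    let ?a = "1 / sqrt (ip w w)"
    show v: "(\<lambda>x. ?a * w x) \<in> V" using w by (intro Vscale)
    show "ip (\<lambda>x. ?a * w x) (\<lambda>x. ?a * w x) = 1"
      using pos VL[OF w(1)] VL[OF v] by (subst L2.scale_left, simp, simp, subst L2.scale_right) auto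
    show "en (\<lambda>x. ?a * w x) (\<lambda>x. ?a * w x) = en w w / ip w w"
      using pos VH[OF w(1)] VH[OF v] by (subst H.scale_left, simp, simp, subst H.scale_right) auto
  qed
  have Rne: "R \<noteq> {}" using normalize[OF w0] by (auto simp: R_def)
  have Rbd: "bdd_below R" by (rule bdd_belowI[of _ 0]) (auto simp: R_def intro: H.form_nonneg VH)
  define l where "l = Inf R"
  have l0: "0 \<le> l" unfolding l_def by (rule cInf_greatest[OF Rne]) (auto simp: R_def intro: H.form_nonneg VH)
  have low: "l * ip w w \<le> en w w" if w: "w \<in> V" for w
  proof (cases "ip w w = 0")
    case True
    then show ?thesis using H.form_nonneg[OF VH[OF w]] by simp
  next
    case False
    then have pos: "ip w w > 0" using L2.form_nonneg[OF VL[OF w]] by simp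
    have "en w w / ip w w \<in> R" using normalize[OF w False] by (force simp: R_def)
    then have "l \<le> en w w / ip w w" unfolding l_def using Rbd by (rule cInf_lower)
    then show ?thesis using pos by (simp add: pos_le_divide_eq)
  qed
  have "\<exists>w. w \<in> V \<and> ip w w = 1 \<and> en w w < l + 1 / real (Suc n)" for n
  proof -
    have "Inf R < l + 1 / real (Suc n)" by (simp add: l_def)
    then obtain x where "x \<in> R" "x < l + 1 / real (Suc n)" using cInf_lessD[OF Rne] by blast
    then show ?thesis unfolding R_def by blast
  qed
  then obtain u where uV: "\<And>n. u n \<in> V" and u1: "\<And>n. ip (u n) (u n) = 1"
    and ulam: "\<And>n. en (u n) (u n) < l + 1 / real (Suc n)" by metis
  note uH = VH[OF uV] and uL = VL[OF uV]
  \<comment> \<open>Outside the ball of this radius the weight at level \<open>l + 1\<close>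
    vanishes.\<close>
  define \<rho> where "\<rho> = (l + 1) powr (1 / (2 * s))"
  obtain k :: "nat \<Rightarrow> nat" where k: "strict_mono k" and ps: "\<forall>e>0. \<exists>N. \<forall>n\<ge>N. \<forall>m\<ge>N. \<forall>\<xi>\<in>cball 0 \<rho>.
        power_spectrum (\<lambda>x. u (k n) x - u (k m) x) \<xi> < e"
    using low_frequency_compact[of u \<rho>, OF uL eq_refl[OF u1]] by blast
  let ?v = "\<lambda>n. u (k n)"
  let ?d = "\<lambda>n m x. ?v n x - ?v m x"
  let ?p = "(2 * pi) ^ DIM('a) :: real"
  have p0: "?p > 0" by simp
  have dH: "?d n m \<in> H" for n m using uH by (intro H.diff_mem)
  have sup: "weight (l + 1) \<xi> = 0" if "\<xi> \<notin> cball 0 \<rho>" for \<xi>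
  proof -
    have "\<rho> \<le> norm \<xi>" using that by simp
    then have "\<rho> powr (2 * s) \<le> norm \<xi> powr (2 * s)" using s by (intro powr_mono2) (auto simp: \<rho>_def)
    moreover have "\<rho> powr (2 * s) = l + 1" unfolding \<rho>_def powr_powr using s l0 by simp
    ultimately show ?thesis by simp
  qed
  define J where "J = (LINT \<xi>|(lborel :: 'a measure). weight (l + 1) \<xi>)"
  have J0: "0 \<le> J" unfolding J_def by (intro Bochner_Integration.integral_nonneg) simp
  have qd: "en (?d n m) (?d n m) \<le> l * ip (?d n m) (?d n m) + 4 * (1 / real (Suc N))"
    if "n \<ge> N" "m \<ge> N" for n m N
  proof -
    have "en (?v n) (?v n) \<le> l + 1 / real (Suc N)" if "n \<ge> N" for n
    proof -
      have "real (Suc N) \<le> real (Suc (k n))" using seq_suble[OF k, of n] that by simp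
      then have "1 / real (Suc (k n)) \<le> 1 / real (Suc N)" by (intro divide_left_mono) auto
      then show ?thesis using ulam[of "k n"] by linarith
    qed
    moreover have "l * ip (?d n m) (?d n m) = 4 * l - l * ip (\<lambda>x. ?v n x + ?v m x) (\<lambda>x. ?v n x + ?v m x)"
      using L2.parallelogram[OF uL uL, of "k n" "k m"] u1 by (simp add: right_diff_distrib)
    ultimately show ?thesis
      using low[OF Vadd[OF uV[of "k n"] uV[of "k m"]]] H.parallelogram[OF uH uH, of "k n" "k m"] that
      by (smt (verit))
  qed
  have cauchy: "\<exists>N. \<forall>n\<ge>N. \<forall>m\<ge>N. ip (?d n m) (?d n m) < e \<and> en (?d n m) (?d n m) < e"
    if e: "0 < e" for e
  proof -
    \<comment> \<open>\<open>main\<close> below yields the bounds \<open>2 * a\<close> for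
      \<open>ip\<close> and hence \<open>l * (2 * a) + a\<close> for \<open>en\<close>; both are
      smaller than \<open>e = 4 * (l + 1) * a\<close>.\<close>
    define a where "a = e / (4 * (l + 1))"
    have a: "a > 0" using e l0 by (simp add: a_def)
    have ae: "2 * a < e" "l * (2 * a) + a < e"
    proof -
      have "4 * (l + 1) * a = e" using l0 by (simp add: a_def)
      moreover have "0 \<le> l * a" using l0 a by simp
      ultimately show "2 * a < e" "l * (2 * a) + a < e" using a by (auto simp: algebra_simps)
    qed
    \<comment> \<open>The threshold makes the integral against the weight, whose mass is
      \<open>J\<close>, at most \<open>a * ?p\<close>; \<open>J + 1\<close> in place of
      \<open>J\<close> keeps the denominator positive.\<close>
    obtain N1 where N1: "\<forall>n\<ge>N1. \<forall>m\<ge>N1. \<forall>\<xi>\<in>cball 0 \<rho>. power_spectrum (?d n m) \<xi> < a * ?p / (J + 1)"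
      using ps[rule_format, of "a * ?p / (J + 1)"] a p0 J0 by auto
    obtain N2 where N2: "1 / real (Suc N2) < a / 4"
      using reals_Archimedean[of "a / 4"] a by (auto simp: inverse_eq_divide)
    have main: "ip (?d n m) (?d n m) \<le> 2 * a \<and> en (?d n m) (?d n m) \<le> l * ip (?d n m) (?d n m) + a"
      if n: "n \<ge> max N1 N2" and m: "m \<ge> max N1 N2" for n m
    proof -
      have q: "en (?d n m) (?d n m) \<le> l * ip (?d n m) (?d n m) + a"
        using qd[of N2 n m] n m N2 by simp
      have "?p * ((l + 1) * ip (?d n m) (?d n m) - en (?d n m) (?d n m)) \<le>
          (LBINT \<xi>. weight (l + 1) \<xi> * power_spectrum (?d n m) \<xi>)"
        using l0 by (intro form_le_weight_spectrum dH) simp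
      also have "\<dots> \<le> (LINT \<xi>|(lborel :: 'a measure). weight (l + 1) \<xi> * (a * ?p / (J + 1)))"
      proof (rule integral_mono)
        show "integrable lborel (\<lambda>\<xi>. weight (l + 1) \<xi> * power_spectrum (?d n m) \<xi>)"
          using l0 by (intro integrable_weight_spectrum H_L2 dH) simp
        show "integrable lborel (\<lambda>\<xi>::'a. weight (l + 1) \<xi> * (a * ?p / (J + 1)))"
          using l0 weyl_weight(1)[OF s(1), of "l + 1", where 'a='a] by simp
        show "weight (l + 1) \<xi> * power_spectrum (?d n m) \<xi> \<le> weight (l + 1) \<xi> * (a * ?p / (J + 1))" for \<xi>
        proof (cases "\<xi> \<in> cball 0 \<rho>")
          case True
          then have "power_spectrum (?d n m) \<xi> < a * ?p / (J + 1)" using N1 n m by (meson max.boundedE)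
          then show ?thesis by (intro mult_left_mono) auto
        next
          case False
          show ?thesis unfolding sup[OF False] by simp
        qed
      qed
      also have "\<dots> = J * (a * ?p / (J + 1))"
        unfolding J_def by simp
      also have "\<dots> \<le> a * ?p"
      proof -
        have "J * X / (J + 1) \<le> X" if "0 \<le> X" for X using J0 that by (simp add: pos_divide_le_eq algebra_simps)
        from this[of "a * ?p"] show ?thesis using a by simp
      qed
      finally have "(l + 1) * ip (?d n m) (?d n m) - en (?d n m) (?d n m) \<le> a"
        using p0 by (simp add: mult.commute[of a])
      \<comment> \<open>Adding the two estimates cancels the energy and leaves
        \<open>ip \<le> 2 * a\<close>, because the level \<open>l + 1\<close> exceeds
        \<open>l\<close> by exactly 1.\<close>
      then show ?thesis using q by (simp add: algebra_simps)
    qed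
    have "ip (?d n m) (?d n m) < e \<and> en (?d n m) (?d n m) < e"
      if "n \<ge> max N1 N2" and "m \<ge> max N1 N2" for n m
    proof -
      have "l * ip (?d n m) (?d n m) \<le> l * (2 * a)" using main[OF that] l0 by (intro mult_left_mono) auto
      then show ?thesis using main[OF that] ae by linarith
    qed
    then show ?thesis by blast
  qed
  obtain w r where wH: "w \<in> H" and r: "strict_mono (r :: nat \<Rightarrow> nat)"
    and lim: "(\<lambda>n. ip (\<lambda>x. ?v (r n) x - w x) (\<lambda>x. ?v (r n) x - w x)) \<longlonglongrightarrow> 0"
      "(\<lambda>n. en (\<lambda>x. ?v (r n) x - w x) (\<lambda>x. ?v (r n) x - w x)) \<longlonglongrightarrow> 0"
    by (rule H_complete[of ?v, OF uH cauchy]) (assumption, rule that)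
  note wL = H_L2[OF wH]
  have "(\<lambda>n. ip (?v (r n)) (?v (r n))) \<longlonglongrightarrow> ip w w"
    by (rule L2.form_tendsto(1)[OF uL wL lim(1)])
  then have w1: "ip w w = 1" using u1 by (simp add: LIMSEQ_const_iff)
  have "ip w (\<phi> i) = 0" if i: "i \<in> I" for i
  proof -
    have "(\<lambda>n. ip (\<phi> i) (?v (r n))) \<longlonglongrightarrow> ip (\<phi> i) w"
      by (rule L2.form_tendsto(2)[OF uL wL lim(1) \<phi>[OF i]])
    moreover have "ip (\<phi> i) (?v (r n)) = 0" for n
      using uV[of "k (r n)"] i by (simp add: V_def L2.form_sym[of "\<phi> i"])
    ultimately show ?thesis by (simp add: LIMSEQ_const_iff L2.form_sym[of w])
  qed
  then have wV: "w \<in> V" using wH by (simp add: V_def)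
  have "(\<lambda>n. en (?v (r n)) (?v (r n))) \<longlonglongrightarrow> en w w"
    by (rule H.form_tendsto(1)[OF uH wH lim(2)])
  moreover have "(\<lambda>n. l + 1 / real (Suc n)) \<longlonglongrightarrow> l + 0"
    by (intro tendsto_intros LIMSEQ_Suc[OF lim_1_over_n])
  moreover have "en (?v (r n)) (?v (r n)) \<le> l + 1 / real (Suc n)" for n
  proof -
    have "n \<le> k (r n)" using seq_suble[OF k, of "r n"] seq_suble[OF r, of n] by simp
    then have "1 / real (Suc (k (r n))) \<le> 1 / real (Suc n)" by (intro divide_left_mono) auto
    then show ?thesis using ulam[of "k (r n)"] by linarith
  qed
  ultimately have "en w w \<le> l" using LIMSEQ_le by (metis (no_types, lifting) add_0_right)
  then have "en w w = l" using low[OF wV] w1 by simp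
  then show ?thesis using wV w1 low by (intro bexI[of _ w]) simp_all
qed

end

section \<open>Cut-off functions\<close>

lemma integrable_nonneg_bound:
  fixes f g :: "'b \<Rightarrow> real"
  assumes "integrable M g" "f \<in> borel_measurable M" "\<And>x. 0 \<le> f x" "\<And>x. f x \<le> g x"
  shows "integrable M f"
  by (rule Bochner_Integration.integrable_bound[OF assms(1,2)])
     (use assms(3,4) in \<open>auto intro!: AE_I2 intro: order_trans[OF _ abs_ge_self]\<close>)

text \<open>Read off the symbol identity: averaging \<open>1 - cos (\<xi> \<bullet> z)\<close> over
  a Gaussian in \<open>\<xi>\<close> gives a multiple of \<open>1 - exp (- |z|^2 / 4)\<close>, which
  dominates a multiple of \<open>min 1 (|z|^2)\<close>. Tonelli turns the double integral into a
  Gaussian moment of \<open>norm \<xi> powr (2 * s)\<close>.\<close>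

lemma nn_integral_min_kernel_finite:
  fixes s :: real
  assumes s: "0 < s" "s < 1"
  shows "(\<integral>\<^sup>+z. ennreal (min 1 ((norm z)\<^sup>2) / norm z powr (real DIM('a) + 2 * s)) \<partial>(lborel :: 'a::euclidean_space measure)) < \<infinity>"
proof -
  let ?kern = "\<lambda>z::'a. norm z powr (real DIM('a) + 2 * s)"
  let ?c = "frac_lap_const DIM('a) s"
  let ?A = "pi powr (real DIM('a) / 2)"
  have c: "?c > 0" by (rule frac_lap_const_pos[OF s])
  let ?G = "\<lambda>\<xi>::'a. exp (- 1 * (norm \<xi>)\<^sup>2)"
  have avg: "(\<integral>\<^sup>+\<xi>. ennreal (?G \<xi> * (1 - cos (\<xi> \<bullet> z))) \<partial>lborel) = ennreal (?A * (1 - exp (- (norm z)\<^sup>2 / 4)))" for z :: 'a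
    using nn_integral_gaussian_one_minus_cos[of 1 z] by (simp add: inner_commute[of z])
  \<comment> \<open>The inequality \<open>1 + r / 4 \<le> exp (r / 4)\<close> gives
    \<open>1 - exp (- r / 4) \<ge> r / (4 + r)\<close>, which is at least \<open>r / 5\<close> for
    \<open>r \<le> 1\<close> and at least \<open>1 / 5\<close> beyond; hence the factor 5.\<close>
  have min_le: "min 1 r \<le> 5 * (1 - exp (- r / 4))" if "0 \<le> r" for r :: real
  proof -
    have "1 + r / 4 \<le> exp (r / 4)" by (rule exp_ge_add_one_self)
    then have "exp (- r / 4) \<le> 1 / (1 + r / 4)"
      using that by (simp add: exp_minus field_simps)
    moreover have "min 1 r \<le> 5 * (1 - 1 / (1 + r / 4))"
    proof -
      have "1 - 1 / (1 + r / 4) = r / (4 + r)" using that by (simp add: field_simps)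
      moreover have "min 1 r \<le> 5 * (r / (4 + r))"
      proof (cases "r \<le> 1")
        case True
        have "r * (4 + r) \<le> r * 5" using True that by (intro mult_left_mono) auto
        then show ?thesis using True that by (simp add: pos_le_divide_eq min_def mult.commute)
      next
        case False
        then show ?thesis by (simp add: pos_le_divide_eq min_def)
      qed
      ultimately show ?thesis by simp
    qed
    moreover have "5 * (1 - a) \<le> 5 * (1 - b)" if "b \<le> a" for a b :: real using that by simp
    ultimately show ?thesis by (meson order_trans)
  qed
  have "ennreal (?A / 5) * (\<integral>\<^sup>+z. ennreal (min 1 ((norm z)\<^sup>2) / ?kern z) \<partial>lborel) =
      (\<integral>\<^sup>+z. ennreal (?A / 5 * (min 1 ((norm z)\<^sup>2) / ?kern z)) \<partial>lborel)"
    by (subst nn_integral_cmult[symmetric], measurable) (intro nn_integral_cong, simp add: ennreal_mult'[symmetric])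
  also have "\<dots> \<le> (\<integral>\<^sup>+z. ennreal (1 / ?kern z) * ennreal (?A * (1 - exp (- (norm z)\<^sup>2 / 4))) \<partial>lborel)"
  proof (rule nn_integral_mono)
    fix z :: 'a
    have "?A / 5 * min 1 ((norm z)\<^sup>2) \<le> ?A / 5 * (5 * (1 - exp (- (norm z)\<^sup>2 / 4)))"
      by (intro mult_left_mono min_le) auto
    then have "1 / ?kern z * (?A / 5 * min 1 ((norm z)\<^sup>2)) \<le> 1 / ?kern z * (?A * (1 - exp (- (norm z)\<^sup>2 / 4)))"
      by (intro mult_left_mono) auto
    then show "ennreal (?A / 5 * (min 1 ((norm z)\<^sup>2) / ?kern z)) \<le> ennreal (1 / ?kern z) * ennreal (?A * (1 - exp (- (norm z)\<^sup>2 / 4)))"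
      by (subst ennreal_mult'[symmetric]) (auto intro!: ennreal_leI simp: mult_ac)
  qed
  also have "\<dots> = (\<integral>\<^sup>+z. (\<integral>\<^sup>+\<xi>. ennreal (1 / ?kern z) * ennreal (?G \<xi> * (1 - cos (\<xi> \<bullet> z))) \<partial>lborel) \<partial>lborel)"
    unfolding avg[symmetric] by (intro nn_integral_cong nn_integral_cmult[symmetric]) measurable
  also have "\<dots> = (\<integral>\<^sup>+\<xi>. (\<integral>\<^sup>+z. ennreal (1 / ?kern z) * ennreal (?G \<xi> * (1 - cos (\<xi> \<bullet> z))) \<partial>lborel) \<partial>lborel)"
    by (rule lborel_pair.Fubini') (simp add: case_prod_beta', measurable)
  also have "\<dots> = (\<integral>\<^sup>+\<xi>. (\<integral>\<^sup>+z. ennreal (?G \<xi>) * ennreal ((1 - cos (\<xi> \<bullet> z)) / ?kern z) \<partial>lborel) \<partial>lborel)"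
    by (intro nn_integral_cong) (simp add: ennreal_mult'[symmetric])
  also have "\<dots> = (\<integral>\<^sup>+\<xi>. ennreal (?G \<xi>) * ennreal (norm \<xi> powr (2 * s) / ?c) \<partial>lborel)"
    unfolding nn_integral_one_minus_cos[OF s, symmetric] by (intro nn_integral_cong nn_integral_cmult) measurable
  \<comment> \<open>By \<open>norm \<xi> powr (2 * s) \<le> 1 + |\<xi>|^2 \<le> 2 * exp (|\<xi>|^2 /
    2)\<close>, one half of the Gaussian exponent absorbs the growth and the other half stays
    integrable.\<close>
  also have "\<dots> \<le> (\<integral>\<^sup>+\<xi>. ennreal (2 / ?c * exp (- (1 / 2) * (norm \<xi>)\<^sup>2)) \<partial>(lborel :: 'a measure))"
  proof (rule nn_integral_mono)
    fix \<xi> :: 'a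
    let ?r = "(norm \<xi>)\<^sup>2"
    have "norm \<xi> powr (2 * s) \<le> 1 + ?r"
    proof (cases "norm \<xi> \<le> 1")
      case True
      have "norm \<xi> powr (2 * s) \<le> 1" using True s powr_mono2[of "2 * s" "norm \<xi>" 1] by simp
      then show ?thesis by (simp add: add_increasing2)
    next
      case False
      then have "norm \<xi> powr (2 * s) \<le> norm \<xi> powr 2" using s by (intro powr_mono) auto
      also have "\<dots> = ?r" using False by simp
      finally show ?thesis by simp
    qed
    also have "\<dots> \<le> 2 * exp (?r / 2)" using exp_ge_add_one_self[of "?r / 2"] zero_le_power2[of "norm \<xi>"] by linarith
    finally have "?G \<xi> * (norm \<xi> powr (2 * s) / ?c) \<le> ?G \<xi> * (2 * exp (?r / 2) / ?c)"
      using c by (intro mult_left_mono divide_right_mono) auto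
    also have "\<dots> = 2 / ?c * (exp (- 1 * ?r) * exp (?r / 2))" by simp
    also have "exp (- 1 * ?r) * exp (?r / 2) = exp (- (1 / 2) * ?r)" unfolding exp_add[symmetric] by simp
    finally show "ennreal (?G \<xi>) * ennreal (norm \<xi> powr (2 * s) / ?c) \<le> ennreal (2 / ?c * exp (- (1 / 2) * ?r))"
      by (subst ennreal_mult'[symmetric]) (auto intro: ennreal_leI)
  qed
  also have "\<dots> < \<infinity>"
  proof -
    have "integrable lborel (\<lambda>\<xi>::'a. 2 / ?c * exp (- (1 / 2) * (norm \<xi>)\<^sup>2))"
      using gaussian_cos_integral(1)[of "1 / 2" "0::'a"] by (intro integrable_mult_right) simp
    then show ?thesis using c by (subst nn_integral_eq_integral) auto
  qed
  finally show ?thesis by (auto simp: ennreal_mult_less_top)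
qed

context frac_domain
begin

text \<open>If \<open>x\<close> or \<open>y\<close> lies in \<open>\<Omega>\<close>, the squared
  difference is at most \<open>L^2 * min 1 (|x - y|^2)\<close>; otherwise it vanishes. So the
  truncated kernel, paired with the indicator function of \<open>\<Omega>\<close> in each variable,
  is an integrable majorant. \<open>1 \<le> L\<close> lets one constant serve both branches of the
  minimum.\<close>

lemma lipschitz_in_H:
  assumes v [measurable]: "v \<in> borel_measurable borel" and v0: "\<And>x. x \<notin> \<Omega> \<Longrightarrow> v x = 0"
    and v1: "\<And>x. 0 \<le> v x" "\<And>x. v x \<le> 1" and L: "1 \<le> L" and lip: "\<And>x y. \<bar>v x - v y\<bar> \<le> L * norm (x - y)"
  shows "v \<in> H"
proof -
  let ?k = "\<lambda>z::'a. min 1 ((norm z)\<^sup>2) / kern z"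
  have "(\<integral>\<^sup>+z. ennreal (?k z) \<partial>lborel) \<noteq> \<infinity>"
    using nn_integral_min_kernel_finite[OF s, where 'a='a] by simp
  then obtain c where c: "0 \<le> c" "(\<integral>\<^sup>+z. ennreal (?k z) \<partial>lborel) = ennreal c"
    by (cases "\<integral>\<^sup>+z. ennreal (?k z) \<partial>lborel") auto
  have km: "?k \<in> borel_measurable borel" by measurable
  note conv = integrable_pair_convolve[OF integrable_indicator_dom km _ c(2) _ c(1), simplified]
  let ?G = "\<lambda>z. L\<^sup>2 * ((case z of (x, y) \<Rightarrow> indicator \<Omega> x * ?k (x - y)) + (case z of (x, y) \<Rightarrow> indicator \<Omega> y * ?k (x - y)))"
  have G: "integrable (lborel \<Otimes>\<^sub>M lborel) ?G"
    using conv by (intro integrable_mult_right Bochner_Integration.integrable_add) (auto dest: integrable.intros)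
  have "(v x - v y)\<^sup>2 / kern (x - y) \<le> ?G (x, y)" for x y
  proof (cases "x \<in> \<Omega> \<or> y \<in> \<Omega>")
    case True
    have "(v x - v y)\<^sup>2 \<le> L\<^sup>2 * min 1 ((norm (x - y))\<^sup>2)"
    proof -
      have "\<bar>v x - v y\<bar>\<^sup>2 \<le> (L * norm (x - y))\<^sup>2" by (intro power_mono lip) auto
      moreover have "\<bar>v x - v y\<bar>\<^sup>2 \<le> 1\<^sup>2" using v1[of x] v1[of y] by (intro power_mono) auto
      moreover have "1 \<le> L\<^sup>2" using L by simp
      ultimately show ?thesis by (auto simp: min_def power_mult_distrib)
    qed
    then have "(v x - v y)\<^sup>2 / kern (x - y) \<le> L\<^sup>2 * ?k (x - y)"
      by (simp add: divide_right_mono)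
    also have "\<dots> \<le> ?G (x, y)"
      using True by (auto simp: indicator_def distrib_left intro!: mult_left_mono)
    finally show ?thesis .
  next
    case False
    then show ?thesis using v0 by simp
  qed
  then have "integrable (lborel \<Otimes>\<^sub>M lborel) (\<lambda>z. (v (fst z) - v (snd z))\<^sup>2 / kern (fst z - snd z))"
    by (intro integrable_nonneg_bound[OF G]) (measurable, auto)
  then show ?thesis using v0 by (auto simp: H_def case_prod_unfold)
qed

text \<open>Truncated multiples of the distance to the complement converge to the indicator function
  because \<open>\<Omega>\<close> is open, and dominated convergence carries the squared norms to
  the volume. The factor \<open>Suc n\<close> rather than \<open>n\<close> keeps the Lipschitz
  constant at least 1.\<close>

lemma cutoff_exists:
  assumes "\<eta> < measure lborel \<Omega>"
  shows "\<exists>v\<in>H. (\<forall>x. \<bar>v x\<bar> \<le> 1) \<and> \<eta> < ip v v"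
proof -
  define v where "v n x = min 1 (real (Suc n) * infdist x (- \<Omega>))" for n x
  have ne: "- \<Omega> \<noteq> {}" using bounded_dom not_bounded_UNIV[where 'a='a] double_complement[of \<Omega>] by force
  have cl: "closed (- \<Omega>)" using open_dom by (simp add: closed_Compl)
  have vm [measurable]: "v n \<in> borel_measurable borel" for n
    unfolding v_def by (intro borel_measurable_continuous_onI continuous_intros)
  have v01: "0 \<le> v n x" "v n x \<le> 1" for n x
    by (auto simp: v_def infdist_nonneg)
  have v0: "v n x = 0" if "x \<notin> \<Omega>" for n x
    using that by (simp add: v_def)
  have vH: "v n \<in> H" for n
  proof (rule lipschitz_in_H[of _ "real (Suc n)"])
    fix x y
    have "\<bar>v n x - v n y\<bar> \<le> \<bar>real (Suc n) * infdist x (- \<Omega>) - real (Suc n) * infdist y (- \<Omega>)\<bar>"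
      unfolding v_def by linarith
    also have "\<dots> = real (Suc n) * \<bar>infdist x (- \<Omega>) - infdist y (- \<Omega>)\<bar>"
      unfolding right_diff_distrib[symmetric] abs_mult by simp
    also have "\<dots> \<le> real (Suc n) * norm (x - y)"
      using infdist_triangle[of x "- \<Omega>" y] infdist_triangle[of y "- \<Omega>" x]
      by (intro mult_left_mono) (auto simp: dist_norm norm_minus_commute abs_le_iff)
    finally show "\<bar>v n x - v n y\<bar> \<le> real (Suc n) * norm (x - y)" .
  qed (use v01 v0 in auto)
  have "(\<lambda>n. LBINT x. (v n x)\<^sup>2) \<longlonglongrightarrow> (LBINT x. indicator \<Omega> x)"
  proof (rule integral_dominated_convergence)
    show "integrable lborel (indicator \<Omega> :: 'a \<Rightarrow> real)" by (rule integrable_indicator_dom)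
    show "AE x in lborel. norm ((v n x)\<^sup>2) \<le> indicator \<Omega> x" for n
    proof (rule AE_I2)
      show "norm ((v n x)\<^sup>2) \<le> indicator \<Omega> x" for x
        using v01[of n x] v0[of x n] by (auto simp: indicator_def power_le_one)
    qed
    show "AE x in lborel. (\<lambda>n. (v n x)\<^sup>2) \<longlonglongrightarrow> indicator \<Omega> x"
    proof (rule AE_I2)
      fix x
      show "(\<lambda>n. (v n x)\<^sup>2) \<longlonglongrightarrow> indicator \<Omega> x"
      proof (cases "x \<in> \<Omega>")
        case True
        then have pos: "infdist x (- \<Omega>) > 0" using in_closed_iff_infdist_zero[OF cl ne, of x] infdist_nonneg[of x "- \<Omega>"] by auto
        obtain N :: nat where N: "1 / infdist x (- \<Omega>) < real N" using reals_Archimedean2 by blast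
        have "v n x = 1" if "n \<ge> N" for n
        proof -
          have "1 < real N * infdist x (- \<Omega>)" using N pos by (simp add: pos_divide_less_eq)
          also have "\<dots> \<le> real (Suc n) * infdist x (- \<Omega>)" using that pos by (intro mult_right_mono) auto
          finally show ?thesis by (simp add: v_def)
        qed
        then have "eventually (\<lambda>n. (v n x)\<^sup>2 = indicator \<Omega> x) sequentially"
          using True by (intro eventually_sequentiallyI[of N]) simp
        then show ?thesis by (rule tendsto_eventually)
      qed (use v0 in simp)
    qed
  qed measurable
  then have "(\<lambda>n. ip (v n) (v n)) \<longlonglongrightarrow> measure lborel \<Omega>" by (simp add: ip_self)
  from order_tendstoD(1)[OF this assms] obtain n where "\<eta> < ip (v n) (v n)"
    by (auto simp: eventually_sequentially)
  then show ?thesis using vH[of n] v01[of n] by (intro bexI[of _ "v n"]) auto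
qed

end

section \<open>Trace bounds\<close>

text \<open>Completeness is stated for single eigenfunctions: one that is orthogonal to all
  \<open>\<phi> i\<close> has norm zero. This is what the multiplicities provide directly; its
  consequence for arbitrary elements of \<open>H\<close> is
  \<open>form_le_spectral_sum\<close>.\<close>

locale frac_spectrum = frac_domain s \<Omega> for s and \<Omega> :: "'a::euclidean_space set" +
  fixes ev :: "nat \<Rightarrow> real" and \<phi> :: "nat \<Rightarrow> 'a \<Rightarrow> real"
  assumes phi_H: "\<And>i. 1 \<le> i \<Longrightarrow> \<phi> i \<in> H"
    and phi_orthonormal: "\<And>i j. 1 \<le> i \<Longrightarrow> 1 \<le> j \<Longrightarrow> ip (\<phi> i) (\<phi> j) = (if i = j then 1 else 0)"
    and phi_eigen: "\<And>i w. 1 \<le> i \<Longrightarrow> w \<in> H \<Longrightarrow> en (\<phi> i) w = ev i * ip (\<phi> i) w"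
    and phi_complete: "\<And>u \<mu>. u \<in> H \<Longrightarrow> (\<And>w. w \<in> H \<Longrightarrow> en u w = \<mu> * ip u w) \<Longrightarrow>
        (\<And>i. 1 \<le> i \<Longrightarrow> ip u (\<phi> i) = 0) \<Longrightarrow> ip u u = 0"
begin

lemma phi_L2: "1 \<le> i \<Longrightarrow> \<phi> i \<in> L2"
  by (rule H_L2[OF phi_H])

lemma en_phi: "1 \<le> i \<Longrightarrow> en (\<phi> i) (\<phi> i) = ev i"
  using phi_eigen[of i "\<phi> i"] phi_H[of i] phi_orthonormal[of i i] by simp

lemma sum_eigenvalues_ge:
  assumes I: "finite I" "I \<subseteq> {1..}" and \<mu>: "0 \<le> \<mu>"
  shows "(2 * pi) ^ DIM('a) * (\<Sum>i\<in>I. \<mu> - ev i) \<le> measure lborel \<Omega> * (LBINT \<xi>. weight \<mu> \<xi>)"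
proof -
  have i1: "1 \<le> i" if "i \<in> I" for i using I(2) that by auto
  have "(\<Sum>i\<in>I. \<mu> - ev i) = (\<Sum>i\<in>I. \<mu> - en (\<phi> i) (\<phi> i))"
    by (intro sum.cong refl) (simp only: en_phi[OF i1])
  then show ?thesis
    using berezin_li_yau[OF I(1) phi_H phi_orthonormal \<mu>] i1 by simp
qed

definition below :: "real \<Rightarrow> nat set" where
  "below \<mu> = {i. 1 \<le> i \<and> ev i < \<mu>}"

text \<open>Each index in \<open>below \<mu>\<close> contributes at least 1 at the level
  \<open>M = max 0 \<mu> + 1\<close>, while the Berezin--Li--Yau bound at \<open>M\<close> does not
  depend on the index set. Monotonicity and finite multiplicities alone would still permit a finite
  accumulation point.\<close>

lemma finite_below: "finite (below \<mu>)"
proof (rule ccontr)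
  assume inf: "infinite (below \<mu>)"
  define M where "M = max 0 \<mu> + 1"
  define C where "C = measure lborel \<Omega> * (LINT \<xi>|(lborel :: 'a measure). weight M \<xi>) / (2 * pi) ^ DIM('a)"
  obtain I where I: "finite I" "card I = nat \<lceil>C\<rceil> + 1" "I \<subseteq> below \<mu>"
    using infinite_arbitrarily_large[OF inf] by blast
  have "real (card I) = (\<Sum>i\<in>I. 1)" by simp
  also have "\<dots> \<le> (\<Sum>i\<in>I. M - ev i)"
    using I(3) by (intro sum_mono) (auto simp: below_def M_def)
  also have "\<dots> \<le> C"
  proof -
    have "I \<subseteq> {1..}" "0 \<le> M" using I(3) by (auto simp: below_def M_def)
    from sum_eigenvalues_ge[OF I(1) this] show ?thesis
      by (simp add: C_def pos_le_divide_eq mult.commute)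
  qed
  finally have "real (nat \<lceil>C\<rceil> + 1) \<le> C" using I(2) by simp
  then show False by linarith
qed

text \<open>An inequality form of the spectral theorem. Splitting off the components along
  \<open>below \<mu>\<close> decouples both forms. On the remainder the energy is at least
  \<open>\<mu>\<close> times the squared norm: otherwise a Rayleigh minimizer there would be an
  eigenfunction with eigenvalue below \<open>\<mu>\<close> orthogonal to every
  \<open>\<phi> i\<close>, against \<open>phi_complete\<close>.\<close>

lemma form_le_spectral_sum:
  assumes w: "w \<in> H"
  shows "\<mu> * ip w w - en w w \<le> (\<Sum>i\<in>below \<mu>. (\<mu> - ev i) * (ip w (\<phi> i))\<^sup>2)"
proof -
  let ?I = "below \<mu>"
  have i1: "1 \<le> i" if "i \<in> ?I" for i using that by (simp add: below_def)
  have pH: "\<phi> i \<in> H" and pL: "\<phi> i \<in> L2" if "i \<in> ?I" for i using phi_H phi_L2 i1[OF that] by auto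
  have on: "ip (\<phi> i) (\<phi> j) = (if i = j then 1 else 0)" if "i \<in> ?I" "j \<in> ?I" for i j
    using phi_orthonormal i1 that by blast
  define V where "V = {w \<in> H. \<forall>i\<in>?I. ip w (\<phi> i) = 0}"
  have split: "\<exists>r p. r \<in> V \<and> p \<in> H \<and> (\<forall>x. w x = r x + p x) \<and>
      p = (\<lambda>x. \<Sum>i\<in>?I. ip w (\<phi> i) * \<phi> i x) \<and> ip w w = ip r r + (\<Sum>i\<in>?I. (ip w (\<phi> i))\<^sup>2)"
    if w: "w \<in> H" for w
  proof -
    let ?p = "\<lambda>x. \<Sum>i\<in>?I. ip w (\<phi> i) * \<phi> i x"
    note r = L2.orthonormal_remainder[OF finite_below pL H_L2[OF w] on, of \<mu>, simplified]
    have "?p \<in> H" by (rule H.lincomb_mem[OF finite_below pH])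
    moreover from this have "(\<lambda>x. w x - ?p x) \<in> V"
      using r(2) w by (auto simp: V_def intro: H.diff_mem)
    ultimately show ?thesis using r(3)
      by (intro exI[of _ "\<lambda>x. w x - ?p x"] exI[of _ ?p]) auto
  qed
  obtain r p where r: "r \<in> V" and p: "p \<in> H" and wrp: "\<forall>x. w x = r x + p x"
    and pdef: "p = (\<lambda>x. \<Sum>i\<in>?I. ip w (\<phi> i) * \<phi> i x)"
    and ipw: "ip w w = ip r r + (\<Sum>i\<in>?I. (ip w (\<phi> i))\<^sup>2)"
    using split[OF w] by blast
  have rH: "r \<in> H" and rorth: "\<And>i. i \<in> ?I \<Longrightarrow> ip r (\<phi> i) = 0" using r by (auto simp: V_def)
  have Vp: "en u (\<lambda>x. \<Sum>i\<in>?I. c i * \<phi> i x) = 0" if "u \<in> V" for u c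
  proof -
    have "en u (\<lambda>x. \<Sum>i\<in>?I. c i * \<phi> i x) = (\<Sum>i\<in>?I. c i * en u (\<phi> i))"
      using that by (intro H.lincomb_right[OF finite_below pH]) (auto simp: V_def)
    also have "\<dots> = 0"
    proof (rule sum.neutral, safe)
      fix i assume i: "i \<in> ?I"
      have "en u (\<phi> i) = en (\<phi> i) u" by (rule H.form_sym)
      also have "\<dots> = ev i * ip u (\<phi> i)"
        using phi_eigen[OF i1[OF i], of u] that L2.form_sym[of "\<phi> i" u] by (simp add: V_def)
      also have "\<dots> = 0" using that i by (simp add: V_def)
      finally show "c i * en u (\<phi> i) = 0" by simp
    qed
    finally show ?thesis .
  qed
  have w_eq: "w = (\<lambda>x. r x + p x)" using wrp by auto
  have "en p p = (\<Sum>i\<in>?I. ip w (\<phi> i) * en (\<phi> i) p)"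
    by (subst (1) pdef) (rule H.lincomb_left[OF finite_below pH p])
  also have "\<dots> = (\<Sum>i\<in>?I. ev i * (ip w (\<phi> i))\<^sup>2)"
  proof (intro sum.cong refl)
    fix i assume i: "i \<in> ?I"
    have "ip (\<phi> i) p = ip (\<phi> i) w - ip (\<phi> i) r"
      using L2.add_right[OF H_L2[OF rH] H_L2[OF p] pL[OF i]] by (simp add: w_eq)
    also have "\<dots> = ip w (\<phi> i)"
      using rorth[OF i] by (simp add: L2.form_sym[of "\<phi> i"])
    finally show "ip w (\<phi> i) * en (\<phi> i) p = ev i * (ip w (\<phi> i))\<^sup>2"
      using phi_eigen[OF i1[OF i] p] by (simp add: power2_eq_square)
  qed
  finally have enp: "en p p = (\<Sum>i\<in>?I. ev i * (ip w (\<phi> i))\<^sup>2)" .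
  have "en r p = 0" unfolding pdef by (rule Vp[OF r])
  then have enw: "en w w = en r r + en p p"
    using H.form_add_scaled[OF rH p, of 1] by (simp add: w_eq)
  have "\<mu> * ip r r \<le> en r r"
  proof (rule ccontr)
    assume neg: "\<not> \<mu> * ip r r \<le> en r r"
    then have ne: "ip r r \<noteq> 0" using H.form_nonneg[OF rH] by auto
    then have pos: "ip r r > 0" using L2.form_nonneg[OF H_L2[OF rH]] by simp
    obtain u where u: "u \<in> V" "ip u u = 1" and umin: "\<And>w. w \<in> V \<Longrightarrow> en u u * ip w w \<le> en w w"
      using rayleigh_minimizer[of ?I \<phi> r, folded V_def, OF pL r ne] by blast
    define l where "l = en u u"
    have uH: "u \<in> H" and uL: "u \<in> L2" using u(1) H_L2 by (auto simp: V_def)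
    have "l * ip r r < \<mu> * ip r r" using umin[OF r] neg by (simp add: l_def)
    then have l: "l < \<mu>" using pos by simp
    have V_eig: "en u w = l * ip u w" if "w \<in> V" for w
    proof -
      have wH: "w \<in> H" and wL: "w \<in> L2" using that H_L2 by (auto simp: V_def)
      have quad: "0 \<le> 2 * t * (en u w - l * ip u w) + t\<^sup>2 * (en w w - l * ip w w)" for t
      proof -
        have "(\<lambda>x. u x + t * w x) \<in> V"
          using that u(1) pL uL wL by (auto simp: V_def H.add_mem H.scale_mem L2.add_left L2.scale_left L2.scale_mem)
        from umin[OF this] show ?thesis
          unfolding H.form_add_scaled[OF uH wH] L2.form_add_scaled[OF uL wL]
          using u(2) by (simp add: l_def algebra_simps)
      qed
      define b where "b = en u w - l * ip u w"
      define d where "d = en w w - l * ip w w"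
      have d0: "0 \<le> d" using umin[OF that] by (simp add: d_def l_def)
      have "b = 0"
      proof (rule ccontr)
        assume "b \<noteq> 0"
        \<comment> \<open>The summand 1 keeps \<open>t\<close> defined when \<open>d = 0\<close>;
          the quadratic then takes the negative value \<open>- (t^2 * (d + 2))\<close>.\<close>
        define t where "t = - b / (d + 1)"
        have bt: "b = - t * (d + 1)" and "t \<noteq> 0" using d0 \<open>b \<noteq> 0\<close> by (auto simp: t_def)
        have "0 \<le> 2 * t * b + t\<^sup>2 * d" using quad[of t] by (simp only: b_def d_def)
        also have "\<dots> = - (t\<^sup>2 * (d + 2))" by (simp add: bt power2_eq_square algebra_simps)
        also have "\<dots> < 0" using \<open>t \<noteq> 0\<close> d0 by simp
        finally show False by simp
      qed
      then show ?thesis by (simp add: b_def)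
    qed
    \<comment> \<open>The equation extends from \<open>V\<close> to \<open>H\<close> because the
      component of \<open>w\<close> along the eigenfunctions in \<open>below \<mu>\<close> is
      orthogonal to \<open>u\<close> in both forms.\<close>
    have eig: "en u w = l * ip u w" if w: "w \<in> H" for w
    proof -
      obtain r' p' where r': "r' \<in> V" and p': "p' \<in> H" and w_eq': "\<forall>x. w x = r' x + p' x"
        and pdef': "p' = (\<lambda>x. \<Sum>i\<in>?I. ip w (\<phi> i) * \<phi> i x)"
        using split[OF w] by blast
      have w': "w = (\<lambda>x. r' x + p' x)" using w_eq' by auto
      have r'H: "r' \<in> H" using r' by (simp add: V_def)
      have "en u p' = 0" unfolding pdef' by (rule Vp[OF u(1)])
      moreover have "ip u p' = 0"
        unfolding pdef' using u(1) by (subst L2.lincomb_right[OF finite_below pL uL]) (auto simp: V_def intro!: sum.neutral)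
      ultimately show ?thesis
        using V_eig[OF r'] H.add_right[OF r'H p' uH] L2.add_right[OF H_L2[OF r'H] H_L2[OF p'] uL]
        by (simp add: w')
    qed
    \<comment> \<open>Inside \<open>below \<mu>\<close> this is membership in \<open>V\<close>.
      Outside, \<open>ev i \<ge> \<mu> > l\<close>, and eigenfunctions with different eigenvalues
      are orthogonal.\<close>
    have "ip u (\<phi> i) = 0" if i: "1 \<le> i" for i
    proof (cases "i \<in> ?I")
      case True
      then show ?thesis using u(1) by (simp add: V_def)
    next
      case False
      then have "ev i \<noteq> l" using l i by (auto simp: below_def)
      moreover have "ev i * ip u (\<phi> i) = l * ip u (\<phi> i)"
        using phi_eigen[OF i uH] eig[OF phi_H[OF i]] H.form_sym[of u "\<phi> i"] L2.form_sym[of u "\<phi> i"] by simp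
      ultimately show ?thesis by simp
    qed
    then have "ip u u = 0" using phi_complete[OF uH eig] by blast
    then show False using u(2) by simp
  qed
  then show ?thesis
    unfolding enw enp ipw by (simp add: left_diff_distrib sum_subtractf sum_distrib_left algebra_simps)
qed

text \<open>The two functions are the real and imaginary part of
  \<open>exp (i * (\<xi> \<bullet> x)) * v x\<close>, whose squared difference is \<open>(v x - v
  y)^2 + 2 * v x * v y * (1 - cos (\<xi> \<bullet> (x - y)))\<close>. Replacing
  \<open>2 * v x * v y\<close> by \<open>(v x)^2 + (v y)^2\<close> decouples the variables, and the
  symbol identity integrates each term.\<close>

lemma modulated_energy:
  assumes v: "v \<in> H"
  shows "(\<lambda>x. v x * cos (\<xi> \<bullet> x)) \<in> H" and "(\<lambda>x. v x * sin (\<xi> \<bullet> x)) \<in> H"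
    and "en (\<lambda>x. v x * cos (\<xi> \<bullet> x)) (\<lambda>x. v x * cos (\<xi> \<bullet> x)) + en (\<lambda>x. v x * sin (\<xi> \<bullet> x)) (\<lambda>x. v x * sin (\<xi> \<bullet> x)) \<le>
      en v v + norm \<xi> powr (2 * s) * ip v v"
proof -
  let ?P = "lborel \<Otimes>\<^sub>M lborel :: ('a \<times> 'a) measure"
  let ?wc = "\<lambda>x. v x * cos (\<xi> \<bullet> x)" and ?ws = "\<lambda>x. v x * sin (\<xi> \<bullet> x)"
  let ?c = "frac_lap_const DIM('a) s"
  let ?e = "\<lambda>f z. (f (fst z) - f (snd z))\<^sup>2 / kern (fst z - snd z)"
  let ?k = "\<lambda>z::'a. (1 - cos (\<xi> \<bullet> z)) / kern z"
  note [measurable] = HD(1)[OF v]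
  note vL = H_L2[OF v]
  have km: "?k \<in> borel_measurable borel" by measurable
  have cc: "0 \<le> norm \<xi> powr (2 * s) / ?c" using const_pos by simp
  note conv = integrable_pair_convolve[OF L2D(3)[OF vL] km _ nn_integral_one_minus_cos[OF s] _ cc, simplified]
  let ?G = "\<lambda>z. (case z of (x, y) \<Rightarrow> (v x - v y)\<^sup>2 / kern (x - y)) +
      ((case z of (x, y) \<Rightarrow> (v x)\<^sup>2 * ?k (x - y)) + (case z of (x, y) \<Rightarrow> (v y)\<^sup>2 * ?k (x - y)))"
  have G: "has_bochner_integral ?P ?G ((LINT (x, y)|?P. (v x - v y)\<^sup>2 / kern (x - y)) +
      (norm \<xi> powr (2 * s) / ?c * ip v v + norm \<xi> powr (2 * s) / ?c * ip v v))"
    unfolding ip_self using conv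
    by (intro has_bochner_integral_add has_bochner_integral_integrable HD(3)[OF v]) simp_all
  then have Gi: "integrable ?P ?G" by (rule integrable.intros)
  have le: "?e ?wc z + ?e ?ws z \<le> ?G z" for z
  proof -
    obtain x y where z: "z = (x, y)" by (cases z)
    have "(a * c - b * d)\<^sup>2 + (a * p - b * q)\<^sup>2 \<le> (a - b)\<^sup>2 + (a\<^sup>2 * (1 - (c * d + p * q)) + b\<^sup>2 * (1 - (c * d + p * q)))"
      if "c\<^sup>2 + p\<^sup>2 = 1" "d\<^sup>2 + q\<^sup>2 = 1" "c * d + p * q \<le> 1" for a b c d p q :: real
    proof -
      have "(a * c - b * d)\<^sup>2 + (a * p - b * q)\<^sup>2 = a\<^sup>2 * (c\<^sup>2 + p\<^sup>2) + b\<^sup>2 * (d\<^sup>2 + q\<^sup>2) - 2 * a * b * (c * d + p * q)"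
        by (simp add: power2_eq_square algebra_simps)
      also have "\<dots> = a\<^sup>2 + b\<^sup>2 - 2 * a * b * (c * d + p * q)" using that by simp
      finally have 1: "(a * c - b * d)\<^sup>2 + (a * p - b * q)\<^sup>2 = a\<^sup>2 + b\<^sup>2 - 2 * a * b * (c * d + p * q)" .
      have 2: "(a - b)\<^sup>2 + (a\<^sup>2 * (1 - t) + b\<^sup>2 * (1 - t)) = a\<^sup>2 + b\<^sup>2 - 2 * a * b * t + (a - b)\<^sup>2 * (1 - t)" for t
        by (simp add: power2_eq_square algebra_simps)
      have "0 \<le> (a - b)\<^sup>2 * (1 - (c * d + p * q))" using that by simp
      then show ?thesis unfolding 1 2 by linarith
    qed
    from this[of "cos (\<xi> \<bullet> x)" "sin (\<xi> \<bullet> x)" "cos (\<xi> \<bullet> y)" "sin (\<xi> \<bullet> y)" "v x" "v y"]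
    have "(?wc x - ?wc y)\<^sup>2 + (?ws x - ?ws y)\<^sup>2 \<le> (v x - v y)\<^sup>2 + ((v x)\<^sup>2 * (1 - cos (\<xi> \<bullet> (x - y))) + (v y)\<^sup>2 * (1 - cos (\<xi> \<bullet> (x - y))))"
      by (simp add: inner_diff_right cos_diff[symmetric])
    then have "((?wc x - ?wc y)\<^sup>2 + (?ws x - ?ws y)\<^sup>2) / kern (x - y) \<le> ((v x - v y)\<^sup>2 + ((v x)\<^sup>2 * (1 - cos (\<xi> \<bullet> (x - y))) + (v y)\<^sup>2 * (1 - cos (\<xi> \<bullet> (x - y))))) / kern (x - y)"
      by (rule divide_right_mono) simp
    then show ?thesis by (simp add: z add_divide_distrib)
  qed
  have ei: "0 \<le> ?e f z" for f z by simp
  have ic: "integrable ?P (?e ?wc)"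
  proof (rule integrable_nonneg_bound[OF Gi _ ei])
    show "?e ?wc z \<le> ?G z" for z using le[of z] ei[of ?ws z] by linarith
  qed measurable
  have is': "integrable ?P (?e ?ws)"
  proof (rule integrable_nonneg_bound[OF Gi _ ei])
    show "?e ?ws z \<le> ?G z" for z using le[of z] ei[of ?wc z] by linarith
  qed measurable
  show "?wc \<in> H" "?ws \<in> H"
    using ic is' HD(2)[OF v] by (auto simp: H_def case_prod_unfold)
  have "(LINT z|?P. ?e ?wc z) + (LINT z|?P. ?e ?ws z) = (LINT z|?P. ?e ?wc z + ?e ?ws z)"
    using ic is' by simp
  also have "\<dots> \<le> (LINT z|?P. ?G z)"
    using ic is' Gi le by (intro integral_mono) auto
  also have "\<dots> = (LINT (x, y)|?P. (v x - v y)\<^sup>2 / kern (x - y)) + 2 * (norm \<xi> powr (2 * s) / ?c * ip v v)"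
    using has_bochner_integral_integral_eq[OF G] by simp
  finally have "?c / 2 * ((LINT z|?P. ?e ?wc z) + (LINT z|?P. ?e ?ws z)) \<le>
      ?c / 2 * ((LINT (x, y)|?P. (v x - v y)\<^sup>2 / kern (x - y)) + 2 * (norm \<xi> powr (2 * s) / ?c * ip v v))"
    using const_pos by (intro mult_left_mono) auto
  then show "en ?wc ?wc + en ?ws ?ws \<le> en v v + norm \<xi> powr (2 * s) * ip v v"
    using const_pos by (simp add: en_self case_prod_unfold distrib_left)
qed

text \<open>The coefficients of the modulated cut-offs against \<open>\<phi> i\<close> are also the
  transforms of \<open>\<phi> i * v\<close> at \<open>\<xi>\<close>. Integrating their squares over
  \<open>\<xi>\<close>, Bessel's inequality and \<open>|v| \<le> 1\<close> allow at most
  \<open>(2 * pi) ^ DIM('a)\<close> for each eigenfunction. The price of the cut-off is the shift of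
  the level by its Rayleigh quotient.\<close>

lemma eigenvalue_sum_lower_trace:
  assumes v: "v \<in> H" and v1: "\<And>x. \<bar>v x\<bar> \<le> 1" and pos: "0 < ip v v"
    and \<mu>: "en v v / ip v v \<le> \<mu>"
  shows "ip v v * (LBINT \<xi>. weight (\<mu> - en v v / ip v v) \<xi>) \<le>
    (2 * pi) ^ DIM('a) * (\<Sum>i\<in>below \<mu>. \<mu> - ev i)"
proof -
  note [measurable] = HD(1)[OF v]
  note vL = H_L2[OF v]
  define e where "e = en v v / ip v v"
  let ?f = "\<lambda>i x. \<phi> i x * v x"
  have i1: "1 \<le> i" "ev i < \<mu>" if "i \<in> below \<mu>" for i using that by (auto simp: below_def)
  have fL: "?f i \<in> L2" if "i \<in> below \<mu>" for i
    by (rule L2_bounded_mult[OF phi_L2[OF i1(1)[OF that]] HD(1)[OF v] v1])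
  have fi: "integrable lborel (power_spectrum (?f i))" if "i \<in> below \<mu>" for i
    by (rule power_spectrum_bessel(1)[OF L2_integrable[OF fL[OF that]] L2D(3)[OF fL[OF that]]])
  have f1: "(LBINT \<xi>. power_spectrum (?f i) \<xi>) \<le> (2 * pi) ^ DIM('a)" if i: "i \<in> below \<mu>" for i
  proof -
    have "(LBINT x. (?f i x)\<^sup>2) \<le> (LBINT x. (\<phi> i x)\<^sup>2)"
    proof (rule integral_mono[OF L2D(3)[OF fL[OF i]] L2D(3)[OF phi_L2[OF i1(1)[OF i]]]])
      show "(?f i x)\<^sup>2 \<le> (\<phi> i x)\<^sup>2" for x
        using mult_left_mono[OF power_mono[OF v1[of x], of 2], of "(\<phi> i x)\<^sup>2"] by (simp add: power_mult_distrib)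
    qed
    also have "\<dots> = 1" using phi_orthonormal[OF i1(1)[OF i] i1(1)[OF i]] by (simp add: ip_self)
    finally have "(2 * pi) ^ DIM('a) * (LBINT x. (?f i x)\<^sup>2) \<le> (2 * pi) ^ DIM('a) * 1"
      by (intro mult_left_mono) auto
    then show ?thesis
      using power_spectrum_bessel(2)[OF L2_integrable[OF fL[OF i]] L2D(3)[OF fL[OF i]]] by linarith
  qed
  have pt: "ip v v * weight (\<mu> - e) \<xi> \<le> (\<Sum>i\<in>below \<mu>. (\<mu> - ev i) * power_spectrum (?f i) \<xi>)" for \<xi>
  proof -
    let ?wc = "\<lambda>x. v x * cos (\<xi> \<bullet> x)" and ?ws = "\<lambda>x. v x * sin (\<xi> \<bullet> x)"
    note m = modulated_energy[OF v, of \<xi>]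
    have "ip ?wc ?wc + ip ?ws ?ws = (LBINT x. ?wc x * ?wc x + ?ws x * ?ws x)"
      unfolding ip_def using L2_integrable_mult[OF H_L2[OF m(1)] H_L2[OF m(1)]] L2_integrable_mult[OF H_L2[OF m(2)] H_L2[OF m(2)]]
      by simp
    also have "\<dots> = ip v v"
      unfolding ip_def
    proof (intro Bochner_Integration.integral_cong refl)
      fix x
      have "(a * c) * (a * c) + (a * d) * (a * d) = a * a * (d\<^sup>2 + c\<^sup>2)" for a c d :: real
        by (simp add: power2_eq_square algebra_simps)
      from this[of "v x" "cos (\<xi> \<bullet> x)" "sin (\<xi> \<bullet> x)"]
      show "?wc x * ?wc x + ?ws x * ?ws x = v x * v x"
        unfolding sin_cos_squared_add mult_1_right .
    qed
    finally have ipv: "ip ?wc ?wc + ip ?ws ?ws = ip v v" .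
    have "ip v v * (\<mu> - e - norm \<xi> powr (2 * s)) = \<mu> * ip v v - (en v v + norm \<xi> powr (2 * s) * ip v v)"
      using pos by (simp add: e_def algebra_simps)
    also have "\<dots> \<le> (\<mu> * ip ?wc ?wc - en ?wc ?wc) + (\<mu> * ip ?ws ?ws - en ?ws ?ws)"
      using m(3) unfolding ipv[symmetric] by (simp add: distrib_left)
    also have "\<dots> \<le> (\<Sum>i\<in>below \<mu>. (\<mu> - ev i) * (ip ?wc (\<phi> i))\<^sup>2) + (\<Sum>i\<in>below \<mu>. (\<mu> - ev i) * (ip ?ws (\<phi> i))\<^sup>2)"
      by (intro add_mono form_le_spectral_sum m)
    also have "\<dots> = (\<Sum>i\<in>below \<mu>. (\<mu> - ev i) * power_spectrum (?f i) \<xi>)"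
    proof -
      have "ip ?wc (\<phi> i) = cos_tr (?f i) \<xi>" "ip ?ws (\<phi> i) = sin_tr (?f i) \<xi>" for i
        by (simp_all add: ip_def cos_tr_def sin_tr_def mult_ac)
      then show ?thesis by (simp add: power_spectrum_def sum.distrib distrib_left)
    qed
    finally have "ip v v * (\<mu> - e - norm \<xi> powr (2 * s)) \<le> (\<Sum>i\<in>below \<mu>. (\<mu> - ev i) * power_spectrum (?f i) \<xi>)" .
    \<comment> \<open>Indices in \<open>below \<mu>\<close> have \<open>ev i < \<mu>\<close>; the
      right side being nonnegative, the left side may be replaced by its positive part.\<close>
    moreover have "0 \<le> (\<Sum>i\<in>below \<mu>. (\<mu> - ev i) * power_spectrum (?f i) \<xi>)"
      using i1 by (intro sum_nonneg mult_nonneg_nonneg) (auto intro: less_imp_le)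
    ultimately show ?thesis by (simp add: max_def)
  qed
  have "ip v v * (LBINT \<xi>. weight (\<mu> - e) \<xi>) = (LBINT \<xi>. ip v v * weight (\<mu> - e) \<xi>)"
    by simp
  also have "\<dots> \<le> (LBINT \<xi>. (\<Sum>i\<in>below \<mu>. (\<mu> - ev i) * power_spectrum (?f i) \<xi>))"
  proof (rule integral_mono)
    show "integrable lborel (\<lambda>\<xi>. ip v v * weight (\<mu> - e) \<xi>)"
      using weyl_weight(1)[OF s(1), of "\<mu> - e", where 'a='a] \<mu> by (simp add: e_def)
    show "integrable lborel (\<lambda>\<xi>. \<Sum>i\<in>below \<mu>. (\<mu> - ev i) * power_spectrum (?f i) \<xi>)"
      using fi by simp
  qed (rule pt)
  also have "\<dots> = (\<Sum>i\<in>below \<mu>. (\<mu> - ev i) * (LBINT \<xi>. power_spectrum (?f i) \<xi>))"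
    using fi by (subst Bochner_Integration.integral_sum) auto
  also have "\<dots> \<le> (\<Sum>i\<in>below \<mu>. (\<mu> - ev i) * (2 * pi) ^ DIM('a))"
    using i1 f1 by (intro sum_mono mult_left_mono) (auto intro: less_imp_le)
  also have "\<dots> = (2 * pi) ^ DIM('a) * (\<Sum>i\<in>below \<mu>. \<mu> - ev i)"
    by (simp add: sum_distrib_right mult.commute)
  finally show ?thesis by (simp add: e_def)
qed

end

section \<open>Asymptotics of eigenvalue sums\<close>

text \<open>Young's inequality with the conjugate exponents \<open>1 + a\<close> and
  \<open>1 + 1 / a\<close>. Splitting \<open>k * m\<close> as \<open>(d * m) * (k / d)\<close> with
  \<open>d powr p = D\<close> makes the first term exactly the one that is subtracted.\<close>

lemma legendre_bound:
  fixes a D m k :: real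
  assumes a: "0 < a" and D: "0 < D" and m: "0 \<le> m" and k: "0 < k"
  shows "k * m - D * m powr (1 + a) / (1 + a) \<le> k powr (1 + 1 / a) * (D powr (- (1 / a)) * (a / (1 + a)))"
proof -
  define p where "p = 1 + a"
  define q where "q = (1 + a) / a"
  define d where "d = D powr (1 / p)"
  have pq: "p > 1" "q > 1" "1 / p + 1 / q = 1" using a by (auto simp: p_def q_def field_simps)
  have d: "d > 0" using D by (simp add: d_def)
  have "(d * m) * (k / d) \<le> (d * m) powr p / p + (k / d) powr q / q"
    using d m k by (intro Youngs_inequality pq) auto
  moreover have "(d * m) * (k / d) = k * m" using d by simp
  moreover have "(d * m) powr p = D * m powr (1 + a)"
    unfolding powr_mult d_def powr_powr using pq D by (simp add: p_def)
  moreover have "(k / d) powr q / q = k powr (1 + 1 / a) * (D powr (- (1 / a)) * (a / (1 + a)))"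
  proof -
    have "1 / p * q = 1 / a" using a by (simp add: p_def q_def)
    moreover have "q = 1 + 1 / a" using a by (simp add: q_def field_simps)
    ultimately have "(k / d) powr q = k powr (1 + 1 / a) * D powr (- (1 / a))"
      unfolding powr_divide d_def powr_powr by (simp add: powr_minus_divide)
    then show ?thesis by (simp add: q_def)
  qed
  ultimately show ?thesis by (simp add: p_def)
qed

text \<open>\<open>m\<close> is the stationary point, where \<open>D * m powr a = k\<close>; it
  shows that the bound from Young's inequality is sharp.\<close>

lemma legendre_attained:
  fixes a D k :: real
  assumes a: "0 < a" and D: "0 < D" and k: "0 < k"
  defines "m \<equiv> (k / D) powr (1 / a)"
  shows "k * m - D * m powr (1 + a) / (1 + a) = k powr (1 + 1 / a) * (D powr (- (1 / a)) * (a / (1 + a)))"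
proof -
  have "m powr a = k / D" unfolding m_def powr_powr using a D k by simp
  moreover have "m powr (1 + a) = m * m powr a" unfolding powr_add by (simp add: m_def)
  ultimately have "D * m powr (1 + a) = k * m" using D by simp
  then have "k * m - D * m powr (1 + a) / (1 + a) = k * m * (a / (1 + a))" using a by (simp add: field_simps)
  moreover have "k * m = k powr (1 + 1 / a) * D powr (- (1 / a))"
    unfolding m_def powr_divide powr_add using k D by (simp add: powr_minus_divide)
  ultimately show ?thesis by simp
qed

section \<open>Two-sided bounds for eigenvalue sums\<close>

context frac_spectrum
begin

text \<open>Berezin--Li--Yau for the indices \<open>{1..k}\<close> holds at every nonnegative level;
  the level chosen is the maximiser of \<open>legendre_attained\<close>.\<close>

lemma eigenvalue_sum_ge:
  assumes pos: "0 < measure lborel \<Omega>" and k: "0 < k"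
  defines "a \<equiv> real DIM('a) / (2 * s)"
    and "D \<equiv> unit_ball_vol (real DIM('a)) * measure lborel \<Omega> / (2 * pi) ^ DIM('a)"
  shows "real k powr (1 + 1 / a) * (D powr (- (1 / a)) * (a / (1 + a))) \<le> (\<Sum>i=1..k. ev i)"
proof -
  have a: "0 < a" and D: "0 < D" using s pos by (auto simp: a_def D_def)
  define m where "m = (real k / D) powr (1 / a)"
  have "(2 * pi) ^ DIM('a) * (\<Sum>i=1..k. m - ev i) \<le>
      measure lborel \<Omega> * (LBINT \<xi>. weight m \<xi>)"
    by (rule sum_eigenvalues_ge) (auto simp: m_def)
  also have "\<dots> = (2 * pi) ^ DIM('a) * (D * m powr (1 + a) / (1 + a))"
    using weyl_weight(2)[OF s(1), of m, where 'a='a] by (simp add: m_def D_def a_def)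
  finally have "(\<Sum>i=1..k. m - ev i) \<le> D * m powr (1 + a) / (1 + a)"
    by (rule mult_left_le_imp_le) simp
  then show ?thesis
    using legendre_attained[OF a D, of "real k", folded m_def] k by (simp add: sum_subtractf)
qed

text \<open>With \<open>\<mu> = ev k\<close> the trace of the positive part is exactly \<open>k * ev k - (\<Sum>i=1..k. ev i)\<close>.\<close>

lemma eigenvalue_sum_le:
  assumes mono: "mono_on {1..} ev" and v: "v \<in> H" and v1: "\<And>x. \<bar>v x\<bar> \<le> 1" and pos: "0 < ip v v" and k: "0 < k"
  defines "a \<equiv> real DIM('a) / (2 * s)"
    and "D \<equiv> unit_ball_vol (real DIM('a)) * ip v v / (2 * pi) ^ DIM('a)"
  shows "(\<Sum>i=1..k. ev i) \<le> real k * (en v v / ip v v) + real k powr (1 + 1 / a) * (D powr (- (1 / a)) * (a / (1 + a)))"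
proof -
  have a: "0 < a" and D: "0 < D" using s pos by (auto simp: a_def D_def)
  define e where "e = en v v / ip v v"
  have le: "ev i \<le> ev k" if "i \<in> {1..k}" for i using mono that by (auto simp: mono_on_def)
  show ?thesis
  \<comment> \<open>\<open>eigenvalue_sum_lower_trace\<close> requires a level of at least
    \<open>e\<close>. If \<open>ev k\<close> is smaller, all \<open>k\<close> eigenvalues lie below
    \<open>e\<close>, and the first term of the bound suffices.\<close>
  proof (cases "e \<le> ev k")
    case True
    have sub: "below (ev k) \<subseteq> {1..k}"
    proof
      fix i assume "i \<in> below (ev k)"
      then have i: "1 \<le> i" "ev i < ev k" by (auto simp: below_def)
      then have "i \<le> k" using mono k by (metis atLeast_iff leI less_imp_le mono_onD not_less Suc_leI One_nat_def)
      then show "i \<in> {1..k}" using i by simp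
    qed
    have "(\<Sum>i\<in>below (ev k). ev k - ev i) = (\<Sum>i=1..k. ev k - ev i)"
    proof (rule sum.mono_neutral_left[OF _ sub])
      show "\<forall>i\<in>{1..k} - below (ev k). ev k - ev i = 0"
      proof
        fix i assume i: "i \<in> {1..k} - below (ev k)"
        then have "\<not> ev i < ev k" by (simp add: below_def)
        with le[of i] i show "ev k - ev i = 0" by simp
      qed
    qed simp
    then have "ip v v * (LBINT \<xi>. weight (ev k - e) \<xi>) \<le> (2 * pi) ^ DIM('a) * (\<Sum>i=1..k. ev k - ev i)"
      using eigenvalue_sum_lower_trace[OF v v1 pos, of "ev k"] True by (simp add: e_def)
    moreover have "ip v v * (LBINT \<xi>. weight (ev k - e) \<xi>) =
        (2 * pi) ^ DIM('a) * (D * (ev k - e) powr (1 + a) / (1 + a))"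
      using weyl_weight(2)[OF s(1), of "ev k - e", where 'a='a] True by (simp add: D_def a_def)
    ultimately have "(2 * pi) ^ DIM('a) * (D * (ev k - e) powr (1 + a) / (1 + a)) \<le> (2 * pi) ^ DIM('a) * (\<Sum>i=1..k. ev k - ev i)"
      by (simp only:)
    then have "D * (ev k - e) powr (1 + a) / (1 + a) \<le> (\<Sum>i=1..k. ev k - ev i)"
      by (rule mult_left_le_imp_le) simp
    then show ?thesis
      using legendre_bound[OF a D, of "ev k - e" "real k"] True k
      by (simp add: sum_subtractf e_def right_diff_distrib)
  next
    case False
    have "(\<Sum>i=1..k. ev i) \<le> (\<Sum>i=1..k. ev k)" by (intro sum_mono le)
    also have "\<dots> = real k * ev k" by simp
    also have "\<dots> \<le> real k * e" using False by (intro mult_left_mono) auto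
    also have "\<dots> \<le> real k * e + real k powr (1 + 1 / a) * (D powr (- (1 / a)) * (a / (1 + a)))"
      using a by simp
    finally show ?thesis by (simp add: e_def)
  qed
qed

text \<open>The lower bound is exact for each \<open>k\<close>. In the upper bound a cut-off costs
  \<open>real k\<close> times its Rayleigh quotient, which is of lower order for a fixed
  \<open>v\<close>. Hence \<open>v\<close> is fixed close to the indicator function before
  \<open>k\<close> tends to infinity.\<close>

theorem eigenvalue_sum_asymptotics:
  assumes mono: "mono_on {1..} ev" and pos: "0 < measure lborel \<Omega>"
  defines "a \<equiv> real DIM('a) / (2 * s)"
    and "D \<equiv> unit_ball_vol (real DIM('a)) * measure lborel \<Omega> / (2 * pi) ^ DIM('a)"
  shows "(\<lambda>k. real k powr (- 1 - 1 / a) * (\<Sum>i=1..k. ev i)) \<longlonglongrightarrow> D powr (- (1 / a)) * (a / (1 + a))"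
proof -
  have a: "0 < a" and D: "0 < D" using s pos by (auto simp: a_def D_def)
  let ?U = "unit_ball_vol (real DIM('a)) / (2 * pi) ^ DIM('a)"
  let ?T = "\<lambda>x. (?U * x) powr (- (1 / a)) * (a / (1 + a))"
  have T: "D powr (- (1 / a)) * (a / (1 + a)) = ?T (measure lborel \<Omega>)" by (simp add: D_def)
  have cancel: "real k powr (- 1 - 1 / a) * (real k powr (1 + 1 / a) * x) = x" if "0 < k" for k x
  proof -
    have "real k powr (- 1 - 1 / a) * real k powr (1 + 1 / a) = real k powr ((- 1 - 1 / a) + (1 + 1 / a))"
      by (rule powr_add[symmetric])
    also have "\<dots> = 1" using that by simp
    finally show ?thesis by (simp add: mult.assoc[symmetric])
  qed
  show ?thesis
    unfolding T
  proof (rule order_tendstoI)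
    fix l assume l: "l < ?T (measure lborel \<Omega>)"
    show "eventually (\<lambda>k. l < real k powr (- 1 - 1 / a) * (\<Sum>i=1..k. ev i)) sequentially"
    proof (rule eventually_sequentiallyI[of 1])
      fix k :: nat assume k: "1 \<le> k"
      have "?T (measure lborel \<Omega>) = real k powr (- 1 - 1 / a) * (real k powr (1 + 1 / a) * ?T (measure lborel \<Omega>))"
        using cancel[of k] k by simp
      also have "\<dots> \<le> real k powr (- 1 - 1 / a) * (\<Sum>i=1..k. ev i)"
        using eigenvalue_sum_ge[OF pos, of k] k by (intro mult_left_mono) (auto simp: a_def)
      finally show "l < real k powr (- 1 - 1 / a) * (\<Sum>i=1..k. ev i)" using l by simp
    qed
  next
    fix l assume l: "?T (measure lborel \<Omega>) < l"
    let ?W = "measure lborel \<Omega>"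
    have U: "?U > 0" by simp
    have nz: "?U * ?W \<noteq> 0" using mult_pos_pos[OF U pos] by (rule less_imp_neq[symmetric])
    \<comment> \<open>\<open>cutoff_exists\<close> is available for \<open>\<eta>\<close> below the
      volume, hence the limit from the left. On positive arguments \<open>?T\<close> is
      nonincreasing, so the bound at \<open>\<eta>\<close> passes on to
      \<open>ip v v > \<eta>\<close>.\<close>
    have "(?T \<longlongrightarrow> ?T ?W) (at_left ?W)"
      by (intro tendsto_mult tendsto_powr tendsto_const tendsto_ident_at nz)
    then have "eventually (\<lambda>x. ?T x < l) (at_left ?W)" using l by (rule order_tendstoD)
    moreover have "eventually (\<lambda>x. 0 < x) (at_left ?W)"
      using pos by (rule order_tendstoD(1)[OF tendsto_ident_at])
    moreover have "eventually (\<lambda>x. x < ?W) (at_left ?W)"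
      by (simp add: eventually_at_filter)
    ultimately have "eventually (\<lambda>x. ?T x < l \<and> 0 < x \<and> x < ?W) (at_left ?W)"
      by eventually_elim auto
    then obtain \<eta> where \<eta>: "?T \<eta> < l" "0 < \<eta>" "\<eta> < ?W"
      using eventually_happens trivial_limit_at_left_real by blast
    obtain v where v: "v \<in> H" "\<And>x. \<bar>v x\<bar> \<le> 1" "\<eta> < ip v v" using cutoff_exists[OF \<eta>(3)] by blast
    then have vpos: "0 < ip v v" using \<eta> by simp
    have "?T (ip v v) \<le> ?T \<eta>"
      using v(3) \<eta>(2) U a by (intro mult_right_mono powr_mono2' mult_left_mono mult_pos_pos) auto
    then have Tl: "?T (ip v v) < l" using \<eta> by simp
    let ?e = "en v v / ip v v"
    have "(\<lambda>k. real k powr (- (1 / a)) * ?e + ?T (ip v v)) \<longlonglongrightarrow> 0 * ?e + ?T (ip v v)"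
      using a by (intro tendsto_intros tendsto_neg_powr filterlim_real_sequentially) auto
    then have "eventually (\<lambda>k. real k powr (- (1 / a)) * ?e + ?T (ip v v) < l) sequentially"
      using Tl by (intro order_tendstoD(2)) auto
    then show "eventually (\<lambda>k. real k powr (- 1 - 1 / a) * (\<Sum>i=1..k. ev i) < l) sequentially"
      using eventually_gt_at_top[of 0]
    proof eventually_elim
      case (elim k)
      have "real k powr (- 1 - 1 / a) * (\<Sum>i=1..k. ev i) \<le>
          real k powr (- 1 - 1 / a) * (real k * ?e + real k powr (1 + 1 / a) * ?T (ip v v))"
        using eigenvalue_sum_le[OF mono v(1,2) vpos elim(2)] by (intro mult_left_mono) (auto simp: a_def)
      also have "\<dots> = real k powr (- (1 / a)) * ?e + ?T (ip v v)"
      proof -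
        have "real k powr (- 1 - 1 / a) * real k = real k powr (- (1 / a))"
          using elim(2) powr_add[of "real k" "- 1 - 1 / a" 1] by simp
        then show ?thesis
          unfolding distrib_left cancel[OF elim(2)] by (simp add: mult.assoc[symmetric])
      qed
      finally show ?case using elim(1) by simp
    qed
  qed
qed

end

section \<open>Passing to Borel representatives\<close>

context sym_form
begin

definition span_upto :: "(nat \<Rightarrow> 'b \<Rightarrow> real) \<Rightarrow> nat \<Rightarrow> ('b \<Rightarrow> real) set" where
  "span_upto f m = {u. \<exists>c. u = (\<lambda>x. \<Sum>j<m. c j * f j x)}"

lemma span_upto_lincomb:
  assumes "finite I" "\<And>i. i \<in> I \<Longrightarrow> g i \<in> span_upto f m"
  shows "(\<lambda>x. \<Sum>i\<in>I. b i * g i x) \<in> span_upto f m"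
proof -
  from assms(2) have "\<forall>i\<in>I. \<exists>c. g i = (\<lambda>x. \<Sum>j<m. c j * f j x)" by (simp add: span_upto_def)
  then obtain c where c: "\<And>i. i \<in> I \<Longrightarrow> g i = (\<lambda>x. \<Sum>j<m. c i j * f j x)" by metis
  have "(\<Sum>i\<in>I. b i * g i x) = (\<Sum>j<m. (\<Sum>i\<in>I. b i * c i j) * f j x)" for x
  proof -
    have "(\<Sum>i\<in>I. b i * g i x) = (\<Sum>i\<in>I. \<Sum>j<m. b i * c i j * f j x)"
      using c by (simp add: sum_distrib_left mult.assoc)
    also have "\<dots> = (\<Sum>j<m. \<Sum>i\<in>I. b i * c i j * f j x)" by (rule sum.swap)
    finally show ?thesis by (simp add: sum_distrib_right)
  qed
  then show ?thesis
    unfolding span_upto_def by (intro CollectI exI[of _ "\<lambda>j. \<Sum>i\<in>I. b i * c i j"]) auto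
qed

text \<open>Independence is meant modulo \<open>B\<close>: only the trivial combination has
  \<open>B\<close>-norm zero, which for \<open>ip\<close> is independence almost everywhere. The
  span clause keeps \<open>g\<close> inside an eigenspace containing \<open>f\<close>; the last
  clause carries orthogonality to \<open>g\<close> over to \<open>f\<close>.\<close>

lemma gram_schmidt:
  assumes f: "\<And>i. i < m \<Longrightarrow> f i \<in> S"
    and indep: "\<And>c. B (\<lambda>x. \<Sum>i<m. c i * f i x) (\<lambda>x. \<Sum>i<m. c i * f i x) = 0 \<Longrightarrow> (\<forall>i<m. c i = 0)"
  shows "\<exists>g. (\<forall>i<m. g i \<in> span_upto f m) \<and> (\<forall>i<m. \<forall>j<m. B (g i) (g j) = (if i = j then 1 else 0)) \<and>
    (\<forall>u\<in>S. (\<forall>i<m. B u (g i) = 0) \<longrightarrow> (\<forall>i<m. B u (f i) = 0))"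
  using assms
proof (induction m)
  case 0
  then show ?case by simp
next
  case (Suc m)
  have ext: "(\<Sum>i<Suc m. (if i < m then c i else 0) * f i x) = (\<Sum>i<m. c i * f i x)" for c x
  proof -
    have "(\<Sum>i<m. (if i < m then c i else 0) * f i x) = (\<Sum>i<m. c i * f i x)" by (rule sum.cong) auto
    then show ?thesis by simp
  qed
  have "\<forall>i<m. c i = 0" if "B (\<lambda>x. \<Sum>i<m. c i * f i x) (\<lambda>x. \<Sum>i<m. c i * f i x) = 0" for c
    using Suc.prems(2)[of "\<lambda>i. if i < m then c i else 0"] that unfolding ext
    by (auto split: if_splits)
  from Suc.IH[OF Suc.prems(1) this] obtain g where
    g: "\<And>i. i < m \<Longrightarrow> g i \<in> span_upto f m"
    and on: "\<And>i j. i < m \<Longrightarrow> j < m \<Longrightarrow> B (g i) (g j) = (if i = j then 1 else 0)"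
    and orth: "\<And>u. u \<in> S \<Longrightarrow> (\<forall>i<m. B u (g i) = 0) \<Longrightarrow> (\<forall>i<m. B u (f i) = 0)"
    by (metis less_SucI)
  have span_S: "u \<in> S" if "u \<in> span_upto f n" "n \<le> Suc m" for u n
    using that Suc.prems(1) by (auto simp: span_upto_def intro!: lincomb_mem)
  have gS: "g i \<in> S" if "i < m" for i using span_S[OF g[OF that]] by simp
  have fS: "f m \<in> S" using Suc.prems(1) by simp
  have span_mono: "u \<in> span_upto f (Suc m)" if u: "u \<in> span_upto f m" for u
  proof -
    obtain c where "u = (\<lambda>x. \<Sum>j<m. c j * f j x)" using u by (auto simp: span_upto_def)
    then have "u = (\<lambda>x. \<Sum>i<Suc m. (if i < m then c i else 0) * f i x)" unfolding ext by simp
    then show ?thesis unfolding span_upto_def by (intro CollectI exI)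
  qed
  let ?p = "\<lambda>x. \<Sum>i\<in>{..<m}. B (f m) (g i) * g i x"
  define r where "r = (\<lambda>x. f m x - ?p x)"
  have on': "B (g i) (g j) = (if i = j then 1 else 0)" if "i \<in> {..<m}" "j \<in> {..<m}" for i j using on that by simp
  have gS': "g i \<in> S" if "i \<in> {..<m}" for i using gS that by simp
  note rem = orthonormal_remainder[of "{..<m}" g "f m", OF finite_lessThan gS' fS on', folded r_def]
  have pS: "?p \<in> S" using gS by (intro lincomb_mem) auto
  obtain b where b: "?p = (\<lambda>x. \<Sum>j<m. b j * f j x)"
    using span_upto_lincomb[where I = "{..<m}" and g = g and f = f and m = m and b = "\<lambda>i. B (f m) (g i)"] g by (auto simp: span_upto_def)
  define c where "c j = (if j = m then 1 else - b j)" for j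
  have r_eq: "r = (\<lambda>x. \<Sum>j<Suc m. c j * f j x)"
  proof
    fix x
    have "?p x = (\<Sum>j<m. b j * f j x)" using b by (rule fun_cong)
    moreover have "(\<Sum>j<m. c j * f j x) = (\<Sum>j<m. - (b j * f j x))"
      by (intro sum.cong) (auto simp: c_def)
    ultimately show "r x = (\<Sum>j<Suc m. c j * f j x)" by (simp add: r_def c_def sum_negf)
  qed
  \<comment> \<open>A remainder of norm zero would be a null combination of the \<open>f j\<close>
    with coefficient 1 at index \<open>m\<close>.\<close>
  have "B r r \<noteq> 0"
  proof
    assume "B r r = 0"
    then have "c m = 0" using Suc.prems(2)[of c] unfolding r_eq by blast
    then show False by (simp add: c_def)
  qed
  then have rr: "B r r > 0" using form_nonneg[OF rem(1)] by simp
  define n where "n = sqrt (B r r)"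
  have n: "n > 0" "n * n = B r r" using rr by (auto simp: n_def)
  define gm where "gm = (\<lambda>x. 1 / n * r x)"
  have gmS: "gm \<in> S" unfolding gm_def by (rule scale_mem[OF rem(1)])
  have gm_left: "B gm w = 1 / n * B r w" if "w \<in> S" for w
    unfolding gm_def by (rule scale_left[OF rem(1) that])
  define g' where "g' i = (if i < m then g i else gm)" for i
  have "B gm gm = 1"
  proof -
    have "B gm gm = 1 / n * (1 / n * B r r)"
      using gm_left[OF gmS] gm_left[OF rem(1)] form_sym[of r gm] by simp
    also have "\<dots> = 1" using rr n by (simp add: field_simps)
    finally show ?thesis .
  qed
  moreover have gmg: "B gm (g i) = 0" if "i < m" for i
    using gm_left[OF gS[OF that]] rem(2)[of i] that by simp
  moreover have "B (g i) gm = 0" if "i < m" for i using gmg[OF that] form_sym[of "g i" gm] by simp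
  ultimately have on'': "B (g' i) (g' j) = (if i = j then 1 else 0)" if "i < Suc m" "j < Suc m" for i j
    using that on by (auto simp: g'_def less_Suc_eq)
  have gm_span: "gm \<in> span_upto f (Suc m)"
    unfolding gm_def r_eq span_upto_def
    by (intro CollectI exI[of _ "\<lambda>j. 1 / n * c j"]) (simp only: sum_distrib_left mult.assoc)
  have g'_span: "g' i \<in> span_upto f (Suc m)" if "i < Suc m" for i
    using that g gm_span by (auto simp: g'_def intro: span_mono)
  have "B u (f i) = 0" if u: "u \<in> S" and u0: "\<forall>i<Suc m. B u (g' i) = 0" and i: "i < Suc m" for u i
  proof -
    have ug: "\<forall>i<m. B u (g i) = 0"
    proof (intro allI impI)
      fix i assume "i < m"
      then show "B u (g i) = 0" using u0[rule_format, of i] by (simp add: g'_def)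
    qed
    have "B u gm = 0" using u0[rule_format, of m] by (simp add: g'_def)
    then have "B u r = 0" using gm_left[OF u] n form_sym[of u gm] form_sym[of u r] by simp
    moreover have "B u r = B u (f m) - B u ?p"
      unfolding r_def by (rule diff_right[OF fS pS u])
    moreover have "B u ?p = 0"
      using lincomb_right[OF finite_lessThan gS' u, where c = "\<lambda>i. B (f m) (g i)"] ug by simp
    ultimately have "B u (f m) = 0" by simp
    then show ?thesis using orth[OF u ug] i by (auto simp: less_Suc_eq)
  qed
  then show ?case using g'_span on'' by (intro exI[of _ g']) blast
qed

end

section \<open>Lebesgue and Borel product measures\<close>

lemma sigma_finite_lebesgue: "sigma_finite_measure (lebesgue :: 'a::euclidean_space measure)"
proof
  obtain A :: "'a set set" where A: "countable A" "A \<subseteq> sets lborel" "\<Union>A = space lborel" "\<forall>a\<in>A. emeasure lborel a \<noteq> \<infinity>"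
    using lborel.sigma_finite_countable by blast
  then show "\<exists>A::'a set set. countable A \<and> A \<subseteq> sets lebesgue \<and> \<Union>A = space lebesgue \<and> (\<forall>a\<in>A. emeasure lebesgue a \<noteq> \<infinity>)"
    by (intro exI[of _ A]) (auto simp: sets_completionI_sets subset_iff)
qed

text \<open>The product of two completions is neither the Borel product nor its completion, so the
  integrals are compared through iterated ones: completing a measure changes neither the inner nor
  the outer integral. The hypothesis \<open>eq\<close> is iterated for the same reason. A general
  \<open>h\<close> covers the norm and the positive and negative parts at once.\<close>

lemma pair_lebesgue_transfer:
  fixes f g :: "'a::euclidean_space \<times> 'a \<Rightarrow> real"
  assumes f: "f \<in> borel_measurable (lebesgue \<Otimes>\<^sub>M lebesgue)" and g: "g \<in> borel_measurable (lborel \<Otimes>\<^sub>M lborel)"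
    and eq: "AE x in lborel. AE y in lborel. f (x, y) = g (x, y)"
  shows "integrable (lebesgue \<Otimes>\<^sub>M lebesgue) f \<longleftrightarrow> integrable (lborel \<Otimes>\<^sub>M lborel) g"
    and "integrable (lborel \<Otimes>\<^sub>M lborel) g \<Longrightarrow>
      integral\<^sup>L (lebesgue \<Otimes>\<^sub>M lebesgue) f = integral\<^sup>L (lborel \<Otimes>\<^sub>M lborel) g"
proof -
  interpret L: sigma_finite_measure "lebesgue :: 'a measure" by (rule sigma_finite_lebesgue)
  have nn: "(\<integral>\<^sup>+z. h (f z) \<partial>(lebesgue \<Otimes>\<^sub>M lebesgue)) = (\<integral>\<^sup>+z. h (g z) \<partial>(lborel \<Otimes>\<^sub>M lborel))"
    if [measurable]: "h \<in> borel_measurable borel" for h :: "real \<Rightarrow> ennreal"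
  proof -
    note [measurable] = f g
    have "(\<integral>\<^sup>+z. h (f z) \<partial>(lebesgue \<Otimes>\<^sub>M lebesgue)) = (\<integral>\<^sup>+x. (\<integral>\<^sup>+y. h (f (x, y)) \<partial>lebesgue) \<partial>lebesgue)"
      by (rule L.nn_integral_fst[symmetric]) measurable
    also have "\<dots> = (\<integral>\<^sup>+x. (\<integral>\<^sup>+y. h (f (x, y)) \<partial>lborel) \<partial>lborel)"
      by (simp only: nn_integral_completion)
    also have "\<dots> = (\<integral>\<^sup>+x. (\<integral>\<^sup>+y. h (g (x, y)) \<partial>lborel) \<partial>lborel)"
    proof (rule nn_integral_cong_AE, use eq in eventually_elim)
      fix x assume "AE y in lborel. f (x, y) = g (x, y)"
      then show "(\<integral>\<^sup>+y. h (f (x, y)) \<partial>lborel) = (\<integral>\<^sup>+y. h (g (x, y)) \<partial>lborel)"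
        by (intro nn_integral_cong_AE) auto
    qed
    also have "\<dots> = (\<integral>\<^sup>+z. h (g z) \<partial>(lborel \<Otimes>\<^sub>M lborel))"
      by (rule lborel.nn_integral_fst) measurable
    finally show ?thesis .
  qed
  show iff: "integrable (lebesgue \<Otimes>\<^sub>M lebesgue) f \<longleftrightarrow> integrable (lborel \<Otimes>\<^sub>M lborel) g"
    unfolding integrable_iff_bounded using f g nn[of "\<lambda>t. ennreal (norm t)"] by simp
  show "integral\<^sup>L (lebesgue \<Otimes>\<^sub>M lebesgue) f = integral\<^sup>L (lborel \<Otimes>\<^sub>M lborel) g"
    if "integrable (lborel \<Otimes>\<^sub>M lborel) g"
    using that iff nn[of ennreal] nn[of "\<lambda>t. ennreal (- t)"] by (simp add: real_lebesgue_integral_def)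
qed

context frac_domain
begin

lemma frac_form_measurable:
  assumes [measurable]: "u \<in> borel_measurable lebesgue" "w \<in> borel_measurable lebesgue"
  shows "(\<lambda>(x, y). (u x - u y) * (w x - w y) / kern (x - y)) \<in> borel_measurable (lebesgue \<Otimes>\<^sub>M lebesgue)"
proof -
  have [measurable]: "(\<lambda>x::'a. x) \<in> lebesgue \<rightarrow>\<^sub>M borel" by (rule measurable_completion) simp
  have "(\<lambda>z. (u (fst z) - u (snd z)) * (w (fst z) - w (snd z)) / kern (fst z - snd z)) \<in> borel_measurable (lebesgue \<Otimes>\<^sub>M lebesgue)"
    by measurable
  then show ?thesis by (simp add: case_prod_unfold)
qed

lemma form_transfer:
  assumes u: "u \<in> borel_measurable lebesgue" and w: "w \<in> borel_measurable lebesgue"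
    and u': "u' \<in> borel_measurable borel" and w': "w' \<in> borel_measurable borel"
    and eu: "AE x in lborel. u x = u' x" and ew: "AE x in lborel. w x = w' x"
  shows "integrable (lebesgue \<Otimes>\<^sub>M lebesgue) (\<lambda>(x, y). (u x - u y) * (w x - w y) / kern (x - y)) \<longleftrightarrow>
      integrable (lborel \<Otimes>\<^sub>M lborel) (\<lambda>(x, y). (u' x - u' y) * (w' x - w' y) / kern (x - y))"
    and "integrable (lborel \<Otimes>\<^sub>M lborel) (\<lambda>(x, y). (u' x - u' y) * (w' x - w' y) / kern (x - y)) \<Longrightarrow>
      frac_energy s u w = en u' w'"
proof -
  note [measurable] = u' w'
  have m: "(\<lambda>(x, y). (u' x - u' y) * (w' x - w' y) / kern (x - y)) \<in> borel_measurable (lborel \<Otimes>\<^sub>M lborel)"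
    by measurable
  have "AE x in lborel. u x = u' x \<and> w x = w' x" using eu ew by eventually_elim simp
  then have eq: "AE x in lborel. AE y in lborel. (\<lambda>(x, y). (u x - u y) * (w x - w y) / kern (x - y)) (x, y) =
      (\<lambda>(x, y). (u' x - u' y) * (w' x - w' y) / kern (x - y)) (x, y)"
  proof eventually_elim
    case (elim x)
    show ?case using eu ew by eventually_elim (use elim in simp)
  qed
  note t = pair_lebesgue_transfer[OF frac_form_measurable[OF u w] m eq]
  show "integrable (lebesgue \<Otimes>\<^sub>M lebesgue) (\<lambda>(x, y). (u x - u y) * (w x - w y) / kern (x - y)) \<longleftrightarrow>
      integrable (lborel \<Otimes>\<^sub>M lborel) (\<lambda>(x, y). (u' x - u' y) * (w' x - w' y) / kern (x - y))"
    by (rule t(1))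
  show "frac_energy s u w = en u' w'"
    if "integrable (lborel \<Otimes>\<^sub>M lborel) (\<lambda>(x, y). (u' x - u' y) * (w' x - w' y) / kern (x - y))"
    unfolding frac_energy_def en_def t(2)[OF that] ..
qed

lemma borel_representative:
  assumes u: "u \<in> frac_H0 s \<Omega>"
  shows "\<exists>u'\<in>H. AE x in lborel. u x = u' x"
proof -
  have um: "u \<in> borel_measurable lebesgue" and u0: "\<And>x. x \<notin> \<Omega> \<Longrightarrow> u x = 0"
    and ui: "integrable (lebesgue \<Otimes>\<^sub>M lebesgue) (\<lambda>(x, y). \<bar>u x - u y\<bar>\<^sup>2 / kern (x - y))"
    using u by (auto simp: frac_H0_def)
  obtain g where g: "g \<in> borel_measurable lborel" "AE x in lborel. u x = g x"
    using completion_ex_borel_measurable_real[OF um] by blast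
  \<comment> \<open>A Borel version may be nonzero outside \<open>\<Omega>\<close> on a null set;
    the indicator function restores vanishing at every such point.\<close>
  define u' where "u' x = g x * indicator \<Omega> x" for x
  have u'm: "u' \<in> borel_measurable borel" unfolding u'_def using g(1) by measurable
  have eq: "AE x in lborel. u x = u' x"
    using g(2) by eventually_elim (use u0 in \<open>auto simp: u'_def indicator_def\<close>)
  have "integrable (lborel \<Otimes>\<^sub>M lborel) (\<lambda>(x, y). (u' x - u' y) * (u' x - u' y) / kern (x - y))"
    using ui form_transfer(1)[OF um um u'm u'm eq eq] by (simp add: power2_eq_square)
  then have "u' \<in> H" using u'm by (auto simp: H_def u'_def power2_eq_square)
  then show ?thesis using eq by blast
qed

lemma H_subset_frac_H0:
  assumes u: "u \<in> H" shows "u \<in> frac_H0 s \<Omega>"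
proof -
  have um: "u \<in> borel_measurable lebesgue" using HD(1)[OF u] by (intro measurable_completion) simp
  show ?thesis
    using form_transfer(1)[OF um um HD(1)[OF u] HD(1)[OF u]] HD[OF u] um
    by (simp add: frac_H0_def power2_eq_square)
qed

lemma frac_energy_eq:
  assumes u: "u \<in> frac_H0 s \<Omega>" and w: "w \<in> frac_H0 s \<Omega>" and u': "u' \<in> H" and w': "w' \<in> H"
    and "AE x in lborel. u x = u' x" "AE x in lborel. w x = w' x"
  shows "frac_energy s u w = en u' w'" and "(LINT x:\<Omega>|lebesgue. u x * w x) = ip u' w'"
proof -
  have um: "u \<in> borel_measurable lebesgue" and wm: "w \<in> borel_measurable lebesgue"
    using u w by (auto simp: frac_H0_def)
  show "frac_energy s u w = en u' w'"
    by (rule form_transfer(2)[OF um wm HD(1)[OF u'] HD(1)[OF w'] assms(5,6) H_integrable_mult[OF u' w']])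
  have m: "(\<lambda>x. u' x * w' x) \<in> borel_measurable lborel" using HD(1)[OF u'] HD(1)[OF w'] by measurable
  have "(LINT x:\<Omega>|lebesgue. u x * w x) = (LINT x|lebesgue. u x * w x)"
    unfolding set_lebesgue_integral_def
    using u by (intro Bochner_Integration.integral_cong refl) (auto simp: frac_H0_def indicator_def)
  also have "\<dots> = (LINT x|lebesgue. u' x * w' x)"
  proof (rule integral_cong_AE)
    have "AE x in lborel. u x * w x = u' x * w' x" using assms(5,6) by eventually_elim simp
    then show "AE x in lebesgue. u x * w x = u' x * w' x" by (rule AE_completion)
    show "(\<lambda>x. u x * w x) \<in> borel_measurable lebesgue" using um wm by measurable
    show "(\<lambda>x. u' x * w' x) \<in> borel_measurable lebesgue" by (rule measurable_completion[OF m])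
  qed
  also have "\<dots> = (LBINT x. u' x * w' x)" by (rule integral_completion[OF m])
  finally show "(LINT x:\<Omega>|lebesgue. u x * w x) = ip u' w'" by (simp add: ip_def)
qed

section \<open>Eigenspaces and orthonormal eigenfunctions\<close>

definition eigenspace :: "real \<Rightarrow> ('a \<Rightarrow> real) set" where
  "eigenspace \<mu> = {u \<in> H. \<forall>w\<in>H. en u w = \<mu> * ip u w}"

lemma eigenspace_representative:
  assumes u: "u \<in> frac_eigenspace s \<Omega> \<mu>" and u': "u' \<in> H" and eq: "AE x in lborel. u x = u' x"
  shows "u' \<in> eigenspace \<mu>"
proof -
  have uH: "u \<in> frac_H0 s \<Omega>" using u by (simp add: frac_eigenspace_def)
  have "en u' w = \<mu> * ip u' w" if w: "w \<in> H" for w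
    using u frac_energy_eq[OF uH H_subset_frac_H0[OF w] u' w eq AE_I2[OF refl]] H_subset_frac_H0[OF w]
    by (simp add: frac_eigenspace_def)
  then show ?thesis using u' by (simp add: eigenspace_def)
qed

lemma eigenspace_frac_eigenspace:
  assumes u: "u \<in> eigenspace \<mu>" shows "u \<in> frac_eigenspace s \<Omega> \<mu>"
proof -
  have uH: "u \<in> H" using u by (simp add: eigenspace_def)
  have "frac_energy s u w = \<mu> * (LINT x:\<Omega>|lebesgue. u x * w x)" if w: "w \<in> frac_H0 s \<Omega>" for w
  proof -
    obtain w' where w': "w' \<in> H" "AE x in lborel. w x = w' x" using borel_representative[OF w] by blast
    show ?thesis
      using frac_energy_eq[OF H_subset_frac_H0[OF uH] w uH w'(1) AE_I2[OF refl] w'(2)] u w'(1)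
      by (simp add: eigenspace_def)
  qed
  then show ?thesis using H_subset_frac_H0[OF uH] by (simp add: frac_eigenspace_def)
qed

lemma ip_zero_iff:
  assumes "u \<in> L2" shows "ip u u = 0 \<longleftrightarrow> (AE x in lborel. u x = 0)"
  unfolding ip_self using integral_nonneg_eq_0_iff_AE[OF L2D(3)[OF assms]] by simp

lemma eigenspace_lincomb:
  assumes "finite I" "\<And>i. i \<in> I \<Longrightarrow> f i \<in> eigenspace \<mu>"
  shows "(\<lambda>x. \<Sum>i\<in>I. c i * f i x) \<in> eigenspace \<mu>"
proof -
  have fH: "f i \<in> H" if "i \<in> I" for i using assms(2)[OF that] by (simp add: eigenspace_def)
  have "en (\<lambda>x. \<Sum>i\<in>I. c i * f i x) w = \<mu> * ip (\<lambda>x. \<Sum>i\<in>I. c i * f i x) w" if w: "w \<in> H" for w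
  proof -
    have "en (\<lambda>x. \<Sum>i\<in>I. c i * f i x) w = (\<Sum>i\<in>I. c i * en (f i) w)"
      by (rule H.lincomb_left[OF assms(1) fH w])
    also have "\<dots> = (\<Sum>i\<in>I. c i * (\<mu> * ip (f i) w))"
      using assms(2) w by (intro sum.cong) (auto simp: eigenspace_def)
    also have "\<dots> = \<mu> * (\<Sum>i\<in>I. c i * ip (f i) w)"
      by (simp add: sum_distrib_left mult.left_commute)
    also have "(\<Sum>i\<in>I. c i * ip (f i) w) = ip (\<lambda>x. \<Sum>i\<in>I. c i * f i x) w"
      by (rule L2.lincomb_left[OF assms(1) H_L2[OF fH] H_L2[OF w], symmetric])
    finally show ?thesis .
  qed
  then show ?thesis using H.lincomb_mem[OF assms(1) fH] by (simp add: eigenspace_def)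
qed

text \<open>The spanning clause of \<open>frac_multiplicity\<close> is recast as the absence of an
  eigenfunction of nonzero norm orthogonal to the basis, a form insensitive to changes on null sets
  and ready for \<open>phi_complete\<close>.\<close>

lemma eigenspace_orthonormal_basis:
  assumes "frac_multiplicity s \<Omega> \<mu> m"
  shows "\<exists>g. (\<forall>i<m. g i \<in> eigenspace \<mu>) \<and> (\<forall>i<m. \<forall>j<m. ip (g i) (g j) = (if i = j then 1 else 0)) \<and>
    (\<forall>u\<in>eigenspace \<mu>. (\<forall>i<m. ip u (g i) = 0) \<longrightarrow> ip u u = 0)"
proof -
  obtain \<phi> where \<phi>: "\<And>i. i < m \<Longrightarrow> \<phi> i \<in> frac_eigenspace s \<Omega> \<mu>"
    and ind: "\<And>c. (AE x in lebesgue. (\<Sum>i<m. c i * \<phi> i x) = 0) \<Longrightarrow> (\<forall>i<m. c i = 0)"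
    and spn: "\<And>u. u \<in> frac_eigenspace s \<Omega> \<mu> \<Longrightarrow> \<exists>c. AE x in lebesgue. u x = (\<Sum>i<m. c i * \<phi> i x)"
    using assms unfolding frac_multiplicity_def by blast
  have "\<forall>i. \<exists>f. i < m \<longrightarrow> f \<in> H \<and> (AE x in lborel. \<phi> i x = f x)"
    using borel_representative \<phi> by (fastforce simp: frac_eigenspace_def)
  then obtain f where f: "\<And>i. i < m \<Longrightarrow> f i \<in> H" and feq: "\<And>i. i < m \<Longrightarrow> AE x in lborel. \<phi> i x = f i x"
    by metis
  have fE: "f i \<in> eigenspace \<mu>" if "i < m" for i
    by (rule eigenspace_representative[OF \<phi>[OF that] f[OF that] feq[OF that]])
  have fL: "f i \<in> L2" if "i < m" for i by (rule H_L2[OF f[OF that]])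
  \<comment> \<open>Uniting finitely many exceptional sets gives one null set that serves all
    coefficient vectors \<open>c\<close> simultaneously.\<close>
  have "AE x in lborel. \<forall>i\<in>{..<m}. \<phi> i x = f i x"
    by (rule AE_finite_allI) (use feq in auto)
  then have sums: "AE x in lborel. \<forall>c. (\<Sum>i<m. c i * \<phi> i x) = (\<Sum>i<m. c i * f i x)"
    by eventually_elim auto
  have indep: "\<forall>i<m. c i = 0" if "ip (\<lambda>x. \<Sum>i<m. c i * f i x) (\<lambda>x. \<Sum>i<m. c i * f i x) = 0" for c
  proof (rule ind, rule AE_completion)
    have "(\<lambda>x. \<Sum>i<m. c i * f i x) \<in> L2" using fL by (intro L2.lincomb_mem) auto
    then have "AE x in lborel. (\<Sum>i<m. c i * f i x) = 0" using that by (simp add: ip_zero_iff)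
    then show "AE x in lborel. (\<Sum>i<m. c i * \<phi> i x) = 0" using sums by eventually_elim simp
  qed
  obtain g where g: "\<And>i. i < m \<Longrightarrow> g i \<in> L2.span_upto f m"
    and on: "\<And>i j. i < m \<Longrightarrow> j < m \<Longrightarrow> ip (g i) (g j) = (if i = j then 1 else 0)"
    and orth: "\<And>u. u \<in> L2 \<Longrightarrow> (\<forall>i<m. ip u (g i) = 0) \<Longrightarrow> (\<forall>i<m. ip u (f i) = 0)"
    using L2.gram_schmidt[of m f, OF fL indep] by blast
  have gE: "g i \<in> eigenspace \<mu>" if "i < m" for i
    using g[OF that] fE by (auto simp: L2.span_upto_def intro!: eigenspace_lincomb)
  have "ip u u = 0" if u: "u \<in> eigenspace \<mu>" and ug: "\<forall>i<m. ip u (g i) = 0" for u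
  proof -
    have uL: "u \<in> L2" using u H_L2 by (simp add: eigenspace_def)
    obtain c where "AE x in lebesgue. u x = (\<Sum>i<m. c i * \<phi> i x)"
      using spn[OF eigenspace_frac_eigenspace[OF u]] by blast
    then have "AE x in lborel. u x = (\<Sum>i<m. c i * \<phi> i x)" by (simp add: AE_completion_iff)
    then have c: "AE x in lborel. u x = (\<Sum>i<m. c i * f i x)" using sums by eventually_elim simp
    let ?p = "\<lambda>x. \<Sum>i<m. c i * f i x"
    have pL: "?p \<in> L2" using fL by (intro L2.lincomb_mem) auto
    have "ip u u = ip u ?p"
      unfolding ip_def
    proof (rule integral_cong_AE)
      show "AE x in lborel. u x * u x = u x * ?p x" using c by eventually_elim simp
    qed (use L2D(1)[OF uL] L2D(1)[OF pL] in measurable)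
    also have "\<dots> = (\<Sum>i<m. c i * ip u (f i))" using fL uL by (intro L2.lincomb_right) auto
    also have "\<dots> = 0" using orth[OF uL ug] by simp
    finally show ?thesis .
  qed
  then show ?thesis using gE on by (intro exI[of _ g]) blast
qed

text \<open>For each value \<open>\<mu>\<close> the bijection \<open>h \<mu>\<close> distributes an
  orthonormal basis of the eigenspace among the indices with \<open>ev i = \<mu>\<close>; different
  values give orthogonal functions because both forms are symmetric. For a \<open>\<mu>\<close> that
  does not occur the basis is empty, and completeness says that no eigenfunction of nonzero norm
  exists.\<close>

theorem eigenvalue_seq_spectrum:
  fixes ev :: "nat \<Rightarrow> real"
  assumes "frac_eigenvalue_seq s \<Omega> ev"
  shows "\<exists>\<phi>. frac_spectrum s \<Omega> ev \<phi>"
proof -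
  define M where "M \<mu> = {i. 1 \<le> i \<and> ev i = \<mu>}" for \<mu>
  have fin: "finite (M \<mu>)" and mult: "frac_multiplicity s \<Omega> \<mu> (card (M \<mu>))" for \<mu>
    using assms by (auto simp: frac_eigenvalue_seq_def M_def)
  obtain g where gE: "\<And>\<mu> i. i < card (M \<mu>) \<Longrightarrow> g \<mu> i \<in> eigenspace \<mu>"
    and on: "\<And>\<mu> i j. i < card (M \<mu>) \<Longrightarrow> j < card (M \<mu>) \<Longrightarrow> ip (g \<mu> i) (g \<mu> j) = (if i = j then 1 else 0)"
    and compl: "\<And>\<mu> u. u \<in> eigenspace \<mu> \<Longrightarrow> (\<forall>i<card (M \<mu>). ip u (g \<mu> i) = 0) \<Longrightarrow> ip u u = 0"
    using eigenspace_orthonormal_basis[OF mult] by metis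
  obtain h where h: "\<And>\<mu>. bij_betw (h \<mu>) (M \<mu>) {0..<card (M \<mu>)}"
    using ex_bij_betw_finite_nat[OF fin] by metis
  define \<phi> where "\<phi> i = g (ev i) (h (ev i) i)" for i
  have hM: "h (ev i) i < card (M (ev i))" if "1 \<le> i" for i
    using bij_betwE[OF h, of "ev i"] that by (auto simp: M_def)
  have \<phi>E: "\<phi> i \<in> eigenspace (ev i)" if "1 \<le> i" for i
    unfolding \<phi>_def by (rule gE[OF hM[OF that]])
  have \<phi>H: "\<phi> i \<in> H" if "1 \<le> i" for i using \<phi>E[OF that] by (simp add: eigenspace_def)
  have eig: "en (\<phi> i) w = ev i * ip (\<phi> i) w" if "1 \<le> i" "w \<in> H" for i w
    using \<phi>E[OF that(1)] that(2) by (simp add: eigenspace_def)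
  have "frac_spectrum s \<Omega> ev \<phi>"
  proof unfold_locales
    fix i j :: nat assume i: "1 \<le> i" and j: "1 \<le> j"
    show "ip (\<phi> i) (\<phi> j) = (if i = j then 1 else 0)"
    proof (cases "ev i = ev j")
      case True
      have "h (ev i) i = h (ev i) j \<longleftrightarrow> i = j"
        using inj_onD[OF bij_betw_imp_inj_on[OF h[of "ev i"]], of i j] i j True by (auto simp: M_def)
      then show ?thesis
        using on[OF hM[OF i], of "h (ev i) j"] hM[OF j] True by (simp add: \<phi>_def)
    next
      case False
      have "ev i * ip (\<phi> i) (\<phi> j) = en (\<phi> i) (\<phi> j)" by (rule eig[OF i \<phi>H[OF j], symmetric])
      also have "\<dots> = en (\<phi> j) (\<phi> i)" by (rule H.form_sym)
      also have "\<dots> = ev j * ip (\<phi> j) (\<phi> i)" by (rule eig[OF j \<phi>H[OF i]])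
      also have "ip (\<phi> j) (\<phi> i) = ip (\<phi> i) (\<phi> j)" by (rule L2.form_sym)
      finally have "ev i * ip (\<phi> i) (\<phi> j) = ev j * ip (\<phi> i) (\<phi> j)" .
      then show ?thesis using False by auto
    qed
  next
    fix u \<mu> assume u: "u \<in> H" and e: "\<And>w. w \<in> H \<Longrightarrow> en u w = \<mu> * ip u w"
      and o: "\<And>i. 1 \<le> i \<Longrightarrow> ip u (\<phi> i) = 0"
    have "ip u (g \<mu> k) = 0" if k: "k < card (M \<mu>)" for k
    proof -
      have "k \<in> h \<mu> ` M \<mu>" using bij_betw_imp_surj_on[OF h[of \<mu>]] k by simp
      then obtain i where "i \<in> M \<mu>" "k = h \<mu> i" by blast
      then show ?thesis using o[of i] by (auto simp: M_def \<phi>_def)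
    qed
    then show "ip u u = 0" using compl[of u \<mu>] u e by (simp add: eigenspace_def)
  qed (use \<phi>H eig in auto)
  then show ?thesis by blast
qed

end

theorem corollary1p2:
  fixes \<Omega> :: "(real ^ 'n) set" and s R c\<^sub>0 :: real and ev :: "nat \<Rightarrow> real"
  assumes "0 < s" and "s < 1"
    and "open \<Omega>" and "connected \<Omega>" and "\<Omega> \<noteq> {}" and "bounded \<Omega>"
    and "0 < R" and "ball 0 R \<subseteq> \<Omega>" and "\<Omega> \<subseteq> ball 0 (2 * R)"
    and "0 < c\<^sub>0"
    and "\<And>t. 0 < t \<Longrightarrow>
           hausdorff_measure (CARD('n) - 1) {x \<in> \<Omega>. infdist x (frontier \<Omega>) = t}
             \<le> ennreal (c\<^sub>0 * R ^ (CARD('n) - 1))"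
    and "frac_eigenvalue_seq s \<Omega> ev"
  shows "(\<lambda>k. real k powr (- 1 - 2 * s / real CARD('n)) * (\<Sum>i = 1..k. ev i)) \<longlonglongrightarrow>
           (2 * pi) powr (2 * s) * real CARD('n) / (real CARD('n) + 2 * s) *
             (measure lebesgue (ball (0 :: real ^ 'n) 1) * measure lebesgue \<Omega>)
               powr (- (2 * s / real CARD('n)))"
proof -
  interpret frac_domain s \<Omega> using assms by unfold_locales
  obtain \<phi> where "frac_spectrum s \<Omega> ev \<phi>"
    using eigenvalue_seq_spectrum[OF \<open>frac_eigenvalue_seq s \<Omega> ev\<close>] by blast
  then interpret frac_spectrum s \<Omega> ev \<phi> .
  let ?N = "real CARD('n)" and ?W = "measure lborel \<Omega>"
  define U where "U = unit_ball_vol ?N"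
  have N: "0 < ?N" and U: "0 < U" by (simp_all add: U_def)
  have mono: "mono_on {1..} ev"
    using \<open>frac_eigenvalue_seq s \<Omega> ev\<close> by (simp add: frac_eigenvalue_seq_def)
  \<comment> \<open>The inscribed ball supplies the positive volume that
    \<open>eigenvalue_sum_asymptotics\<close> asks for.\<close>
  have "0 < emeasure lborel (ball (0 :: real ^ 'n) R)"
    using \<open>0 < R\<close> by (simp add: emeasure_ball)
  also have "\<dots> \<le> emeasure lborel \<Omega>"
    using \<open>ball 0 R \<subseteq> \<Omega>\<close> by (intro emeasure_mono) auto
  finally have W: "0 < ?W"
    using emeasure_dom by (simp add: measure_def enn2real_positive_iff)
  have B: "measure lebesgue (ball (0 :: real ^ 'n) 1) = U"
    using content_ball[of 1 "0 :: real ^ 'n"] by (simp add: U_def)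
  \<comment> \<open>With this \<open>a\<close> the exponent \<open>1 / a\<close> is
    \<open>2 * s / ?N\<close>, and the denominator \<open>(2 * pi) ^ CARD('n)\<close> turns into the
    factor \<open>(2 * pi) powr (2 * s)\<close> of the limit.\<close>
  define a where "a = ?N / (2 * s)"
  have inv_a: "1 / a = 2 * s / ?N" by (simp add: a_def)
  have "(U * ?W / (2 * pi) ^ CARD('n)) powr (- (1 / a)) = (U * ?W) powr (- (1 / a)) * (2 * pi) powr (2 * s)"
  proof -
    have "(2 * pi) ^ CARD('n) = (2 * pi) powr ?N" by (simp add: powr_realpow)
    moreover have "?N * (- (1 / a)) = - (2 * s)" using N by (simp add: inv_a)
    ultimately have "((2 * pi) ^ CARD('n)) powr (- (1 / a)) = (2 * pi) powr (- (2 * s))"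
      by (simp only: powr_powr)
    then show ?thesis
      unfolding powr_divide by (simp add: powr_minus_divide)
  qed
  moreover have "a / (1 + a) = ?N / (?N + 2 * s)"
    using \<open>0 < s\<close> N by (simp add: a_def field_simps)
  moreover have "(\<lambda>k. real k powr (- 1 - 1 / a) * (\<Sum>i = 1..k. ev i)) \<longlonglongrightarrow>
      (U * ?W / (2 * pi) ^ CARD('n)) powr (- (1 / a)) * (a / (1 + a))"
    using eigenvalue_sum_asymptotics[OF mono W] by (simp add: a_def U_def)
  ultimately have "(\<lambda>k. real k powr (- 1 - 1 / a) * (\<Sum>i = 1..k. ev i)) \<longlonglongrightarrow>
      (2 * pi) powr (2 * s) * ?N / (?N + 2 * s) * (U * ?W) powr (- (1 / a))"
    by (simp add: mult_ac)
  then show ?thesis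
    unfolding B inv_a using dom_sets by simp
qed

end
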